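(* For $i=1,\dots,d$ consider elements of $\mathcal{K}_d$ of the form $$f_i=1+\sum_{j=1}^{n_i}a_{ij}x_i^j,\qquad n_i\ge 1,\quad a_{ij}\in U(\mathfrak{h}),\quad a_{in_i}\in\mathbb{C}\setminus\{0\},\qquad (\ast)$$ and let $S_{f_1,\dots,f_d}=\mathcal{K}_d\big/\big(\sum_{i=1}^d\mathcal{K}_df_i\big)$, a (left) $\mathcal{K}_d$-module. Then: (1) For all $f_1,\dots,f_d$ of the form $(\ast)$, any quotient $\mathcal{K}_d$-module of $S_{f_1,\dots,f_d}$ is a finitely generated $U(\mathfrak{h})$-module. (2) For all $f_1,\dots,f_d$ of the form $(\ast)$, the $\mathcal{K}_d$-module $S_{f_1,\dots,f_d}$ has finite composition length. (3) Any simple $\mathcal{K}_d$-module that is a finitely generated $U(\mathfrak{h})$-module is isomorphic to a quotient of $S_{f_1,\dots,f_d}$ for some $f_1,\dots,f_d\in\mathcal{K}_d$ of the form $(\ast)$.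
   Context: $d\ge 1$ is a fixed integer and everything is over $\mathbb{C}$. $\mathcal{K}_d=\mathbb{C}[x_1^{\pm1},\dots,x_d^{\pm1},\partial_1,\dots,\partial_d]$ is the Weyl algebra: the unital associative algebra of differential operators on $\mathbb{C}[x_1^{\pm1},\dots,x_d^{\pm1}]$ generated by multiplications by $x_i^{\pm1}$ and the derivations $\partial_i=x_i\frac{\partial}{\partial x_i}$ (so $\partial_ix_j-x_j\partial_i=\delta_{ij}x_j$). $\mathfrak{h}=\mathrm{span}\{\partial_1,\dots,\partial_d\}$ and $U(\mathfrak{h})=\mathbb{C}[\partial_1,\dots,\partial_d]\subset\mathcal{K}_d$. *)

theory Defs
  imports
    "HOL.Complex"
    "HOL-Library.Poly_Mapping"
    "HOL-Algebra.Module"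
    "HOL-Algebra.AbelCoset"
    "HOL-Algebra.Generated_Rings"
begin

section \<open>Left modules over a not necessarily commutative ring\<close>

text \<open>HOL-Algebra's locale \<^locale>\<open>module\<close> demands a commutative ring of scalars.  The axioms below are
  the same over an arbitrary unital ring.  We keep the record type for modules (its fields
  \<^const>\<open>mult\<close> and \<^const>\<open>one\<close> play no role) and the locale \<^locale>\<open>submodule\<close>, whose definition does not
  use commutativity.\<close>

locale left_module = R?: ring R + M?: abelian_group M
  for R :: "('a, 'r) ring_scheme" (structure) and M :: "('a, 'b, 'm) module_scheme" (structure) +
  assumes smult_closed [simp, intro]:
      "\<lbrakk>a \<in> carrier R; x \<in> carrier M\<rbrakk> \<Longrightarrow> a \<odot>\<^bsub>M\<^esub> x \<in> carrier M"
    and smult_l_distr: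
      "\<lbrakk>a \<in> carrier R; b \<in> carrier R; x \<in> carrier M\<rbrakk>
        \<Longrightarrow> (a \<oplus>\<^bsub>R\<^esub> b) \<odot>\<^bsub>M\<^esub> x = a \<odot>\<^bsub>M\<^esub> x \<oplus>\<^bsub>M\<^esub> b \<odot>\<^bsub>M\<^esub> x"
    and smult_r_distr:
      "\<lbrakk>a \<in> carrier R; x \<in> carrier M; y \<in> carrier M\<rbrakk>
        \<Longrightarrow> a \<odot>\<^bsub>M\<^esub> (x \<oplus>\<^bsub>M\<^esub> y) = a \<odot>\<^bsub>M\<^esub> x \<oplus>\<^bsub>M\<^esub> a \<odot>\<^bsub>M\<^esub> y"
    and smult_assoc1:
      "\<lbrakk>a \<in> carrier R; b \<in> carrier R; x \<in> carrier M\<rbrakk>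
        \<Longrightarrow> (a \<otimes>\<^bsub>R\<^esub> b) \<odot>\<^bsub>M\<^esub> x = a \<odot>\<^bsub>M\<^esub> (b \<odot>\<^bsub>M\<^esub> x)"
    and smult_one [simp]: "x \<in> carrier M \<Longrightarrow> \<one>\<^bsub>R\<^esub> \<odot>\<^bsub>M\<^esub> x = x"

definition regular_module :: "('a, 'r) ring_scheme \<Rightarrow> ('a, 'a) module" where
  "regular_module R =
    \<lparr>carrier = carrier R, mult = mult R, one = one R, zero = zero R, add = add R, smult = mult R\<rparr>"

text \<open>For a submodule \<open>N\<close> the union below is the single coset of \<open>r x\<close>, for any
  representative \<open>x\<close> of \<open>A\<close>.\<close>

definition quotient_module :: "('a, 'b, 'm) module_scheme \<Rightarrow> 'b set \<Rightarrow> ('a, 'b set) module" where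
  "quotient_module M N =
    \<lparr>carrier = a_rcosets\<^bsub>M\<^esub> N, mult = undefined, one = undefined, zero = N, add = set_add M,
     smult = (\<lambda>r A. \<Union>x\<in>A. N +>\<^bsub>M\<^esub> (r \<odot>\<^bsub>M\<^esub> x))\<rparr>"

definition left_ideal_sum :: "('a, 'r) ring_scheme \<Rightarrow> ('i::finite \<Rightarrow> 'a) \<Rightarrow> 'a set" where
  "left_ideal_sum R f = {\<Oplus>\<^bsub>R\<^esub>i\<in>UNIV. g i \<otimes>\<^bsub>R\<^esub> f i | g. g \<in> UNIV \<rightarrow> carrier R}"

definition finitely_generated_module ::
    "('a, 'r) ring_scheme \<Rightarrow> ('a, 'b, 'm) module_scheme \<Rightarrow> bool" where
  "finitely_generated_module R M \<longleftrightarrow> left_module R M \<and>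
    (\<exists>B. finite B \<and> B \<subseteq> carrier M \<and>
      (\<forall>m\<in>carrier M. \<exists>u\<in>B \<rightarrow> carrier R. m = (\<Oplus>\<^bsub>M\<^esub>b\<in>B. u b \<odot>\<^bsub>M\<^esub> b)))"

definition simple_module :: "('a, 'r) ring_scheme \<Rightarrow> ('a, 'b, 'm) module_scheme \<Rightarrow> bool" where
  "simple_module R M \<longleftrightarrow> left_module R M \<and> carrier M \<noteq> {\<zero>\<^bsub>M\<^esub>} \<and>
    (\<forall>N. submodule N R M \<longrightarrow> N = {\<zero>\<^bsub>M\<^esub>} \<or> N = carrier M)"

definition finite_composition_length ::
    "('a, 'r) ring_scheme \<Rightarrow> ('a, 'b, 'm) module_scheme \<Rightarrow> bool" where
  "finite_composition_length R M \<longleftrightarrow> left_module R M \<and>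
    (\<exists>(n::nat) N. N 0 = {\<zero>\<^bsub>M\<^esub>} \<and> N n = carrier M \<and> (\<forall>i\<le>n. submodule (N i) R M) \<and>
      (\<forall>i<n. N i \<subseteq> N (Suc i) \<and>
        simple_module R (quotient_module (M\<lparr>carrier := N (Suc i)\<rparr>) (N i))))"

definition module_isomorphic ::
    "('a, 'r) ring_scheme \<Rightarrow> ('a, 'b, 'm) module_scheme \<Rightarrow> ('a, 'c, 'n) module_scheme \<Rightarrow> bool" where
  "module_isomorphic R M M' \<longleftrightarrow> (\<exists>h. bij_betw h (carrier M) (carrier M') \<and>
    (\<forall>x\<in>carrier M. \<forall>y\<in>carrier M. h (x \<oplus>\<^bsub>M\<^esub> y) = h x \<oplus>\<^bsub>M'\<^esub> h y) \<and>
    (\<forall>r\<in>carrier R. \<forall>x\<in>carrier M. h (r \<odot>\<^bsub>M\<^esub> x) = r \<odot>\<^bsub>M'\<^esub> h x))"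


section \<open>The Weyl algebra of the torus\<close>

text \<open>Laurent polynomials in variables indexed by the finite type \<open>'d\<close>, so that
  $d$ is the cardinality of \<open>'d\<close>: finitely supported functions from the exponent lattice to the
  complex numbers, with the convolution product of \<^theory>\<open>HOL-Library.Poly_Mapping\<close>.\<close>

type_synonym 'd laurent = "('d \<Rightarrow>\<^sub>0 int) \<Rightarrow>\<^sub>0 complex"
type_synonym 'd laurent_op = "'d laurent \<Rightarrow> 'd laurent"

definition scalar_op :: "complex \<Rightarrow> 'd laurent_op" where
  "scalar_op c p = Poly_Mapping.single 0 c * p"

definition X_op :: "'d \<Rightarrow> 'd laurent_op" where
  "X_op i p = Poly_Mapping.single (Poly_Mapping.single i 1) 1 * p"

definition X_inv_op :: "'d \<Rightarrow> 'd laurent_op" where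
  "X_inv_op i p = Poly_Mapping.single (Poly_Mapping.single i (- 1)) 1 * p"

text \<open>The Euler operator $x_i\,\partial/\partial x_i$ multiplies the monomial of exponent
  $\alpha$ by $\alpha_i$.\<close>

definition euler_op :: "'d \<Rightarrow> 'd laurent_op" where
  "euler_op i p = Poly_Mapping.mapp (\<lambda>\<alpha> c. of_int (Poly_Mapping.lookup \<alpha> i) * c) p"

definition laurent_End :: "'d laurent_op ring" where
  "laurent_End =
    \<lparr>carrier = {T. (\<forall>p q. T (p + q) = T p + T q) \<and> (\<forall>c p. T (scalar_op c p) = scalar_op c (T p))},
     mult = (\<circ>), one = id, zero = (\<lambda>_. 0), add = (\<lambda>S T p. S p + T p)\<rparr>"

text \<open>The unital complex subalgebra generated by \<open>G\<close> is the subring generated by \<open>G\<close> and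
  the scalars.\<close>

definition laurent_op_algebra :: "'d laurent_op set \<Rightarrow> 'd laurent_op ring" where
  "laurent_op_algebra G =
    laurent_End\<lparr>carrier := generate_ring laurent_End (range scalar_op \<union> G)\<rparr>"

definition weyl_algebra :: "'d laurent_op ring" where
  "weyl_algebra = laurent_op_algebra (range X_op \<union> range X_inv_op \<union> range euler_op)"

definition U_h :: "'d laurent_op ring" where
  "U_h = laurent_op_algebra (range euler_op)"

definition star_form :: "'d \<Rightarrow> 'd laurent_op \<Rightarrow> bool" where
  "star_form i f \<longleftrightarrow> (\<exists>(n::nat) a. n \<ge> 1 \<and> (\<forall>j\<in>{1..n}. a j \<in> carrier U_h) \<and>
    (\<exists>c. c \<noteq> 0 \<and> a n = scalar_op c) \<and>
    f = \<one>\<^bsub>weyl_algebra\<^esub> \<oplus>\<^bsub>weyl_algebra\<^esub>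
        (\<Oplus>\<^bsub>weyl_algebra\<^esub>j\<in>{1..n}. a j \<otimes>\<^bsub>weyl_algebra\<^esub> X_op i [^]\<^bsub>weyl_algebra\<^esub> j))"

definition S_module :: "('d::finite \<Rightarrow> 'd laurent_op) \<Rightarrow> ('d laurent_op, 'd laurent_op set) module" where
  "S_module f = quotient_module (regular_module weyl_algebra) (left_ideal_sum weyl_algebra f)"

end

theory Submission
  imports Defs "HOL-Computational_Algebra.Polynomial"
begin

text \<open>
  As a left module over \<open>U = U_h\<close>, an integral domain of polynomial functions on the exponent lattice, the
  Weyl algebra is free on the Laurent monomials, and conjugation by a monomial shifts the argument of
  a polynomial function.

  (1) Multiplying \<open>f\<^sub>i\<close> by a monomial \<open>x\<^sup>\<alpha>\<close> gives a relation between \<open>x\<^sup>\<alpha>, \<dots>, x\<^sup>\<alpha>x\<^sub>i\<^sup>n\<close> (with \<open>n = n\<^sub>i\<close>)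
  whose two extreme coefficients are nonzero constants, so modulo the \<open>f\<^sub>i\<close> every monomial is a
  \<open>U\<close>-combination of the monomials in a finite box.

  (2) Let \<open>M\<close> be finitely generated over \<open>U\<close> and \<open>N\<close> a submodule over the Weyl algebra. A single nonzero
  element of \<open>U\<close> annihilates the \<open>U\<close>-torsion of \<open>M/N\<close>, and the annihilator of the torsion is stable
  under all shifts, hence under differences, hence contains a nonzero constant; so \<open>M/N\<close> is
  torsion-free. Consequently elements picked from the successive steps of a strict chain of submodules
  are linearly independent over \<open>U\<close>, and the length of the chain is at most the number of generators.

  (3) For \<open>m \<noteq> 0\<close> in a simple \<open>M\<close>, the ascending chain condition over \<open>U\<close>, applied to the spans of
  \<open>m, x\<^sub>im, x\<^sub>i\<^sup>2m, \<dots>\<close> and of the corresponding negative powers, gives relations with leading, respectively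
  lowest, coefficient 1. The sum of a shift of the former and the latter has the required form, so \<open>M\<close>
  is a cyclic module annihilated on its generator by suitable \<open>f\<^sub>i\<close>.
\<close>

text \<open>Finite generation over \<open>U\<close> does not bound the length of chains of
  \<open>U\<close>-submodules (\<open>U\<close> itself has infinite descending chains), so part (2)
  has to exploit the monomials. They act on \<open>U\<close> by translations, and a
  translation-stable ideal of a polynomial ring in characteristic 0 is zero or everything; this
  excludes torsion modulo submodules over the Weyl algebra, and the rank over \<open>U\<close> then
  strictly increases along a strict chain. The rank is not introduced as a dimension over a fraction
  field: elimination by cross-multiplication takes its place, and statements about
  \<open>M/N\<close> are phrased as membership in \<open>N\<close>. In part (3) one chain controls
  only one extreme coefficient of a relation. Powers in both directions are used because both the
  constant term and the top coefficient must be constants different from zero. The chain condition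
  over \<open>U\<close> is Hilbert's basis theorem for modules, proved inside \<open>M\<close> on a
  spanning family that may be linearly dependent, so leading terms are attached to submodules and
  never to unique expansions of single vectors.\<close>

section \<open>Modules over a not necessarily commutative ring\<close>

context left_module
begin

lemma smult_l_null [simp]: "x \<in> carrier M \<Longrightarrow> \<zero> \<odot>\<^bsub>M\<^esub> x = \<zero>\<^bsub>M\<^esub>"
  using smult_l_distr[of \<zero> \<zero> x] by (metis M.add.r_cancel_one' R.l_zero R.zero_closed smult_closed)

lemma smult_r_null [simp]: "a \<in> carrier R \<Longrightarrow> a \<odot>\<^bsub>M\<^esub> \<zero>\<^bsub>M\<^esub> = \<zero>\<^bsub>M\<^esub>"
  using smult_r_distr[of a "\<zero>\<^bsub>M\<^esub>" "\<zero>\<^bsub>M\<^esub>"]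
  by (metis M.add.r_cancel_one' M.l_zero M.zero_closed smult_closed)

lemma smult_l_minus:
  "\<lbrakk>a \<in> carrier R; x \<in> carrier M\<rbrakk> \<Longrightarrow> (\<ominus> a) \<odot>\<^bsub>M\<^esub> x = \<ominus>\<^bsub>M\<^esub> (a \<odot>\<^bsub>M\<^esub> x)"
  using smult_l_distr[of "\<ominus> a" a x] by (simp add: R.l_neg M.minus_equality)

lemma smult_finsum_l:
  assumes "finite A" "f \<in> A \<rightarrow> carrier R" "x \<in> carrier M"
  shows "(\<Oplus>i\<in>A. f i) \<odot>\<^bsub>M\<^esub> x = (\<Oplus>\<^bsub>M\<^esub>i\<in>A. f i \<odot>\<^bsub>M\<^esub> x)"
  using assms
proof (induction A rule: finite_induct)
  case (insert a A)
  then have "f a \<in> carrier R" "f \<in> A \<rightarrow> carrier R" by auto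
  with insert show ?case by (simp add: Pi_iff smult_l_distr)
qed simp

text \<open>Negation is the action of \<open>\<ominus> \<one>\<close>, so closure under the action
  covers it.\<close>

lemma submoduleI:
  assumes "N \<subseteq> carrier M" "\<zero>\<^bsub>M\<^esub> \<in> N"
    and "\<And>x y. x \<in> N \<Longrightarrow> y \<in> N \<Longrightarrow> x \<oplus>\<^bsub>M\<^esub> y \<in> N"
    and "\<And>a x. a \<in> carrier R \<Longrightarrow> x \<in> N \<Longrightarrow> a \<odot>\<^bsub>M\<^esub> x \<in> N"
  shows "submodule N R M"
proof -
  have "\<ominus>\<^bsub>M\<^esub> x \<in> N" if "x \<in> N" for x
  proof -
    have "\<ominus>\<^bsub>M\<^esub> x = (\<ominus> \<one>) \<odot>\<^bsub>M\<^esub> x"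
      using that assms(1) by (subst smult_l_minus) auto
    then show ?thesis using assms(4) that by simp
  qed
  then show ?thesis
    using assms unfolding submodule_def submodule_axioms_def subgroup_def
    by (simp add: a_inv_def)
qed

end

lemma submoduleD:
  assumes "submodule N R M"
  shows "N \<subseteq> carrier M" "\<zero>\<^bsub>M\<^esub> \<in> N"
    and "\<And>x y. x \<in> N \<Longrightarrow> y \<in> N \<Longrightarrow> x \<oplus>\<^bsub>M\<^esub> y \<in> N"
    and "\<And>x. x \<in> N \<Longrightarrow> \<ominus>\<^bsub>M\<^esub> x \<in> N"
    and "\<And>a x. a \<in> carrier R \<Longrightarrow> x \<in> N \<Longrightarrow> a \<odot>\<^bsub>M\<^esub> x \<in> N"
  using assms unfolding submodule_def submodule_axioms_def subgroup_def
  by (auto simp: a_inv_def)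

lemma submodule_carrier: "left_module R M \<Longrightarrow> submodule (carrier M) R M"
  by (rule left_module.submoduleI) (auto intro: left_module.smult_closed simp: left_module_def
      abelian_group_def abelian_monoid.a_closed abelian_monoid.zero_closed)

lemma submodule_zero: "left_module R M \<Longrightarrow> submodule {\<zero>\<^bsub>M\<^esub>} R M"
  by (rule left_module.submoduleI) (auto simp: left_module_def left_module.smult_r_null
      abelian_group_def abelian_monoid.zero_closed abelian_monoid.l_zero)

subsection \<open>Restriction of scalars and of the carrier\<close>

text \<open>Serves two descents of scalars: from the Weyl algebra to \<open>U_h\<close>, and from
  \<open>U_h\<close> to the complex numbers.\<close>

lemma left_module_subring:
  assumes "left_module R M" "subring A R"
  shows "left_module (R\<lparr>carrier := A\<rparr>) M"
proof -
  interpret left_module R M by fact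
  interpret A: ring "R\<lparr>carrier := A\<rparr>" using assms(2) R.subring_is_ring by blast
  have "A \<subseteq> carrier R" using assms(2) subringE(1) by blast
  then show ?thesis
    by unfold_locales (auto intro: smult_l_distr smult_r_distr smult_assoc1)
qed

lemma submodule_subring:
  "submodule N R M \<Longrightarrow> A \<subseteq> carrier R \<Longrightarrow> submodule N (R\<lparr>carrier := A\<rparr>) M"
  unfolding submodule_def submodule_axioms_def by auto

lemma left_module_submodule:
  assumes "left_module R M" "submodule N R M"
  shows "left_module R (M\<lparr>carrier := N\<rparr>)"
proof -
  interpret left_module R M by fact
  note N = submoduleD[OF assms(2)]
  have *: "x \<in> carrier M" if "x \<in> N" for x using N(1) that by auto
  have "abelian_group (M\<lparr>carrier := N\<rparr>)"
    by (rule abelian_groupI) (auto simp: N * M.a_ac intro!: N(4) bexI[of _ "\<ominus>\<^bsub>M\<^esub> _"] M.r_neg)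
  then interpret N: abelian_group "M\<lparr>carrier := N\<rparr>" .
  show ?thesis
    by unfold_locales (auto simp: N * smult_l_distr smult_r_distr smult_assoc1)
qed

text \<open>Lets the factors of a chain be tested for simplicity on submodules of \<open>M\<close>
  itself.\<close>

lemma submodule_restrict:
  assumes "left_module R M" "submodule N R M"
  shows "submodule L R (M\<lparr>carrier := N\<rparr>) \<longleftrightarrow> submodule L R M \<and> L \<subseteq> N"
proof -
  interpret left_module R M by fact
  interpret N: left_module R "M\<lparr>carrier := N\<rparr>" using assms by (rule left_module_submodule)
  note N = submoduleD[OF assms(2)]
  show ?thesis
  proof (intro iffI conjI)
    assume "submodule L R (M\<lparr>carrier := N\<rparr>)"
    note L = submoduleD[OF this]
    show "submodule L R M" by (rule submoduleI) (use L N in auto)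
    show "L \<subseteq> N" using L(1) by simp
  next
    assume "submodule L R M \<and> L \<subseteq> N"
    then show "submodule L R (M\<lparr>carrier := N\<rparr>)"
      by (intro N.submoduleI) (auto dest: submoduleD)
  qed
qed


subsection \<open>Quotient modules\<close>

context left_module
begin

lemma coset_eq_iff:
  assumes "submodule N R M" "x \<in> carrier M" "y \<in> carrier M"
  shows "N +>\<^bsub>M\<^esub> x = N +>\<^bsub>M\<^esub> y \<longleftrightarrow> x \<ominus>\<^bsub>M\<^esub> y \<in> N"
proof -
  note N = submoduleD[OF assms(1)]
  have sg: "subgroup N (add_monoid M)" using assms(1) by (simp add: submodule_def)
  have mem: "x \<in> N +>\<^bsub>M\<^esub> y \<longleftrightarrow> x \<ominus>\<^bsub>M\<^esub> y \<in> N"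
  proof
    assume "x \<in> N +>\<^bsub>M\<^esub> y"
    then obtain n where n: "n \<in> N" "x = n \<oplus>\<^bsub>M\<^esub> y" by (auto simp: a_r_coset_def')
    then have "n \<in> carrier M" using N(1) by auto
    then have "x \<ominus>\<^bsub>M\<^esub> y = n" using n assms by (simp add: a_minus_def M.a_assoc M.r_neg)
    then show "x \<ominus>\<^bsub>M\<^esub> y \<in> N" using n by simp
  next
    assume *: "x \<ominus>\<^bsub>M\<^esub> y \<in> N"
    have "x = (x \<ominus>\<^bsub>M\<^esub> y) \<oplus>\<^bsub>M\<^esub> y" using assms by (simp add: a_minus_def M.a_assoc M.l_neg)
    with * show "x \<in> N +>\<^bsub>M\<^esub> y" by (auto simp: a_r_coset_def')
  qed
  have "x \<in> N +>\<^bsub>M\<^esub> x" using N(2) assms by (auto simp: a_r_coset_def' intro!: bexI[of _ "\<zero>\<^bsub>M\<^esub>"])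
  then show ?thesis
    using mem M.a_repr_independence[OF _ assms(3) sg, of x] by metis
qed

lemma coset_add:
  assumes "submodule N R M" "x \<in> carrier M" "y \<in> carrier M"
  shows "set_add M (N +>\<^bsub>M\<^esub> x) (N +>\<^bsub>M\<^esub> y) = N +>\<^bsub>M\<^esub> (x \<oplus>\<^bsub>M\<^esub> y)"
proof -
  have "abelian_subgroup N M"
    using assms(1) M.a_comm_group abelian_subgroupI2 by (auto simp: submodule_def)
  then show ?thesis using assms by (simp add: abelian_subgroup.a_rcos_sum)
qed

lemma coset_smult:
  assumes "submodule N R M" "x \<in> carrier M" "r \<in> carrier R"
  shows "(\<Union>y\<in>N +>\<^bsub>M\<^esub> x. N +>\<^bsub>M\<^esub> (r \<odot>\<^bsub>M\<^esub> y)) = N +>\<^bsub>M\<^esub> (r \<odot>\<^bsub>M\<^esub> x)"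
proof -
  note N = submoduleD[OF assms(1)]
  have "N +>\<^bsub>M\<^esub> (r \<odot>\<^bsub>M\<^esub> y) = N +>\<^bsub>M\<^esub> (r \<odot>\<^bsub>M\<^esub> x)" if "y \<in> N +>\<^bsub>M\<^esub> x" for y
  proof -
    from that obtain n where n: "n \<in> N" "y = n \<oplus>\<^bsub>M\<^esub> x" by (auto simp: a_r_coset_def')
    then have c: "n \<in> carrier M" using N(1) by auto
    have "r \<odot>\<^bsub>M\<^esub> y \<ominus>\<^bsub>M\<^esub> r \<odot>\<^bsub>M\<^esub> x = r \<odot>\<^bsub>M\<^esub> n"
      using n c assms by (simp add: smult_r_distr a_minus_def M.a_assoc M.r_neg)
    then show ?thesis using n c assms N(5) by (subst coset_eq_iff) auto
  qed
  moreover have "x \<in> N +>\<^bsub>M\<^esub> x" using N(2) assms by (auto simp: a_r_coset_def' intro!: bexI[of _ "\<zero>\<^bsub>M\<^esub>"])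
  ultimately show ?thesis by blast
qed

lemma carrier_quotient_module: "carrier (quotient_module M N) = (\<lambda>x. N +>\<^bsub>M\<^esub> x) ` carrier M"
  by (auto simp: quotient_module_def A_RCOSETS_def')

lemma left_module_quotient:
  assumes "submodule N R M"
  shows "left_module R (quotient_module M N)"
proof -
  have add: "(N +>\<^bsub>M\<^esub> x) \<oplus>\<^bsub>quotient_module M N\<^esub> (N +>\<^bsub>M\<^esub> y) = N +>\<^bsub>M\<^esub> (x \<oplus>\<^bsub>M\<^esub> y)"
    if "x \<in> carrier M" "y \<in> carrier M" for x y
    using coset_add[OF assms that] by (simp add: quotient_module_def)
  have sm: "r \<odot>\<^bsub>quotient_module M N\<^esub> (N +>\<^bsub>M\<^esub> x) = N +>\<^bsub>M\<^esub> (r \<odot>\<^bsub>M\<^esub> x)"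
    if "x \<in> carrier M" "r \<in> carrier R" for x r
    using coset_smult[OF assms that] by (simp add: quotient_module_def)
  have zero: "\<zero>\<^bsub>quotient_module M N\<^esub> = N +>\<^bsub>M\<^esub> \<zero>\<^bsub>M\<^esub>"
    using submoduleD(1)[OF assms] by (simp add: quotient_module_def)
  interpret Q: abelian_group "quotient_module M N"
  proof (rule abelian_groupI)
    fix A assume "A \<in> carrier (quotient_module M N)"
    then obtain x where x: "x \<in> carrier M" "A = N +>\<^bsub>M\<^esub> x" by (auto simp: carrier_quotient_module)
    show "\<exists>B\<in>carrier (quotient_module M N). B \<oplus>\<^bsub>quotient_module M N\<^esub> A = \<zero>\<^bsub>quotient_module M N\<^esub>"
      using x by (intro bexI[of _ "N +>\<^bsub>M\<^esub> (\<ominus>\<^bsub>M\<^esub> x)"]) (auto simp: carrier_quotient_module add zero M.l_neg)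
  qed (auto simp: carrier_quotient_module add zero M.a_ac)
  show ?thesis
    by unfold_locales
      (auto simp: carrier_quotient_module add sm smult_l_distr smult_r_distr smult_assoc1)
qed

lemma quotient_module_add:
  assumes "submodule N R M" "x \<in> carrier M" "y \<in> carrier M"
  shows "(N +>\<^bsub>M\<^esub> x) \<oplus>\<^bsub>quotient_module M N\<^esub> (N +>\<^bsub>M\<^esub> y) = N +>\<^bsub>M\<^esub> (x \<oplus>\<^bsub>M\<^esub> y)"
  using coset_add[OF assms] by (simp add: quotient_module_def)

lemma quotient_module_smult:
  assumes "submodule N R M" "x \<in> carrier M" "r \<in> carrier R"
  shows "r \<odot>\<^bsub>quotient_module M N\<^esub> (N +>\<^bsub>M\<^esub> x) = N +>\<^bsub>M\<^esub> (r \<odot>\<^bsub>M\<^esub> x)"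
  using coset_smult[OF assms] by (simp add: quotient_module_def)

end

section \<open>Spans and finite generation\<close>

text \<open>The set of coefficients need not be a ring, so that the same notion serves for submodules and for complex subspaces.\<close>

inductive_set span_in :: "('a, 'b, 'm) module_scheme \<Rightarrow> 'a set \<Rightarrow> 'b set \<Rightarrow> 'b set"
  for M A B where
    zero: "\<zero>\<^bsub>M\<^esub> \<in> span_in M A B"
  | step: "a \<in> A \<Longrightarrow> b \<in> B \<Longrightarrow> v \<in> span_in M A B \<Longrightarrow> a \<odot>\<^bsub>M\<^esub> b \<oplus>\<^bsub>M\<^esub> v \<in> span_in M A B"

lemma span_in_mono: "v \<in> span_in M A B \<Longrightarrow> B \<subseteq> B' \<Longrightarrow> v \<in> span_in M A B'"
  by (induction rule: span_in.induct) (auto intro: span_in.intros)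

context left_module
begin

lemma span_in_closed:
  assumes "A \<subseteq> carrier R" "B \<subseteq> carrier M" "v \<in> span_in M A B"
  shows "v \<in> carrier M"
  using assms(3) by induction (use assms in auto)

lemma span_in_add:
  assumes "A \<subseteq> carrier R" "B \<subseteq> carrier M" "v \<in> span_in M A B" "w \<in> span_in M A B"
  shows "v \<oplus>\<^bsub>M\<^esub> w \<in> span_in M A B"
  using assms(3)
proof induction
  case zero
  then show ?case using assms span_in_closed by simp
next
  case (step a b v)
  have "(a \<odot>\<^bsub>M\<^esub> b \<oplus>\<^bsub>M\<^esub> v) \<oplus>\<^bsub>M\<^esub> w = a \<odot>\<^bsub>M\<^esub> b \<oplus>\<^bsub>M\<^esub> (v \<oplus>\<^bsub>M\<^esub> w)"
    by (rule M.a_assoc) (use step assms span_in_closed in auto)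
  then show ?case using step by (auto intro: span_in.step)
qed

lemma span_in_smult_mem:
  assumes "A \<subseteq> carrier R" "B \<subseteq> carrier M" "a \<in> A" "b \<in> B"
  shows "a \<odot>\<^bsub>M\<^esub> b \<in> span_in M A B"
proof -
  have "a \<odot>\<^bsub>M\<^esub> b \<oplus>\<^bsub>M\<^esub> \<zero>\<^bsub>M\<^esub> \<in> span_in M A B" using assms by (blast intro: span_in.intros)
  moreover have "a \<in> carrier R" "b \<in> carrier M" using assms by auto
  ultimately show ?thesis by simp
qed

text \<open>The multiplier may lie outside the coefficient set and the target span may differ from
  the source. This fits monomials, which are not in \<open>U_h\<close> and carry one span to a
  shifted one.\<close>

lemma span_in_smult:
  assumes "A \<subseteq> carrier R" "B \<subseteq> carrier M" "v \<in> span_in M A B"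
    and r: "r \<in> carrier R" and "\<And>a b. a \<in> A \<Longrightarrow> b \<in> B \<Longrightarrow> r \<odot>\<^bsub>M\<^esub> (a \<odot>\<^bsub>M\<^esub> b) \<in> span_in M A' B'"
    and "A' \<subseteq> carrier R" "B' \<subseteq> carrier M"
  shows "r \<odot>\<^bsub>M\<^esub> v \<in> span_in M A' B'"
  using assms(3)
proof induction
  case zero
  then show ?case using r by (simp add: span_in.zero)
next
  case (step a b v)
  then show ?case using assms span_in_closed[OF assms(1,2)]
    by (subst smult_r_distr) (auto intro!: span_in_add)
qed

lemma span_in_subset_submodule:
  assumes "submodule N R M" "A \<subseteq> carrier R" "B \<subseteq> N" "v \<in> span_in M A B"
  shows "v \<in> N"
  using assms(4) by induction (use submoduleD[OF assms(1)] assms in \<open>auto simp: subset_iff\<close>)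

lemma submodule_span:
  assumes "B \<subseteq> carrier M"
  shows "submodule (span_in M (carrier R) B) R M"
proof (rule submoduleI)
  show "span_in M (carrier R) B \<subseteq> carrier M" using assms span_in_closed by blast
  show "\<zero>\<^bsub>M\<^esub> \<in> span_in M (carrier R) B" by (rule span_in.zero)
  fix a x y
  assume x: "x \<in> span_in M (carrier R) B"
  show "x \<oplus>\<^bsub>M\<^esub> y \<in> span_in M (carrier R) B" if "y \<in> span_in M (carrier R) B"
    using span_in_add[OF _ assms x that] by simp
  assume a: "a \<in> carrier R"
  show "a \<odot>\<^bsub>M\<^esub> x \<in> span_in M (carrier R) B"
  proof (rule span_in_smult[OF _ assms x a])
    fix c b assume "c \<in> carrier R" "b \<in> B"
    then show "a \<odot>\<^bsub>M\<^esub> (c \<odot>\<^bsub>M\<^esub> b) \<in> span_in M (carrier R) B"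
      using assms a by (subst smult_assoc1[symmetric]) (auto intro!: span_in_smult_mem)
  qed (use assms in auto)
qed

lemma span_in_superset:
  assumes "B \<subseteq> carrier M" "b \<in> B"
  shows "b \<in> span_in M (carrier R) B"
  using span_in_smult_mem[OF subset_refl assms(1) R.one_closed assms(2)] assms by auto

text \<open>Coefficients belong to indices rather than to vectors, so a family with coinciding
  members, such as the powers of a variable applied to one vector, still yields one coefficient per
  index.\<close>

lemma span_in_finsum:
  assumes "finite I" "f \<in> I \<rightarrow> carrier M" "v \<in> span_in M (carrier R) (f ` I)"
  shows "\<exists>u\<in>I \<rightarrow> carrier R. v = (\<Oplus>\<^bsub>M\<^esub>i\<in>I. u i \<odot>\<^bsub>M\<^esub> f i)"
  using assms(3)
proof induction
  case zero
  show ?case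
  proof (intro bexI)
    show "\<zero>\<^bsub>M\<^esub> = (\<Oplus>\<^bsub>M\<^esub>i\<in>I. \<zero> \<odot>\<^bsub>M\<^esub> f i)"
      using assms(2) by (intro M.add.finprod_one_eqI[symmetric]) (auto simp: Pi_iff)
  qed auto
next
  case (step a b v)
  then obtain u i where u: "u \<in> I \<rightarrow> carrier R" "v = (\<Oplus>\<^bsub>M\<^esub>i\<in>I. u i \<odot>\<^bsub>M\<^esub> f i)"
    and i: "i \<in> I" "b = f i" by auto
  \<comment> \<open>If several indices give the vector \<open>b\<close>, the whole coefficient
    \<open>a\<close> is put on the single chosen index \<open>i\<close>.\<close>
  define e where "e j = (if j = i then a else \<zero>)" for j
  have e: "e \<in> I \<rightarrow> carrier R" using step by (auto simp: e_def)
  have "(\<Oplus>\<^bsub>M\<^esub>j\<in>I. e j \<odot>\<^bsub>M\<^esub> f j) = (\<Oplus>\<^bsub>M\<^esub>j\<in>I. if i = j then a \<odot>\<^bsub>M\<^esub> f j else \<zero>\<^bsub>M\<^esub>)"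
    using assms(2) step by (intro M.finsum_cong') (auto simp: e_def Pi_iff)
  also have "\<dots> = a \<odot>\<^bsub>M\<^esub> f i"
    using i assms step by (intro M.finsum_singleton) (auto simp: Pi_iff)
  finally have *: "(\<Oplus>\<^bsub>M\<^esub>j\<in>I. e j \<odot>\<^bsub>M\<^esub> f j) = a \<odot>\<^bsub>M\<^esub> b" using i by simp
  have "(\<Oplus>\<^bsub>M\<^esub>j\<in>I. (e j \<oplus> u j) \<odot>\<^bsub>M\<^esub> f j) = (\<Oplus>\<^bsub>M\<^esub>j\<in>I. e j \<odot>\<^bsub>M\<^esub> f j \<oplus>\<^bsub>M\<^esub> u j \<odot>\<^bsub>M\<^esub> f j)"
    using assms(2) e u by (intro M.finsum_cong') (auto simp: Pi_iff smult_l_distr)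
  also have "\<dots> = a \<odot>\<^bsub>M\<^esub> b \<oplus>\<^bsub>M\<^esub> v"
    using assms(2) e u by (subst M.finsum_addf) (auto simp: * Pi_iff)
  finally show ?case
    using e u by (intro bexI[of _ "\<lambda>j. e j \<oplus> u j"]) (auto simp: Pi_iff)
qed

lemma finsum_in_span:
  assumes "finite I" "f \<in> I \<rightarrow> B" "B \<subseteq> carrier M" "u \<in> I \<rightarrow> carrier R"
  shows "(\<Oplus>\<^bsub>M\<^esub>i\<in>I. u i \<odot>\<^bsub>M\<^esub> f i) \<in> span_in M (carrier R) B"
  using assms(1,2,4)
proof (induction I rule: finite_induct)
  case empty
  then show ?case by (simp add: span_in.zero)
next
  case (insert i I)
  then have c: "(\<lambda>i. u i \<odot>\<^bsub>M\<^esub> f i) \<in> I \<rightarrow> carrier M" "u i \<odot>\<^bsub>M\<^esub> f i \<in> carrier M"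
    and m: "u i \<in> carrier R" "f i \<in> B" and IH: "(\<Oplus>\<^bsub>M\<^esub>i\<in>I. u i \<odot>\<^bsub>M\<^esub> f i) \<in> span_in M (carrier R) B"
    using assms(3) by (auto simp: Pi_iff subset_iff)
  show ?case
    using span_in.step[OF m IH] M.finsum_insert[OF insert(1,2) c] by simp
qed

lemma finitely_generated_module_iff:
  "finitely_generated_module R M \<longleftrightarrow>
    (\<exists>B. finite B \<and> B \<subseteq> carrier M \<and> span_in M (carrier R) B = carrier M)" (is "?l = ?r")
proof
  assume ?l
  then obtain B where B: "finite B" "B \<subseteq> carrier M"
    "\<forall>m\<in>carrier M. \<exists>u\<in>B \<rightarrow> carrier R. m = (\<Oplus>\<^bsub>M\<^esub>b\<in>B. u b \<odot>\<^bsub>M\<^esub> b)"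
    unfolding finitely_generated_module_def by blast
  have "m \<in> span_in M (carrier R) B" if "m \<in> carrier M" for m
  proof -
    from B(3) that obtain u where "u \<in> B \<rightarrow> carrier R" "m = (\<Oplus>\<^bsub>M\<^esub>b\<in>B. u b \<odot>\<^bsub>M\<^esub> b)" by metis
    then show ?thesis using B finsum_in_span[of B "\<lambda>b. b" B u] by simp
  qed
  then have "span_in M (carrier R) B = carrier M"
    using span_in_closed[OF subset_refl B(2)] by (intro subset_antisym subsetI)
  then show ?r using B by (intro exI[of _ B]) simp
next
  assume ?r
  then obtain B where B: "finite B" "B \<subseteq> carrier M" "span_in M (carrier R) B = carrier M" by blast
  have "\<exists>u\<in>B \<rightarrow> carrier R. m = (\<Oplus>\<^bsub>M\<^esub>b\<in>B. u b \<odot>\<^bsub>M\<^esub> b)" if "m \<in> carrier M" for m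
    using span_in_finsum[of B "\<lambda>b. b" m] that B by (simp add: Pi_iff subset_iff)
  then show ?l using B left_module_axioms unfolding finitely_generated_module_def by blast
qed

lemma finitely_generated_quotient:
  assumes "submodule N R M" "finitely_generated_module R M"
  shows "finitely_generated_module R (quotient_module M N)"
proof -
  interpret Q: left_module R "quotient_module M N" using assms(1) by (rule left_module_quotient)
  obtain B where B: "finite B" "B \<subseteq> carrier M" "span_in M (carrier R) B = carrier M"
    using assms(2) finitely_generated_module_iff by blast
  have *: "N +>\<^bsub>M\<^esub> v \<in> span_in (quotient_module M N) (carrier R) ((\<lambda>x. N +>\<^bsub>M\<^esub> x) ` B)"
    if "v \<in> span_in M (carrier R) B" for v
    using that
  proof induction
    case zero
    have "N +>\<^bsub>M\<^esub> \<zero>\<^bsub>M\<^esub> = \<zero>\<^bsub>quotient_module M N\<^esub>"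
      using submoduleD(1)[OF assms(1)] by (simp add: quotient_module_def)
    then show ?case by (simp add: span_in.zero)
  next
    case (step a b v)
    then have "v \<in> carrier M" "b \<in> carrier M" using B by auto
    then have "N +>\<^bsub>M\<^esub> (a \<odot>\<^bsub>M\<^esub> b \<oplus>\<^bsub>M\<^esub> v) = a \<odot>\<^bsub>quotient_module M N\<^esub> (N +>\<^bsub>M\<^esub> b) \<oplus>\<^bsub>quotient_module M N\<^esub> (N +>\<^bsub>M\<^esub> v)"
      using step assms(1) by (simp add: quotient_module_add quotient_module_smult)
    then show ?case using step by (auto intro: span_in.step)
  qed
  have 1: "(\<lambda>x. N +>\<^bsub>M\<^esub> x) ` B \<subseteq> carrier (quotient_module M N)"
    using B by (auto simp: carrier_quotient_module)
  have "carrier (quotient_module M N) \<subseteq> span_in (quotient_module M N) (carrier R) ((\<lambda>x. N +>\<^bsub>M\<^esub> x) ` B)"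
    using * unfolding carrier_quotient_module B(3) by (rule image_subsetI)
  then have "span_in (quotient_module M N) (carrier R) ((\<lambda>x. N +>\<^bsub>M\<^esub> x) ` B) = carrier (quotient_module M N)"
    using Q.span_in_closed[OF subset_refl 1] by (intro subset_antisym subsetI) blast+
  then show ?thesis
    unfolding Q.finitely_generated_module_iff using B(1) 1 by blast
qed

end

subsection \<open>Composition series\<close>

context left_module
begin

lemma simple_quotientI:
  assumes N: "submodule N R M" "N \<noteq> carrier M"
    and max: "\<And>L. submodule L R M \<Longrightarrow> N \<subseteq> L \<Longrightarrow> L = N \<or> L = carrier M"
  shows "simple_module R (quotient_module M N)"
proof -
  interpret Q: left_module R "quotient_module M N" using N(1) by (rule left_module_quotient)
  note ND = submoduleD[OF N(1)]
  have zero: "\<zero>\<^bsub>quotient_module M N\<^esub> = N" by (simp add: quotient_module_def)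
  have coset0: "N +>\<^bsub>M\<^esub> x = N \<longleftrightarrow> x \<in> N" if "x \<in> carrier M" for x
    using coset_eq_iff[OF N(1) that M.zero_closed] ND(1) that M.minus_equality[of "\<zero>\<^bsub>M\<^esub>" "\<zero>\<^bsub>M\<^esub>"]
    by (simp add: a_minus_def)
  obtain x where x: "x \<in> carrier M" "x \<notin> N" using N(2) ND(1) by blast
  then have "N +>\<^bsub>M\<^esub> x \<in> carrier (quotient_module M N)" "N +>\<^bsub>M\<^esub> x \<noteq> N"
    using coset0 by (auto simp: carrier_quotient_module)
  then have ne: "carrier (quotient_module M N) \<noteq> {\<zero>\<^bsub>quotient_module M N\<^esub>}" using zero by auto
  have "L = {\<zero>\<^bsub>quotient_module M N\<^esub>} \<or> L = carrier (quotient_module M N)"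
    if L: "submodule L R (quotient_module M N)" for L
  proof -
    note LD = submoduleD[OF L]
    \<comment> \<open>The preimage of \<open>L\<close> in \<open>M\<close>, to which the maximality
      of \<open>N\<close> applies.\<close>
    define L' where "L' = {x \<in> carrier M. N +>\<^bsub>M\<^esub> x \<in> L}"
    have "submodule L' R M"
    proof (rule submoduleI)
      show "\<zero>\<^bsub>M\<^esub> \<in> L'" using LD(2) coset0[of "\<zero>\<^bsub>M\<^esub>"] ND(2) zero by (simp add: L'_def)
    next
      fix x y assume "x \<in> L'" "y \<in> L'"
      then show "x \<oplus>\<^bsub>M\<^esub> y \<in> L'" using LD(3) by (auto simp: L'_def quotient_module_add[OF N(1), symmetric])
    next
      fix a x assume "a \<in> carrier R" "x \<in> L'"
      then show "a \<odot>\<^bsub>M\<^esub> x \<in> L'" using LD(5) by (auto simp: L'_def quotient_module_smult[OF N(1), symmetric])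
    qed (auto simp: L'_def)
    moreover have "N \<subseteq> L'"
    proof
      fix x assume "x \<in> N"
      then have "x \<in> carrier M" "N +>\<^bsub>M\<^esub> x = N" using ND(1) coset0 by blast+
      then show "x \<in> L'" using LD(2) zero by (simp add: L'_def)
    qed
    ultimately consider "L' = N" | "L' = carrier M" using max by blast
    then show ?thesis
    proof cases
      case 1
      have "A = N" if "A \<in> L" for A
      proof -
        obtain x where x: "x \<in> carrier M" "A = N +>\<^bsub>M\<^esub> x"
          using subsetD[OF LD(1) \<open>A \<in> L\<close>] by (auto simp: carrier_quotient_module)
        then have "x \<in> N" using that 1 by (auto simp: L'_def)
        then show ?thesis using coset0 x by simp
      qed
      then have "L \<subseteq> {\<zero>\<^bsub>quotient_module M N\<^esub>}" unfolding zero by blast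
      then show ?thesis using LD(2) by blast
    next
      case 2
      then have "carrier (quotient_module M N) \<subseteq> L"
        unfolding carrier_quotient_module L'_def by blast
      then show ?thesis using LD(1) by blast
    qed
  qed
  then show ?thesis using ne Q.left_module_axioms by (simp add: simple_module_def)
qed

text \<open>Since lengths are bounded, there is a longest strict chain from zero to
  \<open>M\<close>. It admits no refinement, which makes all its factors simple.\<close>

lemma finite_composition_lengthI:
  assumes bound: "\<And>(k::nat) N. (\<And>i. i \<le> k \<Longrightarrow> submodule (N i) R M) \<Longrightarrow>
    (\<And>i. i < k \<Longrightarrow> N i \<subset> N (Suc i)) \<Longrightarrow> k \<le> r"
  shows "finite_composition_length R M"
proof -
  define Q where "Q k N \<longleftrightarrow> N 0 = {\<zero>\<^bsub>M\<^esub>} \<and> N k = carrier M \<and> (\<forall>i\<le>k. submodule (N i) R M) \<and>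
    (\<forall>i<k. N i \<subset> N (Suc i))" for k :: nat and N
  have le: "k \<le> r" if "Q k N" for k N
    using that by (intro bound[of k N]) (auto simp: Q_def)
  have sub: "submodule {\<zero>\<^bsub>M\<^esub>} R M" "submodule (carrier M) R M"
    using submodule_zero submodule_carrier left_module_axioms by blast+
  \<comment> \<open>Some chain must exist before a longest one can be taken: zero and
    \<open>M\<close> give length 0 or 1.\<close>
  have "\<exists>k N. Q k N"
  proof (cases "carrier M = {\<zero>\<^bsub>M\<^esub>}")
    case True
    then have "Q 0 (\<lambda>_. carrier M)" using sub by (simp add: Q_def)
    then show ?thesis by blast
  next
    case False
    then have "Q 1 (\<lambda>i. if i = 0 then {\<zero>\<^bsub>M\<^esub>} else carrier M)" using sub by (auto simp: Q_def)
    then show ?thesis by blast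
  qed
  then obtain k where k: "\<exists>N. Q k N" and max: "\<And>k'. (\<exists>N. Q k' N) \<Longrightarrow> k' \<le> k"
    using GreatestI_ex_nat[of "\<lambda>k. \<exists>N. Q k N" r] Greatest_le_nat[of "\<lambda>k. \<exists>N. Q k N" _ r] le by blast
  then obtain N where N: "Q k N" by blast
  have "simple_module R (quotient_module (M\<lparr>carrier := N (Suc i)\<rparr>) (N i))" if "i < k" for i
  proof -
    have s: "submodule (N i) R M" "submodule (N (Suc i)) R M" "N i \<subset> N (Suc i)"
      using N that by (auto simp: Q_def)
    interpret S: left_module R "M\<lparr>carrier := N (Suc i)\<rparr>"
      using s(2) left_module_axioms by (intro left_module_submodule)
    note restr = submodule_restrict[OF left_module_axioms s(2)]
    show ?thesis
    proof (rule S.simple_quotientI)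
      show "submodule (N i) R (M\<lparr>carrier := N (Suc i)\<rparr>)" using s restr by auto
      show "N i \<noteq> carrier (M\<lparr>carrier := N (Suc i)\<rparr>)" using s by auto
      fix L assume "submodule L R (M\<lparr>carrier := N (Suc i)\<rparr>)" "N i \<subseteq> L"
      then have L: "submodule L R M" "L \<subseteq> N (Suc i)" "N i \<subseteq> L" using restr by auto
      show "L = N i \<or> L = carrier (M\<lparr>carrier := N (Suc i)\<rparr>)"
      proof (rule ccontr)
        assume "\<not> ?thesis"
        then have strict: "N i \<subset> L" "L \<subset> N (Suc i)" using L by auto
        \<comment> \<open>\<open>L\<close> is inserted directly after position \<open>i\<close> and
          all later terms move up by one, giving a chain longer than the maximum.\<close>
        define N' where "N' j = (if j \<le> i then N j else if j = Suc i then L else N (j - 1))" for j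
        have "N' j \<subset> N' (Suc j)" if "j < Suc k" for j
        proof -
          consider "j < i" | "j = i" | "j = Suc i" | "j > Suc i" by linarith
          then show ?thesis
          proof cases
            case 4
            then have "Suc (j - 1) = j" "j - 1 < k" using that by auto
            then have "N (j - 1) \<subset> N j" using N unfolding Q_def by metis
            then show ?thesis using 4 by (simp add: N'_def)
          qed (use strict N \<open>i < k\<close> in \<open>auto simp: N'_def Q_def\<close>)
        qed
        moreover have "submodule (N' j) R M" if "j \<le> Suc k" for j
          using N \<open>i < k\<close> L that by (auto simp: N'_def Q_def)
        ultimately have "Q (Suc k) N'" using N \<open>i < k\<close> by (auto simp: Q_def N'_def)
        then show False using max[of "Suc k"] by auto
      qed
    qed
  qed
  then show ?thesis
    using N left_module_axioms unfolding finite_composition_length_def Q_def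
    by (intro conjI exI[of _ k] exI[of _ N]) auto
qed

lemma submodule_cancel:
  assumes "submodule N R M" "x \<oplus>\<^bsub>M\<^esub> y \<in> N" "y \<in> N" "x \<in> carrier M"
  shows "x \<in> N"
proof -
  note N = submoduleD[OF assms(1)]
  have "x = (x \<oplus>\<^bsub>M\<^esub> y) \<oplus>\<^bsub>M\<^esub> \<ominus>\<^bsub>M\<^esub> y"
    using assms N(1) by (subst M.a_assoc) (auto simp: M.r_neg)
  also have "\<dots> \<in> N" using assms N by blast
  finally show ?thesis .
qed

text \<open>Isolates a coefficient of one generator, on which the eliminations below act. The
  coefficient need not be unique.\<close>

lemma span_in_insertE:
  assumes "insert b B \<subseteq> carrier M" "v \<in> span_in M (carrier R) (insert b B)"
  obtains c w where "c \<in> carrier R" "w \<in> span_in M (carrier R) B" "v = c \<odot>\<^bsub>M\<^esub> b \<oplus>\<^bsub>M\<^esub> w"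
proof -
  have B: "B \<subseteq> carrier M" "b \<in> carrier M" using assms(1) by auto
  note cl = span_in_closed[OF subset_refl B(1)]
  have "\<exists>c\<in>carrier R. \<exists>w\<in>span_in M (carrier R) B. v = c \<odot>\<^bsub>M\<^esub> b \<oplus>\<^bsub>M\<^esub> w"
    using assms(2)
  proof induction
    case zero
    show ?case using B by (intro bexI[of _ \<zero>] bexI[of _ "\<zero>\<^bsub>M\<^esub>"]) (auto intro: span_in.zero)
  next
    case (step a b' v)
    then obtain c w where cw: "c \<in> carrier R" "w \<in> span_in M (carrier R) B" "v = c \<odot>\<^bsub>M\<^esub> b \<oplus>\<^bsub>M\<^esub> w"
      by blast
    have wc: "w \<in> carrier M" using cl cw by blast
    show ?case
    proof (cases "b' = b")
      case True
      then have "a \<odot>\<^bsub>M\<^esub> b' \<oplus>\<^bsub>M\<^esub> v = (a \<oplus> c) \<odot>\<^bsub>M\<^esub> b \<oplus>\<^bsub>M\<^esub> w"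
        using cw step B wc by (simp add: smult_l_distr M.a_assoc)
      then show ?thesis using cw step by blast
    next
      case False
      then have b': "b' \<in> B" "b' \<in> carrier M" using step B by auto
      then have "a \<odot>\<^bsub>M\<^esub> b' \<oplus>\<^bsub>M\<^esub> v = c \<odot>\<^bsub>M\<^esub> b \<oplus>\<^bsub>M\<^esub> (a \<odot>\<^bsub>M\<^esub> b' \<oplus>\<^bsub>M\<^esub> w)"
        using cw step B wc by (simp add: M.a_lcomm)
      then show ?thesis using cw step b' by (blast intro: span_in.step)
    qed
  qed
  then show ?thesis using that by blast
qed

end

subsection \<open>Modules over a domain\<close>

locale domain_module = left_module R M + domain R
  for R (structure) and M (structure)
begin

text \<open>Cross-multiplying by the two coefficients of \<open>b\<close> replaces division; by
  commutativity both products equal \<open>c \<otimes> c'\<close> and cancel.\<close>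

lemma eliminate_generator:
  assumes "c \<in> carrier R" "c' \<in> carrier R" "b \<in> carrier M" "w \<in> carrier M" "w' \<in> carrier M"
  shows "c \<odot>\<^bsub>M\<^esub> (c' \<odot>\<^bsub>M\<^esub> b \<oplus>\<^bsub>M\<^esub> w') \<oplus>\<^bsub>M\<^esub> (\<ominus> c') \<odot>\<^bsub>M\<^esub> (c \<odot>\<^bsub>M\<^esub> b \<oplus>\<^bsub>M\<^esub> w)
    = c \<odot>\<^bsub>M\<^esub> w' \<oplus>\<^bsub>M\<^esub> (\<ominus> c') \<odot>\<^bsub>M\<^esub> w"
proof -
  have "c \<odot>\<^bsub>M\<^esub> (c' \<odot>\<^bsub>M\<^esub> b \<oplus>\<^bsub>M\<^esub> w') = (c \<otimes> c') \<odot>\<^bsub>M\<^esub> b \<oplus>\<^bsub>M\<^esub> c \<odot>\<^bsub>M\<^esub> w'"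
    using assms by (simp add: smult_r_distr smult_assoc1)
  moreover have "(\<ominus> c') \<odot>\<^bsub>M\<^esub> (c \<odot>\<^bsub>M\<^esub> b \<oplus>\<^bsub>M\<^esub> w) = (\<ominus> (c \<otimes> c')) \<odot>\<^bsub>M\<^esub> b \<oplus>\<^bsub>M\<^esub> (\<ominus> c') \<odot>\<^bsub>M\<^esub> w"
    using assms by (simp add: smult_r_distr smult_assoc1[symmetric] R.l_minus R.r_minus m_comm)
  moreover have "(c \<otimes> c') \<odot>\<^bsub>M\<^esub> b \<oplus>\<^bsub>M\<^esub> (\<ominus> (c \<otimes> c')) \<odot>\<^bsub>M\<^esub> b = \<zero>\<^bsub>M\<^esub>"
    using assms by (simp add: smult_l_distr[symmetric] R.r_neg)
  moreover have "(x \<oplus>\<^bsub>M\<^esub> y) \<oplus>\<^bsub>M\<^esub> (x' \<oplus>\<^bsub>M\<^esub> y') = (x \<oplus>\<^bsub>M\<^esub> x') \<oplus>\<^bsub>M\<^esub> (y \<oplus>\<^bsub>M\<^esub> y')"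
    if "x \<in> carrier M" "y \<in> carrier M" "x' \<in> carrier M" "y' \<in> carrier M" for x y x' y'
    using that by (simp add: M.a_ac)
  note this[of "(c \<otimes> c') \<odot>\<^bsub>M\<^esub> b" "c \<odot>\<^bsub>M\<^esub> w'" "(\<ominus> (c \<otimes> c')) \<odot>\<^bsub>M\<^esub> b" "(\<ominus> c') \<odot>\<^bsub>M\<^esub> w"]
  ultimately show ?thesis using assms by simp
qed

text \<open>The torsion modulo \<open>N\<close> comes with no generating set of its own, so the
  common annihilator is built by induction on the generators of the ambient span. If some torsion
  element involves the new generator, that one element suffices to eliminate the generator from all
  others.\<close>

lemma torsion_annihilator:
  assumes N: "submodule N R M" and "finite B" "B \<subseteq> carrier M"
  shows "\<exists>s\<in>carrier R - {\<zero>}. \<forall>t\<in>span_in M (carrier R) B.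
    (\<exists>p\<in>carrier R - {\<zero>}. p \<odot>\<^bsub>M\<^esub> t \<in> N) \<longrightarrow> s \<odot>\<^bsub>M\<^esub> t \<in> N"
  using assms(2,3)
proof (induction B rule: finite_induct)
  case empty
  have "t = \<zero>\<^bsub>M\<^esub>" if "t \<in> span_in M (carrier R) {}" for t
    using that by cases auto
  then have "\<one> \<odot>\<^bsub>M\<^esub> t \<in> N" if "t \<in> span_in M (carrier R) {}" for t
    using \<open>\<And>t. t \<in> span_in M (carrier R) {} \<Longrightarrow> t = \<zero>\<^bsub>M\<^esub>\<close>[OF that] submoduleD(2)[OF N] by simp
  then show ?case by (intro bexI[of _ \<one>]) auto
next
  case (insert b B)
  then have B: "B \<subseteq> carrier M" "b \<in> carrier M" by auto
  note cl = span_in_closed[OF subset_refl B(1)]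
  note ND = submoduleD[OF N]
  from insert B obtain s where s: "s \<in> carrier R - {\<zero>}"
    "\<And>t p. t \<in> span_in M (carrier R) B \<Longrightarrow> p \<in> carrier R - {\<zero>} \<Longrightarrow> p \<odot>\<^bsub>M\<^esub> t \<in> N \<Longrightarrow> s \<odot>\<^bsub>M\<^esub> t \<in> N"
    by blast
  show ?case
  \<comment> \<open>Whether some torsion element modulo \<open>N\<close> has a nonzero coefficient
    at \<open>b\<close>. If none has, the old annihilator \<open>s\<close> still works.\<close>
  proof (cases "\<exists>c\<in>carrier R - {\<zero>}. \<exists>w\<in>span_in M (carrier R) B. \<exists>p\<in>carrier R - {\<zero>}.
      p \<odot>\<^bsub>M\<^esub> (c \<odot>\<^bsub>M\<^esub> b \<oplus>\<^bsub>M\<^esub> w) \<in> N")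
    case False
    have "s \<odot>\<^bsub>M\<^esub> t \<in> N" if t: "t \<in> span_in M (carrier R) (insert b B)"
      and p: "p \<in> carrier R - {\<zero>}" "p \<odot>\<^bsub>M\<^esub> t \<in> N" for t p
    proof -
      obtain c w where cw: "c \<in> carrier R" "w \<in> span_in M (carrier R) B" "t = c \<odot>\<^bsub>M\<^esub> b \<oplus>\<^bsub>M\<^esub> w"
        using span_in_insertE[OF insert.prems t] by blast
      then have "c = \<zero>" using False p by blast
      then have "t = w" using cw cl B by simp
      then show ?thesis using s(2)[OF cw(2) p(1)] p(2) by simp
    qed
    then show ?thesis using s(1) by blast
  next
    case True
    then obtain c0 w0 p0 where c0: "c0 \<in> carrier R - {\<zero>}" and w0: "w0 \<in> span_in M (carrier R) B"
      and p0: "p0 \<in> carrier R - {\<zero>}" "p0 \<odot>\<^bsub>M\<^esub> (c0 \<odot>\<^bsub>M\<^esub> b \<oplus>\<^bsub>M\<^esub> w0) \<in> N" by blast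
    define t0 where "t0 = c0 \<odot>\<^bsub>M\<^esub> b \<oplus>\<^bsub>M\<^esub> w0"
    have t0: "t0 \<in> carrier M" using c0 B cl[OF w0] by (simp add: t0_def)
    have "(p0 \<otimes> s \<otimes> c0) \<odot>\<^bsub>M\<^esub> t \<in> N" if t: "t \<in> span_in M (carrier R) (insert b B)"
      and p: "p \<in> carrier R - {\<zero>}" "p \<odot>\<^bsub>M\<^esub> t \<in> N" for t p
    proof -
      obtain c w where cw: "c \<in> carrier R" "w \<in> span_in M (carrier R) B" "t = c \<odot>\<^bsub>M\<^esub> b \<oplus>\<^bsub>M\<^esub> w"
        using span_in_insertE[OF insert.prems t] by blast
      have tc: "t \<in> carrier M" using cw B cl by simp
      \<comment> \<open>\<open>c0 t - c t0\<close> is free of \<open>b\<close>. It is torsion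
        because \<open>p \<otimes> p0\<close> carries both of its summands into \<open>N\<close>, so
        \<open>s\<close> applies to it.\<close>
      define u where "u = c0 \<odot>\<^bsub>M\<^esub> t \<oplus>\<^bsub>M\<^esub> (\<ominus> c) \<odot>\<^bsub>M\<^esub> t0"
      have uc: "u \<in> carrier M" using tc t0 c0 cw by (simp add: u_def)
      have "u = c0 \<odot>\<^bsub>M\<^esub> w \<oplus>\<^bsub>M\<^esub> (\<ominus> c) \<odot>\<^bsub>M\<^esub> w0"
        unfolding u_def t0_def cw(3) using c0 cw B cl w0 by (intro eliminate_generator) auto
      then have u: "u \<in> span_in M (carrier R) B"
        using c0 cw w0 submoduleD(3,5)[OF submodule_span[OF B(1)]] by simp
      have "(p \<otimes> p0) \<odot>\<^bsub>M\<^esub> u = (c0 \<otimes> p0) \<odot>\<^bsub>M\<^esub> (p \<odot>\<^bsub>M\<^esub> t) \<oplus>\<^bsub>M\<^esub> (p \<otimes> (\<ominus> c)) \<odot>\<^bsub>M\<^esub> (p0 \<odot>\<^bsub>M\<^esub> t0)"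
        unfolding u_def using tc t0 c0 cw p p0
        by (simp add: smult_r_distr smult_assoc1[symmetric]) (simp add: m_ac)
      also have "\<dots> \<in> N" using c0 cw p p0 ND unfolding t0_def by simp
      finally have "s \<odot>\<^bsub>M\<^esub> u \<in> N" using s(2)[OF u, of "p \<otimes> p0"] p p0 integral by auto
      \<comment> \<open>The extra factor \<open>p0\<close> pushes the summand with \<open>t0\<close>
        into \<open>N\<close>. What remains is the multiple
        \<open>p0 \<otimes> s \<otimes> c0\<close> of \<open>t\<close>, a factor chosen
        independently of \<open>t\<close> and \<open>p\<close>.\<close>
      then have "p0 \<odot>\<^bsub>M\<^esub> (s \<odot>\<^bsub>M\<^esub> u) \<in> N" using ND p0 by simp
      also have "p0 \<odot>\<^bsub>M\<^esub> (s \<odot>\<^bsub>M\<^esub> u) =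
          (p0 \<otimes> s \<otimes> c0) \<odot>\<^bsub>M\<^esub> t \<oplus>\<^bsub>M\<^esub> (s \<otimes> (\<ominus> c)) \<odot>\<^bsub>M\<^esub> (p0 \<odot>\<^bsub>M\<^esub> t0)"
        unfolding u_def using tc t0 c0 cw p p0 s(1)
        by (simp add: smult_r_distr smult_assoc1[symmetric]) (simp add: m_ac)
      finally show ?thesis
        using submodule_cancel[OF N] p0 c0 s(1) cw tc ND(5) unfolding t0_def by simp
    qed
    moreover have "p0 \<otimes> s \<otimes> c0 \<in> carrier R - {\<zero>}" using p0 s(1) c0 integral by auto
    ultimately show ?thesis by blast
  qed
qed

text \<open>Fraction-free Gaussian elimination: the first \<open>v i\<close> that involves the generator \<open>b\<close> is dropped
  and used to eliminate \<open>b\<close> from the later ones.\<close>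

lemma saturated_chain_bound:
  assumes "finite B" "B \<subseteq> carrier M"
    and "\<And>i. submodule (N i) R M" "\<And>i. N i \<subseteq> N (Suc i)"
    and "\<And>i. i < k \<Longrightarrow> v i \<in> span_in M (carrier R) B"
    and "\<And>i. i < k \<Longrightarrow> v i \<in> N (Suc i)"
    and "\<And>i p. i < k \<Longrightarrow> p \<in> carrier R - {\<zero>} \<Longrightarrow> p \<odot>\<^bsub>M\<^esub> v i \<notin> N i"
  shows "k \<le> card B"
  using assms
proof (induction B arbitrary: k v N rule: finite_induct)
  case empty
  show ?case
  proof (rule ccontr)
    assume "\<not> ?thesis"
    then have k: "0 < k" by simp
    from empty(4)[OF k] have "v 0 = \<zero>\<^bsub>M\<^esub>" by cases auto
    then show False using empty(6)[OF k, of \<one>] submoduleD(2)[OF empty(2)[of 0]] by simp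
  qed
next
  case (insert b B)
  note N = insert.prems(2) and mono = insert.prems(3) and sp = insert.prems(4)
    and vN = insert.prems(5) and tf = insert.prems(6)
  have B: "B \<subseteq> carrier M" "b \<in> carrier M" using insert.prems(1) by auto
  note cl = span_in_closed[OF subset_refl B(1)]
  have "\<exists>c w. i < k \<longrightarrow> c \<in> carrier R \<and> w \<in> span_in M (carrier R) B \<and> v i = c \<odot>\<^bsub>M\<^esub> b \<oplus>\<^bsub>M\<^esub> w" for i
    using span_in_insertE[OF insert.prems(1) sp] by metis
  then obtain c w where c: "\<And>i. i < k \<Longrightarrow> c i \<in> carrier R"
    and w: "\<And>i. i < k \<Longrightarrow> w i \<in> span_in M (carrier R) B"
    and v: "\<And>i. i < k \<Longrightarrow> v i = c i \<odot>\<^bsub>M\<^esub> b \<oplus>\<^bsub>M\<^esub> w i" by metis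
  have vc: "v i \<in> carrier M" if "i < k" for i using v c w B cl that by simp
  show ?case
  proof (cases "\<exists>i<k. c i \<noteq> \<zero>")
    case False
    have "v i \<in> span_in M (carrier R) B" if "i < k" for i
      using v[OF that] w[OF that] cl B False that by auto
    then have "k \<le> card B" by (intro insert.IH[OF B(1), of N k v]) (use N mono vN tf in auto)
    then show ?thesis using insert by simp
  next
    case True
    define i where "i = (LEAST i. i < k \<and> c i \<noteq> \<zero>)"
    have i: "i < k" "c i \<noteq> \<zero>" using LeastI_ex[OF True] by (auto simp: i_def)
    have less: "c j = \<zero>" if "j < i" for j using not_less_Least[of j "\<lambda>j. j < k \<and> c j \<noteq> \<zero>"] that i(1) by (simp add: i_def)
    \<comment> \<open>Entries before \<open>i\<close> have coefficient zero at \<open>b\<close> and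
      stay. From \<open>i\<close> on the index is one ahead, because \<open>v i\<close> is spent;
      accordingly \<open>N'\<close> leaves out the term \<open>N (Suc i)\<close>.\<close>
    define v' where "v' j = (if j < i then v j else c i \<odot>\<^bsub>M\<^esub> v (Suc j) \<oplus>\<^bsub>M\<^esub> (\<ominus> c (Suc j)) \<odot>\<^bsub>M\<^esub> v i)" for j
    define N' where "N' j = (if j \<le> i then N j else N (Suc j))" for j
    have monoN: "N a \<subseteq> N b" if "a \<le> b" for a b using mono that by (rule lift_Suc_mono_le)
    have "k - 1 \<le> card B"
    proof (rule insert.IH[OF B(1)])
      show "submodule (N' j) R M" for j using N by (simp add: N'_def)
      show "N' j \<subseteq> N' (Suc j)" for j using monoN by (auto simp: N'_def)
      fix j assume j: "j < k - 1"
      show "v' j \<in> span_in M (carrier R) B"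
      proof (cases "j < i")
        case True
        then show ?thesis using j v[of j] w[of j] cl B less[of j] by (simp add: v'_def)
      next
        case False
        have "v' j = c i \<odot>\<^bsub>M\<^esub> w (Suc j) \<oplus>\<^bsub>M\<^esub> (\<ominus> c (Suc j)) \<odot>\<^bsub>M\<^esub> w i"
          using False i j c w cl B by (simp add: v'_def v eliminate_generator)
        then show ?thesis
          using i j c w submoduleD(3,5)[OF submodule_span[OF B(1)]] by simp
      qed
      show "v' j \<in> N' (Suc j)"
      proof (cases "j < i")
        case True
        then show ?thesis using j vN[of j] by (simp add: v'_def N'_def)
      next
        case False
        have "v i \<in> N (Suc (Suc j))" using vN[OF i(1)] monoN[of "Suc i" "Suc (Suc j)"] False by auto
        then show ?thesis
          using False i j c vN[of "Suc j"] submoduleD[OF N[of "Suc (Suc j)"]] by (simp add: v'_def N'_def)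
      qed
      fix p assume p: "p \<in> carrier R - {\<zero>}"
      show "p \<odot>\<^bsub>M\<^esub> v' j \<notin> N' j"
      proof (cases "j < i")
        case True
        then show ?thesis using j tf[of j p] p by (simp add: v'_def N'_def)
      next
        case False
        show ?thesis
        proof
          assume "p \<odot>\<^bsub>M\<^esub> v' j \<in> N' j"
          then have "p \<odot>\<^bsub>M\<^esub> v' j \<in> N (Suc j)" using mono False by (auto simp: N'_def split: if_splits)
          moreover have "p \<odot>\<^bsub>M\<^esub> v' j = (p \<otimes> c i) \<odot>\<^bsub>M\<^esub> v (Suc j) \<oplus>\<^bsub>M\<^esub> (p \<otimes> (\<ominus> c (Suc j))) \<odot>\<^bsub>M\<^esub> v i"
            using False i j c p vc by (simp add: v'_def smult_r_distr smult_assoc1)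
          \<comment> \<open>As \<open>i \<le> j\<close>, the correction by \<open>v i\<close>
            vanishes modulo \<open>N (Suc j)\<close>. There \<open>v' j\<close> is just
            \<open>c i\<close> times \<open>v (Suc j)\<close>, with \<open>c i\<close> nonzero, and
            the assumption on \<open>v (Suc j)\<close> applies.\<close>
          moreover have "v i \<in> N (Suc j)" using vN[OF i(1)] monoN[of "Suc i" "Suc j"] False by auto
          then have "(p \<otimes> (\<ominus> c (Suc j))) \<odot>\<^bsub>M\<^esub> v i \<in> N (Suc j)"
            using submoduleD(5)[OF N] p c j by simp
          ultimately have "(p \<otimes> c i) \<odot>\<^bsub>M\<^esub> v (Suc j) \<in> N (Suc j)"
            using submodule_cancel[OF N] p c i j vc by simp
          moreover have "p \<otimes> c i \<in> carrier R - {\<zero>}" using p i c integral by auto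
          ultimately show False using tf[of "Suc j"] j by auto
        qed
      qed
    qed
    then show ?thesis using insert(1,2) by simp
  qed
qed

end

section \<open>Operators on Laurent polynomials\<close>

lemma exponent_induct [case_names zero plus minus]:
  fixes \<alpha> :: "'d \<Rightarrow>\<^sub>0 int"
  assumes "P 0" and plus: "\<And>\<alpha> i. P \<alpha> \<Longrightarrow> P (\<alpha> + Poly_Mapping.single i 1)"
    and minus: "\<And>\<alpha> i. P \<alpha> \<Longrightarrow> P (\<alpha> + Poly_Mapping.single i (- 1))"
  shows "P \<alpha>"
proof -
  have step: "P (\<beta> + Poly_Mapping.single i z)" if "P \<beta>" for \<beta> i z
  proof (induction z rule: int_induct[where k = 0])
    case base
    then show ?case using that by simp
  next
    case (step1 z)
    show ?case using plus[OF step1(2), of i] by (simp add: add.assoc single_add[symmetric])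
  next
    case (step2 z)
    have "P (\<beta> + Poly_Mapping.single i z + Poly_Mapping.single i (- 1))" by (rule minus[OF step2(2)])
    then show ?case by (simp only: add.assoc single_add[symmetric] diff_conv_add_uminus)
  qed
  have "P (\<Sum>i\<in>S. Poly_Mapping.single i (Poly_Mapping.lookup \<alpha> i))" if "finite S" for S
    using that
  proof (induction S rule: finite_induct)
    case (insert i S)
    then show ?case using step[OF insert.IH] by (simp add: add.commute)
  qed (use assms in simp)
  from this[OF finite_keys, of \<alpha>]
  have "P (\<Sum>i\<in>Poly_Mapping.keys \<alpha>. Poly_Mapping.single i (Poly_Mapping.lookup \<alpha> i))" .
  moreover have "(\<Sum>i\<in>Poly_Mapping.keys \<alpha>. Poly_Mapping.single i (Poly_Mapping.lookup \<alpha> i)) = \<alpha>"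
    by (intro poly_mapping_eqI) (simp add: lookup_sum lookup_single when_def in_keys_iff)
  ultimately show ?thesis by simp
qed

text \<open>The operators diagonal in the monomial basis. Scalars and Euler operators are of this
  kind, so computations in \<open>U_h\<close> become pointwise computations with functions of the
  exponent.\<close>

definition diag_op :: "(('d \<Rightarrow>\<^sub>0 int) \<Rightarrow> complex) \<Rightarrow> 'd laurent_op" where
  "diag_op \<phi> = Poly_Mapping.mapp (\<lambda>\<alpha> c. \<phi> \<alpha> * c)"

definition mon_op :: "('d \<Rightarrow>\<^sub>0 int) \<Rightarrow> 'd laurent_op" where
  "mon_op \<alpha> p = Poly_Mapping.single \<alpha> 1 * p"

lemma lookup_single_mult:
  fixes p :: "('d \<Rightarrow>\<^sub>0 int) \<Rightarrow>\<^sub>0 complex"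
  shows "Poly_Mapping.lookup (Poly_Mapping.single \<alpha> c * p) \<beta> = c * Poly_Mapping.lookup p (\<beta> - \<alpha>)"
proof -
  have "(\<Sum>q. Poly_Mapping.lookup p q when \<beta> = l + q) = Poly_Mapping.lookup p (\<beta> - l)" for l
  proof -
    have "\<beta> = l + q \<longleftrightarrow> q = \<beta> - l" for q by (auto simp: algebra_simps)
    then show ?thesis by simp
  qed
  then have "Poly_Mapping.lookup (Poly_Mapping.single \<alpha> c * p) \<beta> =
      (\<Sum>l. (c when \<alpha> = l) * Poly_Mapping.lookup p (\<beta> - l))"
    by (simp add: lookup_mult lookup_single)
  also have "\<dots> = (\<Sum>l. (c * Poly_Mapping.lookup p (\<beta> - l)) when l = \<alpha>)"
    by (intro Sum_any.cong) (auto simp: when_def)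
  finally show ?thesis by simp
qed

lemma lookup_mon_op [simp]: "Poly_Mapping.lookup (mon_op \<alpha> p) \<beta> = Poly_Mapping.lookup p (\<beta> - \<alpha>)"
  by (simp add: mon_op_def lookup_single_mult)

lemma lookup_diag_op [simp]: "Poly_Mapping.lookup (diag_op \<phi> p) \<beta> = \<phi> \<beta> * Poly_Mapping.lookup p \<beta>"
  by (simp add: diag_op_def lookup_mapp when_def in_keys_iff)

lemma X_op_eq: "X_op i = mon_op (Poly_Mapping.single i 1)"
  and X_inv_op_eq: "X_inv_op i = mon_op (Poly_Mapping.single i (- 1))"
  by (auto simp: X_op_def X_inv_op_def mon_op_def)

lemma scalar_op_eq: "scalar_op c = diag_op (\<lambda>_. c)"
  by (intro ext poly_mapping_eqI) (simp add: scalar_op_def lookup_single_mult)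

lemma euler_op_eq: "euler_op i = diag_op (\<lambda>\<alpha>. of_int (Poly_Mapping.lookup \<alpha> i))"
  by (intro ext) (simp add: euler_op_def diag_op_def)

lemma mon_op_0: "mon_op 0 = id"
  by (intro ext poly_mapping_eqI) simp

lemma mon_op_add: "mon_op (\<alpha> + \<beta>) = mon_op \<alpha> \<circ> mon_op \<beta>"
  by (intro ext poly_mapping_eqI) (simp add: diff_diff_eq)

lemma diag_op_one: "diag_op (\<lambda>_. 1) = id"
  by (intro ext poly_mapping_eqI) simp

lemma diag_op_zero: "diag_op (\<lambda>_. 0) = (\<lambda>_. 0)"
  by (intro ext poly_mapping_eqI) simp

lemma diag_op_mult: "diag_op \<phi> \<circ> diag_op \<psi> = diag_op (\<lambda>\<alpha>. \<phi> \<alpha> * \<psi> \<alpha>)"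
  by (intro ext poly_mapping_eqI) simp

lemma diag_op_add: "(\<lambda>p. diag_op \<phi> p + diag_op \<psi> p) = diag_op (\<lambda>\<alpha>. \<phi> \<alpha> + \<psi> \<alpha>)"
  by (intro ext poly_mapping_eqI) (simp add: lookup_add algebra_simps)

lemma diag_op_eq_iff: "diag_op \<phi> = diag_op \<psi> \<longleftrightarrow> \<phi> = \<psi>"
proof
  assume *: "diag_op \<phi> = diag_op \<psi>"
  show "\<phi> = \<psi>"
  proof
    fix \<alpha>
    have "Poly_Mapping.lookup (diag_op \<phi> (Poly_Mapping.single \<alpha> 1)) \<alpha> =
        Poly_Mapping.lookup (diag_op \<psi> (Poly_Mapping.single \<alpha> 1)) \<alpha>" using * by simp
    then show "\<phi> \<alpha> = \<psi> \<alpha>" by simp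
  qed
qed simp

text \<open>The commutation relation of the Weyl algebra for all monomials at once: the coefficient
  that arrives at \<open>\<beta>\<close> was at \<open>\<beta> - \<alpha>\<close> when the diagonal
  operator acted on it.\<close>

lemma mon_op_diag_op: "mon_op \<alpha> \<circ> diag_op \<phi> = diag_op (\<lambda>\<beta>. \<phi> (\<beta> - \<alpha>)) \<circ> mon_op \<alpha>"
  by (intro ext poly_mapping_eqI) simp

subsection \<open>Polynomial functions on the exponent lattice\<close>

text \<open>The polynomial ring is taken as a ring of functions, since the elements of
  \<open>U_h\<close> are operators determined by their eigenvalues on monomials. Translation is then
  mere substitution.\<close>

inductive_set polyfun :: "(('d \<Rightarrow>\<^sub>0 int) \<Rightarrow> complex) set" where
  const: "(\<lambda>_. c) \<in> polyfun"
| coord: "(\<lambda>\<alpha>. of_int (Poly_Mapping.lookup \<alpha> i)) \<in> polyfun"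
| add: "\<phi> \<in> polyfun \<Longrightarrow> \<psi> \<in> polyfun \<Longrightarrow> (\<lambda>\<alpha>. \<phi> \<alpha> + \<psi> \<alpha>) \<in> polyfun"
| mult: "\<phi> \<in> polyfun \<Longrightarrow> \<psi> \<in> polyfun \<Longrightarrow> (\<lambda>\<alpha>. \<phi> \<alpha> * \<psi> \<alpha>) \<in> polyfun"

lemma polyfun_shift: "\<phi> \<in> polyfun \<Longrightarrow> (\<lambda>\<beta>. \<phi> (\<beta> - \<alpha>)) \<in> polyfun"
proof (induction rule: polyfun.induct)
  case (coord i)
  have "(\<lambda>\<beta>. of_int (Poly_Mapping.lookup \<beta> i) + - of_int (Poly_Mapping.lookup \<alpha> i)) \<in> polyfun"
    by (intro polyfun.intros)
  then show ?case by (simp add: lookup_minus)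
qed (auto intro: polyfun.intros)

text \<open>Reduces questions of vanishing to a polynomial in one variable, which has finitely many
  roots unless it is zero.\<close>

lemma polyfun_on_line:
  assumes "\<phi> \<in> polyfun"
  shows "\<exists>q. \<forall>t. \<phi> (\<alpha> + Poly_Mapping.map (\<lambda>x. t * x) \<beta>) = poly q (of_int t)"
  using assms
proof (induction rule: polyfun.induct)
  case (const c)
  show ?case by (rule exI[of _ "[:c:]"]) simp
next
  case (coord i)
  show ?case
    by (rule exI[of _ "[:of_int (Poly_Mapping.lookup \<alpha> i), of_int (Poly_Mapping.lookup \<beta> i):]"])
      (auto simp: lookup_add map.rep_eq when_def)
next
  case (add \<phi> \<psi>)
  then obtain p q where "\<forall>t. \<phi> (\<alpha> + Poly_Mapping.map (\<lambda>x. t * x) \<beta>) = poly p (of_int t)"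
    "\<forall>t. \<psi> (\<alpha> + Poly_Mapping.map (\<lambda>x. t * x) \<beta>) = poly q (of_int t)" by blast
  then show ?case by (intro exI[of _ "p + q"]) simp
next
  case (mult \<phi> \<psi>)
  then obtain p q where "\<forall>t. \<phi> (\<alpha> + Poly_Mapping.map (\<lambda>x. t * x) \<beta>) = poly p (of_int t)"
    "\<forall>t. \<psi> (\<alpha> + Poly_Mapping.map (\<lambda>x. t * x) \<beta>) = poly q (of_int t)" by blast
  then show ?case by (intro exI[of _ "p * q"]) simp
qed

text \<open>Along the line through a point where \<open>\<phi>\<close> does not vanish and one where \<open>\<psi>\<close> does not, both restrict
  to nonzero polynomials in one variable.\<close>

lemma polyfun_integral:
  assumes "\<phi> \<in> polyfun" "\<psi> \<in> polyfun" "\<And>\<alpha>. \<phi> \<alpha> * \<psi> \<alpha> = 0"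
  shows "(\<forall>\<alpha>. \<phi> \<alpha> = 0) \<or> (\<forall>\<alpha>. \<psi> \<alpha> = 0)"
proof (rule ccontr)
  assume "\<not> ?thesis"
  then obtain \<alpha> \<beta> where nz: "\<phi> \<alpha> \<noteq> 0" "\<psi> \<beta> \<noteq> 0" by blast
  define l where "l t = \<alpha> + Poly_Mapping.map (\<lambda>x. t * x) (\<beta> - \<alpha>)" for t
  have "l 0 = \<alpha>" by (intro poly_mapping_eqI) (simp add: l_def lookup_add map.rep_eq)
  have "l 1 = \<beta>" by (intro poly_mapping_eqI) (simp add: l_def lookup_add map.rep_eq lookup_minus when_def)
  obtain p q where p: "\<And>t. \<phi> (l t) = poly p (of_int t)" and q: "\<And>t. \<psi> (l t) = poly q (of_int t)"
    using polyfun_on_line[OF assms(1), of \<alpha> "\<beta> - \<alpha>"] polyfun_on_line[OF assms(2), of \<alpha> "\<beta> - \<alpha>"]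
    unfolding l_def by blast
  have "p \<noteq> 0" "q \<noteq> 0" using p[of 0] q[of 1] nz \<open>l 0 = \<alpha>\<close> \<open>l 1 = \<beta>\<close> by auto
  then have "finite {x. poly (p * q) x = 0}" using poly_roots_finite[of "p * q"] by simp
  moreover have "range (of_int :: int \<Rightarrow> complex) \<subseteq> {x. poly (p * q) x = 0}"
    using assms(3) by (auto simp flip: p q simp del: mult_eq_0_iff)
  ultimately have "finite (range (of_int :: int \<Rightarrow> complex))" using finite_subset by blast
  then show False using finite_imageD[of "of_int :: int \<Rightarrow> complex" UNIV] by (simp add: inj_on_def infinite_UNIV_int)
qed

text \<open>Stands in for total degree below \<open>n\<close>, a notion expressed here through the
  function alone: any \<open>n\<close> successive unit differences give zero. Order 0 means the zero
  function, order 1 a constant.\<close>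

primrec diff_nilpotent :: "nat \<Rightarrow> (('d \<Rightarrow>\<^sub>0 int) \<Rightarrow> complex) \<Rightarrow> bool" where
  "diff_nilpotent 0 \<phi> \<longleftrightarrow> \<phi> = (\<lambda>_. 0)"
| "diff_nilpotent (Suc n) \<phi> \<longleftrightarrow> (\<forall>i. diff_nilpotent n (\<lambda>\<alpha>. \<phi> (\<alpha> + Poly_Mapping.single i 1) - \<phi> \<alpha>))"

lemma diff_nilpotent_zero: "diff_nilpotent n (\<lambda>_. 0)"
  by (induction n) auto

lemma diff_nilpotent_Suc: "diff_nilpotent n \<phi> \<Longrightarrow> diff_nilpotent (Suc n) \<phi>"
  by (induction n arbitrary: \<phi>) auto

lemma diff_nilpotent_mono: "diff_nilpotent m \<phi> \<Longrightarrow> m \<le> n \<Longrightarrow> diff_nilpotent n \<phi>"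
proof (induction n)
  case (Suc n)
  then show ?case using diff_nilpotent_Suc[of n \<phi>] by (cases "m = Suc n") auto
qed simp

lemma diff_nilpotent_add:
  "diff_nilpotent n \<phi> \<Longrightarrow> diff_nilpotent n \<psi> \<Longrightarrow> diff_nilpotent n (\<lambda>\<alpha>. \<phi> \<alpha> + \<psi> \<alpha>)"
proof (induction n arbitrary: \<phi> \<psi>)
  case (Suc n)
  have "(\<lambda>\<alpha>. \<phi> (\<alpha> + Poly_Mapping.single i 1) + \<psi> (\<alpha> + Poly_Mapping.single i 1) - (\<phi> \<alpha> + \<psi> \<alpha>)) =
    (\<lambda>\<alpha>. (\<phi> (\<alpha> + Poly_Mapping.single i 1) - \<phi> \<alpha>) + (\<psi> (\<alpha> + Poly_Mapping.single i 1) - \<psi> \<alpha>))" for i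
    by auto
  then show ?case using Suc by simp
qed auto

lemma diff_nilpotent_shift: "diff_nilpotent n \<phi> \<Longrightarrow> diff_nilpotent n (\<lambda>\<alpha>. \<phi> (\<alpha> + \<beta>))"
proof (induction n arbitrary: \<phi>)
  case (Suc n)
  then have "diff_nilpotent n (\<lambda>\<alpha>. \<phi> (\<alpha> + \<beta> + Poly_Mapping.single i 1) - \<phi> (\<alpha> + \<beta>))" for i
    using Suc.IH[of "\<lambda>\<alpha>. \<phi> (\<alpha> + Poly_Mapping.single i 1) - \<phi> \<alpha>"] by simp
  then show ?case by (simp add: algebra_simps)
qed auto

text \<open>Induction on \<open>n + m\<close> through the discrete Leibniz rule: the difference of a
  product is the difference of \<open>\<phi>\<close> times \<open>\<psi>\<close>, plus the translate
  of \<open>\<phi>\<close> times the difference of \<open>\<psi>\<close>. In each summand one order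
  drops by one.\<close>

lemma diff_nilpotent_mult:
  "diff_nilpotent n \<phi> \<Longrightarrow> diff_nilpotent m \<psi> \<Longrightarrow> diff_nilpotent (n + m) (\<lambda>\<alpha>. \<phi> \<alpha> * \<psi> \<alpha>)"
proof (induction "n + m" arbitrary: n m \<phi> \<psi>)
  case (Suc k)
  show ?case
  proof (cases "n = 0 \<or> m = 0")
    case True
    then have "(\<lambda>\<alpha>. \<phi> \<alpha> * \<psi> \<alpha>) = (\<lambda>_. 0)" using Suc by auto
    then show ?thesis using diff_nilpotent_zero by simp
  next
    case False
    then obtain n' m' where nm: "n = Suc n'" "m = Suc m'" by (metis not0_implies_Suc)
    have "diff_nilpotent k (\<lambda>\<alpha>. \<phi> (\<alpha> + Poly_Mapping.single i 1) * \<psi> (\<alpha> + Poly_Mapping.single i 1) - \<phi> \<alpha> * \<psi> \<alpha>)" for i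
    proof -
      have 1: "diff_nilpotent k (\<lambda>\<alpha>. (\<phi> (\<alpha> + Poly_Mapping.single i 1) - \<phi> \<alpha>) * \<psi> \<alpha>)"
      proof -
        have "k = n' + m" using Suc.hyps(2) nm by simp
        moreover have "diff_nilpotent n' (\<lambda>\<alpha>. \<phi> (\<alpha> + Poly_Mapping.single i 1) - \<phi> \<alpha>)"
          using Suc.prems(1) nm by simp
        ultimately show ?thesis using Suc.hyps(1) Suc.prems(2) by blast
      qed
      have "diff_nilpotent n (\<lambda>\<alpha>. \<phi> (\<alpha> + Poly_Mapping.single i 1))"
        using Suc.prems(1) by (rule diff_nilpotent_shift)
      moreover have "diff_nilpotent m' (\<lambda>\<alpha>. \<psi> (\<alpha> + Poly_Mapping.single i 1) - \<psi> \<alpha>)"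
        using Suc.prems nm by simp
      moreover have "k = n + m'" using Suc.hyps(2) nm by simp
      ultimately have 2: "diff_nilpotent k (\<lambda>\<alpha>. \<phi> (\<alpha> + Poly_Mapping.single i 1) * (\<psi> (\<alpha> + Poly_Mapping.single i 1) - \<psi> \<alpha>))"
        using Suc.hyps(1) by blast
      show ?thesis using diff_nilpotent_add[OF 1 2] by (simp add: algebra_simps)
    qed
    then show ?thesis by (simp flip: Suc.hyps(2))
  qed
qed auto

lemma polyfun_diff_nilpotent: "\<phi> \<in> polyfun \<Longrightarrow> \<exists>n. diff_nilpotent n \<phi>"
proof (induction rule: polyfun.induct)
  case (const c)
  show ?case by (rule exI[of _ 1]) simp
next
  case (coord i)
  show ?case by (rule exI[of _ 2]) (simp add: numeral_2_eq_2 lookup_add)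
next
  case (add \<phi> \<psi>)
  then obtain m n where "diff_nilpotent m \<phi>" "diff_nilpotent n \<psi>" by blast
  then have "diff_nilpotent (max m n) \<phi>" "diff_nilpotent (max m n) \<psi>"
    by (auto intro: diff_nilpotent_mono)
  then show ?case using diff_nilpotent_add by blast
next
  case (mult \<phi> \<psi>)
  then show ?case using diff_nilpotent_mult by blast
qed

text \<open>A nonzero element of \<open>I\<close> of minimal nilpotency order has zero differences, so it is constant.\<close>

lemma difference_closed_contains_const:
  assumes "I \<subseteq> polyfun" "\<phi> \<in> I" "\<phi> \<noteq> (\<lambda>_. 0)"
    and diff: "\<And>\<phi> i. \<phi> \<in> I \<Longrightarrow> (\<lambda>\<alpha>. \<phi> (\<alpha> + Poly_Mapping.single i 1) - \<phi> \<alpha>) \<in> I"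
  shows "\<exists>c. c \<noteq> 0 \<and> (\<lambda>_. c) \<in> I"
proof -
  define Q where "Q n \<longleftrightarrow> (\<exists>\<phi>\<in>I. \<phi> \<noteq> (\<lambda>_. 0) \<and> diff_nilpotent n \<phi>)" for n
  obtain n0 where "diff_nilpotent n0 \<phi>" using polyfun_diff_nilpotent assms(1,2) by blast
  then have Q0: "Q n0" using assms by (auto simp: Q_def)
  define n where "n = (LEAST n. Q n)"
  have "Q n" unfolding n_def using Q0 by (rule LeastI)
  then obtain \<psi> where \<psi>: "\<psi> \<in> I" "\<psi> \<noteq> (\<lambda>_. 0)" "diff_nilpotent n \<psi>" by (auto simp: Q_def)
  \<comment> \<open>Order 0 would force \<open>\<psi>\<close> to be zero.\<close>
  then obtain n' where n': "n = Suc n'" by (cases n) auto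
  have "\<not> Q n'" using not_less_Least[of n' Q] n' by (simp add: n_def)
  then have "(\<lambda>\<alpha>. \<psi> (\<alpha> + Poly_Mapping.single i 1) - \<psi> \<alpha>) = (\<lambda>_. 0)" for i
    using \<psi> n' diff[OF \<psi>(1)] by (auto simp: Q_def)
  then have inv: "\<psi> (\<alpha> + Poly_Mapping.single i 1) = \<psi> \<alpha>" for \<alpha> i by (metis eq_iff_diff_eq_0)
  have "\<psi> \<alpha> = \<psi> 0" for \<alpha>
  proof (induction \<alpha> rule: exponent_induct)
    case (minus \<alpha> i)
    have "\<alpha> + Poly_Mapping.single i (- 1) + Poly_Mapping.single i 1 = \<alpha>"
      by (simp add: add.assoc single_add[symmetric])
    then show ?case using inv[of "\<alpha> + Poly_Mapping.single i (- 1)" i] minus by metis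
  qed (auto simp: inv)
  then have "\<psi> = (\<lambda>_. \<psi> 0)" by auto
  then show ?thesis using \<psi> by metis
qed

subsection \<open>The rings\<close>

lemma ring_laurent_End: "ring (laurent_End :: 'd laurent_op ring)"
proof (rule ringI)
  show "abelian_group (laurent_End :: 'd laurent_op ring)"
  proof (rule abelian_groupI)
    fix T :: "'d laurent_op" assume T: "T \<in> carrier laurent_End"
    have "(\<lambda>p. - T p) \<in> carrier laurent_End"
      using T by (auto simp: laurent_End_def scalar_op_def)
    then show "\<exists>S\<in>carrier laurent_End. S \<oplus>\<^bsub>laurent_End\<^esub> T = \<zero>\<^bsub>laurent_End\<^esub>"
      by (intro bexI[of _ "\<lambda>p. - T p"]) (auto simp: laurent_End_def)
  qed (auto simp: laurent_End_def scalar_op_def algebra_simps)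
  show "Group.monoid (laurent_End :: 'd laurent_op ring)"
    by (rule monoidI) (auto simp: laurent_End_def)
qed (auto simp: laurent_End_def fun_eq_iff)

lemma diag_op_in_End [simp]: "diag_op \<phi> \<in> carrier laurent_End"
  by (auto simp: laurent_End_def scalar_op_eq intro!: poly_mapping_eqI) (simp add: lookup_add algebra_simps)

lemma mon_op_in_End [simp]: "mon_op \<alpha> \<in> carrier laurent_End"
  by (auto simp: laurent_End_def scalar_op_eq intro!: poly_mapping_eqI) (simp add: lookup_add algebra_simps)

lemma a_inv_diag_op: "\<ominus>\<^bsub>laurent_End\<^esub> diag_op \<phi> = diag_op (\<lambda>\<alpha>. - \<phi> \<alpha>)"
proof -
  interpret ring "laurent_End :: 'a laurent_op ring" by (rule ring_laurent_End)
  have "diag_op (\<lambda>\<alpha>. - \<phi> \<alpha>) \<oplus>\<^bsub>laurent_End\<^esub> diag_op \<phi> = \<zero>\<^bsub>laurent_End\<^esub>"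
    by (simp add: laurent_End_def diag_op_add diag_op_zero)
  then show ?thesis by (intro minus_equality) auto
qed

abbreviation weyl_gens :: "'d laurent_op set" where
  "weyl_gens \<equiv> range scalar_op \<union> (range X_op \<union> range X_inv_op \<union> range euler_op)"

lemma weyl_gens_subset: "weyl_gens \<subseteq> carrier laurent_End"
  by (auto simp: scalar_op_eq X_op_eq X_inv_op_eq euler_op_eq)

lemma U_gens_subset: "range scalar_op \<union> range euler_op \<subseteq> carrier laurent_End"
  by (auto simp: scalar_op_eq euler_op_eq)

lemma carrier_weyl_algebra: "carrier weyl_algebra = generate_ring laurent_End weyl_gens"
  and carrier_U_h_generate: "carrier U_h = generate_ring laurent_End (range scalar_op \<union> range euler_op)"
  by (simp_all add: weyl_algebra_def U_h_def laurent_op_algebra_def)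

lemma subring_weyl: "subring (carrier weyl_algebra) laurent_End"
  unfolding carrier_weyl_algebra by (rule ring.generate_ring_is_subring[OF ring_laurent_End weyl_gens_subset])

lemma subring_U_h: "subring (carrier U_h) laurent_End"
  unfolding carrier_U_h_generate by (rule ring.generate_ring_is_subring[OF ring_laurent_End U_gens_subset])

lemma ring_weyl: "ring weyl_algebra"
  unfolding weyl_algebra_def laurent_op_algebra_def
  by (rule ring.generate_ring_is_ring[OF ring_laurent_End weyl_gens_subset])

lemma U_h_subset_weyl: "carrier U_h \<subseteq> carrier weyl_algebra"
  unfolding carrier_U_h_generate
  by (rule ring.generate_ring_min_subring1[OF ring_laurent_End U_gens_subset subring_weyl])
    (auto simp: carrier_weyl_algebra intro: generate_ring.incl)

lemma weyl_simps [simp]: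
  "S \<otimes>\<^bsub>weyl_algebra\<^esub> T = S \<circ> T" "\<one>\<^bsub>weyl_algebra\<^esub> = id" "\<zero>\<^bsub>weyl_algebra\<^esub> = (\<lambda>_. 0)"
  "S \<oplus>\<^bsub>weyl_algebra\<^esub> T = (\<lambda>p. S p + T p)"
  by (simp_all add: weyl_algebra_def laurent_op_algebra_def laurent_End_def)

lemma U_h_simps [simp]:
  "S \<otimes>\<^bsub>U_h\<^esub> T = S \<circ> T" "\<one>\<^bsub>U_h\<^esub> = id" "\<zero>\<^bsub>U_h\<^esub> = (\<lambda>_. 0)" "S \<oplus>\<^bsub>U_h\<^esub> T = (\<lambda>p. S p + T p)"
  by (simp_all add: U_h_def laurent_op_algebra_def laurent_End_def)

lemma U_h_eq: "U_h = weyl_algebra\<lparr>carrier := carrier U_h\<rparr>"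
  by (simp add: weyl_algebra_def U_h_def laurent_op_algebra_def)

text \<open>Both sides are closures of corresponding data: the generators are diagonal with constant
  or coordinate eigenvalues, and the ring operations act on eigenvalues pointwise.\<close>

lemma carrier_U_h: "carrier U_h = diag_op ` polyfun"
proof (intro equalityI subsetI)
  fix T :: "'d laurent_op" assume "T \<in> carrier U_h"
  then show "T \<in> diag_op ` polyfun"
    unfolding carrier_U_h_generate
  proof induction
    case one
    have "\<one>\<^bsub>laurent_End\<^esub> = (diag_op (\<lambda>_. 1) :: 'd laurent_op)" by (simp add: laurent_End_def diag_op_one)
    then show ?case by (metis imageI polyfun.const)
  next
    case (incl h)
    then show ?case by (auto simp: scalar_op_eq euler_op_eq intro: polyfun.intros)
  next
    case (a_inv h)
    then obtain \<phi> where \<phi>: "h = diag_op \<phi>" "\<phi> \<in> polyfun" by auto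
    then have "(\<lambda>\<alpha>. (- 1) * \<phi> \<alpha>) \<in> polyfun" by (intro polyfun.intros)
    then show ?case using \<phi> by (simp add: a_inv_diag_op)
  next
    case (eng_add S T)
    then obtain \<phi> \<psi> where "S = diag_op \<phi>" "\<phi> \<in> polyfun" "T = diag_op \<psi>" "\<psi> \<in> polyfun" by auto
    then show ?case by (auto simp: laurent_End_def diag_op_add intro!: imageI polyfun.add)
  next
    case (eng_mult S T)
    then obtain \<phi> \<psi> where "S = diag_op \<phi>" "\<phi> \<in> polyfun" "T = diag_op \<psi>" "\<psi> \<in> polyfun" by auto
    then show ?case by (auto simp: laurent_End_def diag_op_mult intro!: imageI polyfun.mult)
  qed
next
  fix T :: "'d laurent_op" assume "T \<in> diag_op ` polyfun"
  then obtain \<phi> where \<phi>: "\<phi> \<in> polyfun" "T = diag_op \<phi>" by auto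
  have "diag_op \<phi> \<in> carrier U_h"
    using \<phi>(1)
  proof induction
    case (const c)
    have "scalar_op c \<in> carrier U_h" unfolding carrier_U_h_generate by (intro generate_ring.incl) auto
    then show ?case by (simp add: scalar_op_eq)
  next
    case (coord i)
    have "euler_op i \<in> carrier U_h" unfolding carrier_U_h_generate by (intro generate_ring.incl) auto
    then show ?case by (simp add: euler_op_eq)
  next
    case (add \<phi> \<psi>)
    then show ?case using subringE(7)[OF subring_U_h add.IH] by (simp add: laurent_End_def diag_op_add)
  next
    case (mult \<phi> \<psi>)
    then show ?case using subringE(6)[OF subring_U_h mult.IH] by (simp add: laurent_End_def diag_op_mult)
  qed
  then show "T \<in> carrier U_h" using \<phi> by simp
qed

lemma mon_op_in_weyl: "mon_op \<alpha> \<in> carrier weyl_algebra"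
proof (induction \<alpha> rule: exponent_induct)
  case zero
  then show ?case using subringE(3)[OF subring_weyl] by (simp add: laurent_End_def mon_op_0 id_def)
next
  case (plus \<alpha> i)
  have "X_op i \<in> carrier weyl_algebra" unfolding carrier_weyl_algebra by (intro generate_ring.incl) auto
  from subringE(6)[OF subring_weyl plus this]
  show ?case by (simp add: laurent_End_def mon_op_add X_op_eq comp_def)
next
  case (minus \<alpha> i)
  have "X_inv_op i \<in> carrier weyl_algebra" unfolding carrier_weyl_algebra by (intro generate_ring.incl) auto
  from subringE(6)[OF subring_weyl minus this]
  show ?case by (simp add: laurent_End_def mon_op_add X_inv_op_eq comp_def)
qed

lemma domain_U_h: "domain (U_h :: 'd laurent_op ring)"
proof -
  interpret E: ring "laurent_End :: 'd laurent_op ring" by (rule ring_laurent_End)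
  interpret ring "U_h :: 'd laurent_op ring"
    using E.subring_is_ring[OF subring_U_h] by (simp add: U_h_def laurent_op_algebra_def)
  show ?thesis
  proof unfold_locales
    fix S T :: "'d laurent_op"
    assume "S \<in> carrier U_h" "T \<in> carrier U_h"
    then show "S \<otimes>\<^bsub>U_h\<^esub> T = T \<otimes>\<^bsub>U_h\<^esub> S"
      by (auto simp: carrier_U_h diag_op_mult mult.commute)
  next
    fix S T :: "'d laurent_op"
    assume ST: "S \<otimes>\<^bsub>U_h\<^esub> T = \<zero>\<^bsub>U_h\<^esub>" "S \<in> carrier U_h" "T \<in> carrier U_h"
    then obtain \<phi> \<psi> where *: "S = diag_op \<phi>" "\<phi> \<in> polyfun" "T = diag_op \<psi>" "\<psi> \<in> polyfun"
      by (auto simp: carrier_U_h)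
    then have "diag_op (\<lambda>\<alpha>. \<phi> \<alpha> * \<psi> \<alpha>) = (diag_op (\<lambda>_. 0) :: 'd laurent_op)"
      using ST(1) by (simp add: diag_op_mult diag_op_zero)
    then have "(\<lambda>\<alpha>. \<phi> \<alpha> * \<psi> \<alpha>) = (\<lambda>_. 0)" by (simp add: diag_op_eq_iff)
    then have "\<phi> \<alpha> * \<psi> \<alpha> = 0" for \<alpha> by (rule fun_cong)
    from polyfun_integral[OF *(2,4) this] have "\<phi> = (\<lambda>_. 0) \<or> \<psi> = (\<lambda>_. 0)" by auto
    then show "S = \<zero>\<^bsub>U_h\<^esub> \<or> T = \<zero>\<^bsub>U_h\<^esub>" using * by (auto simp: diag_op_zero)
  next
    have "(diag_op (\<lambda>_. 1) :: 'd laurent_op) \<noteq> diag_op (\<lambda>_. 0)" unfolding diag_op_eq_iff by (simp add: fun_eq_iff)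
    then show "\<one>\<^bsub>U_h :: 'd laurent_op ring\<^esub> \<noteq> \<zero>\<^bsub>U_h\<^esub>" by (simp add: diag_op_one diag_op_zero)
  qed
qed

section \<open>Modules over the Weyl algebra\<close>

lemma subring_U_h_weyl: "subring (carrier U_h) weyl_algebra"
proof -
  interpret W: ring "weyl_algebra :: 'd laurent_op ring" by (rule ring_weyl)
  interpret U: domain "U_h :: 'd laurent_op ring" by (rule domain_U_h)
  show "subring (carrier U_h) (weyl_algebra :: 'd laurent_op ring)"
    using W.ring_incl_imp_subring[OF U_h_subset_weyl] U.ring_axioms U_h_eq by metis
qed

lemma X_op_pow: "X_op i [^]\<^bsub>weyl_algebra\<^esub> j = mon_op (Poly_Mapping.single i (int j))"
proof (induction j)
  case 0
  then show ?case by (simp add: mon_op_0)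
next
  case (Suc j)
  then show ?case
    by (simp add: X_op_eq mon_op_add[symmetric] single_add[symmetric] add.commute)
qed

locale weyl_module = left_module weyl_algebra M
  for M :: "('d laurent_op, 'b, 'm) module_scheme" (structure)
begin

sublocale U: domain_module U_h M
proof -
  interpret D: domain "U_h :: 'd laurent_op ring" by (rule domain_U_h)
  have "left_module (weyl_algebra\<lparr>carrier := carrier U_h\<rparr>) M"
    using left_module_axioms subring_U_h_weyl by (rule left_module_subring)
  then interpret L: left_module "U_h :: 'd laurent_op ring" M by (simp flip: U_h_eq)
  show "domain_module U_h M" by unfold_locales
qed

lemma smult_comp:
  "S \<in> carrier weyl_algebra \<Longrightarrow> T \<in> carrier weyl_algebra \<Longrightarrow> x \<in> carrier M \<Longrightarrow> S \<odot> (T \<odot> x) = (S \<circ> T) \<odot> x"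
  using smult_assoc1[of S T x] by simp

lemma diag_op_in_weyl: "\<phi> \<in> polyfun \<Longrightarrow> diag_op \<phi> \<in> carrier weyl_algebra"
  using U_h_subset_weyl by (auto simp: carrier_U_h)

lemma mon_op_smult_closed [simp]: "x \<in> carrier M \<Longrightarrow> mon_op \<alpha> \<odot> x \<in> carrier M"
  using mon_op_in_weyl by auto

lemma diag_op_smult_closed [simp]: "\<phi> \<in> polyfun \<Longrightarrow> x \<in> carrier M \<Longrightarrow> diag_op \<phi> \<odot> x \<in> carrier M"
  using diag_op_in_weyl by auto

lemma mon_op_0_smult [simp]: "x \<in> carrier M \<Longrightarrow> mon_op 0 \<odot> x = x"
  using smult_one[of x] by (simp add: mon_op_0)

lemma mon_op_smult_smult: "x \<in> carrier M \<Longrightarrow> mon_op \<alpha> \<odot> (mon_op \<beta> \<odot> x) = mon_op (\<alpha> + \<beta>) \<odot> x"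
  by (simp add: smult_comp mon_op_in_weyl mon_op_add)

lemma mon_op_diag_op_smult:
  assumes "\<phi> \<in> polyfun" "x \<in> carrier M"
  shows "mon_op \<alpha> \<odot> (diag_op \<phi> \<odot> x) = diag_op (\<lambda>\<beta>. \<phi> (\<beta> - \<alpha>)) \<odot> (mon_op \<alpha> \<odot> x)"
  using assms by (simp add: smult_comp mon_op_in_weyl diag_op_in_weyl polyfun_shift mon_op_diag_op)

lemma submodule_U_h: "submodule N weyl_algebra M \<Longrightarrow> submodule N U_h M"
  using submodule_subring[OF _ U_h_subset_weyl] by (simp flip: U_h_eq)

lemma torsion_free:
  assumes B: "finite B" "B \<subseteq> carrier M" "span_in M (carrier U_h) B = carrier M"
    and N: "submodule N weyl_algebra M"
    and t: "t \<in> carrier M" "p \<in> carrier U_h - {\<zero>\<^bsub>U_h\<^esub>}" "p \<odot> t \<in> N"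
  shows "t \<in> N"
proof -
  note ND = submoduleD[OF N] and U_in = U_h_subset_weyl
  define T where "T = {t \<in> carrier M. \<exists>p\<in>carrier U_h - {\<zero>\<^bsub>U_h\<^esub>}. p \<odot> t \<in> N}"
  obtain s where s: "s \<in> carrier U_h - {\<zero>\<^bsub>U_h\<^esub>}" "\<And>t. t \<in> T \<Longrightarrow> s \<odot> t \<in> N"
    using U.torsion_annihilator[OF submodule_U_h[OF N] B(1,2)] B(3) by (auto simp: T_def)
  \<comment> \<open>Moving a monomial past \<open>diag_op \<phi>\<close> translates
    \<open>\<phi>\<close>, and a translate of a nonzero function is nonzero, so torsion modulo
    \<open>N\<close> goes to torsion.\<close>
  have T_mon: "mon_op \<gamma> \<odot> t \<in> T" if t: "t \<in> T" for t \<gamma>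
  proof -
    obtain \<phi> where \<phi>: "\<phi> \<in> polyfun" "diag_op \<phi> \<noteq> diag_op (\<lambda>_. 0)" "diag_op \<phi> \<odot> t \<in> N" and tc: "t \<in> carrier M"
      using t by (auto simp: T_def carrier_U_h diag_op_zero)
    from \<phi>(2) obtain \<beta> where \<beta>: "\<phi> \<beta> \<noteq> 0" by (auto simp: diag_op_eq_iff)
    have "diag_op (\<lambda>\<beta>. \<phi> (\<beta> - \<gamma>)) \<odot> (mon_op \<gamma> \<odot> t) \<in> N"
      using ND(5)[OF mon_op_in_weyl \<phi>(3)] mon_op_diag_op_smult[OF \<phi>(1) tc] by simp
    moreover have "(\<lambda>\<beta>. \<phi> (\<beta> - \<gamma>)) \<noteq> (\<lambda>_. 0)" using \<beta> by (auto dest: fun_cong[of _ _ "\<beta> + \<gamma>"])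
    ultimately show ?thesis
      using tc polyfun_shift[OF \<phi>(1)]
      by (auto simp: T_def carrier_U_h diag_op_eq_iff simp flip: diag_op_zero
          intro!: bexI[of _ "diag_op (\<lambda>\<beta>. \<phi> (\<beta> - \<gamma>))"])
  qed
  define I where "I = {\<phi> \<in> polyfun. \<forall>t\<in>T. diag_op \<phi> \<odot> t \<in> N}"
  have shift: "(\<lambda>\<beta>. \<phi> (\<beta> - \<gamma>)) \<in> I" if \<phi>: "\<phi> \<in> I" for \<phi> \<gamma>
  proof -
    have "diag_op (\<lambda>\<beta>. \<phi> (\<beta> - \<gamma>)) \<odot> t \<in> N" if t: "t \<in> T" for t
    proof -
      have tc: "t \<in> carrier M" using t by (simp add: T_def)
      \<comment> \<open>Conjugation: the vector is first moved by the inverse monomial, which keeps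
        it in \<open>T\<close>, then \<open>\<phi>\<close> acts, and moving back turns
        \<open>\<phi>\<close> into its translate.\<close>
      have "diag_op \<phi> \<odot> (mon_op (- \<gamma>) \<odot> t) \<in> N" using \<phi> T_mon[OF t] by (simp add: I_def)
      then have "mon_op \<gamma> \<odot> (diag_op \<phi> \<odot> (mon_op (- \<gamma>) \<odot> t)) \<in> N" using ND(5)[OF mon_op_in_weyl] by blast
      then show ?thesis using \<phi> tc by (simp add: I_def mon_op_diag_op_smult mon_op_smult_smult)
    qed
    then show ?thesis using \<phi> by (auto simp: I_def polyfun_shift)
  qed
  have "\<exists>c. c \<noteq> 0 \<and> (\<lambda>_. c) \<in> I"
  proof -
    obtain \<phi> where \<phi>: "s = diag_op \<phi>" "\<phi> \<in> polyfun" using s(1) by (auto simp: carrier_U_h)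
    show ?thesis
    proof (rule difference_closed_contains_const)
      show "I \<subseteq> polyfun" by (auto simp: I_def)
      show "\<phi> \<in> I" using \<phi> s by (auto simp: I_def)
      show "\<phi> \<noteq> (\<lambda>_. 0)" using s(1) \<phi> by (auto simp: diag_op_zero)
      fix \<psi> and i :: 'd assume \<psi>: "\<psi> \<in> I"
      have 1: "(\<lambda>\<alpha>. \<psi> (\<alpha> + Poly_Mapping.single i 1)) \<in> I"
        using shift[OF \<psi>, of "- Poly_Mapping.single i 1"] by simp
      \<comment> \<open>The difference is written as a sum with a factor \<open>- 1\<close>, since
        \<open>polyfun\<close> is generated by sums and products.\<close>
      have 2: "(\<lambda>\<alpha>. (- 1) * \<psi> \<alpha>) \<in> polyfun" using \<psi> by (intro polyfun.intros) (simp add: I_def)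
      have 3: "(\<lambda>\<alpha>. \<psi> (\<alpha> + Poly_Mapping.single i 1) + (- 1) * \<psi> \<alpha>) \<in> polyfun"
        using 1 2 by (intro polyfun.add) (simp_all add: I_def)
      have "diag_op (\<lambda>\<alpha>. \<psi> (\<alpha> + Poly_Mapping.single i 1) + (- 1) * \<psi> \<alpha>) \<odot> t \<in> N" if t: "t \<in> T" for t
      proof -
        have tc: "t \<in> carrier M" using t by (simp add: T_def)
        have "diag_op (\<lambda>\<alpha>. \<psi> (\<alpha> + Poly_Mapping.single i 1)) \<odot> t \<in> N" "diag_op \<psi> \<odot> t \<in> N"
          using 1 \<psi> t by (auto simp: I_def)
        moreover have "diag_op (\<lambda>_. - 1) \<in> carrier weyl_algebra" by (intro diag_op_in_weyl polyfun.const)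
        ultimately have "diag_op (\<lambda>\<alpha>. \<psi> (\<alpha> + Poly_Mapping.single i 1)) \<odot> t \<oplus>
            diag_op (\<lambda>_. - 1) \<odot> (diag_op \<psi> \<odot> t) \<in> N" using ND by blast
        also have "diag_op (\<lambda>_. - 1) \<odot> (diag_op \<psi> \<odot> t) = diag_op (\<lambda>\<alpha>. (- 1) * \<psi> \<alpha>) \<odot> t"
          using \<psi> tc by (subst smult_comp) (auto simp: diag_op_mult I_def intro!: diag_op_in_weyl polyfun.intros)
        also have "diag_op (\<lambda>\<alpha>. \<psi> (\<alpha> + Poly_Mapping.single i 1)) \<odot> t \<oplus> diag_op (\<lambda>\<alpha>. (- 1) * \<psi> \<alpha>) \<odot> t =
            (diag_op (\<lambda>\<alpha>. \<psi> (\<alpha> + Poly_Mapping.single i 1)) \<oplus>\<^bsub>weyl_algebra\<^esub> diag_op (\<lambda>\<alpha>. (- 1) * \<psi> \<alpha>)) \<odot> t"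
          using 1 2 tc by (intro smult_l_distr[symmetric] diag_op_in_weyl) (auto simp: I_def)
        also have "\<dots> = diag_op (\<lambda>\<alpha>. \<psi> (\<alpha> + Poly_Mapping.single i 1) + (- 1) * \<psi> \<alpha>) \<odot> t"
          unfolding weyl_simps diag_op_add ..
        finally show ?thesis .
      qed
      then show "(\<lambda>\<alpha>. \<psi> (\<alpha> + Poly_Mapping.single i 1) - \<psi> \<alpha>) \<in> I"
        using 3 by (auto simp: I_def)
    qed
  qed
  then obtain c where c: "c \<noteq> 0" "\<And>t. t \<in> T \<Longrightarrow> diag_op (\<lambda>_. c) \<odot> t \<in> N" by (auto simp: I_def)
  have "t \<in> T" using t by (auto simp: T_def)
  \<comment> \<open>A nonzero constant acts invertibly, so its multiple of \<open>t\<close> lying in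
    \<open>N\<close> puts \<open>t\<close> itself into \<open>N\<close>.\<close>
  have c': "(diag_op (\<lambda>_. inverse c) :: 'd laurent_op) \<in> carrier weyl_algebra"
    "(diag_op (\<lambda>_. c) :: 'd laurent_op) \<in> carrier weyl_algebra"
    by (auto intro!: diag_op_in_weyl polyfun.const)
  have "diag_op (\<lambda>_. inverse c) \<odot> (diag_op (\<lambda>_. c) \<odot> t) \<in> N"
    using ND(5)[OF c'(1) c(2)[OF \<open>t \<in> T\<close>]] .
  then show ?thesis
    using c(1) c' t(1) smult_one[OF t(1)] by (simp add: smult_comp diag_op_mult diag_op_one)
qed

text \<open>A strict step yields a vector outside the smaller submodule. Torsion-freeness
  strengthens this to all its nonzero multiples over \<open>U_h\<close>, exactly what
  \<open>saturated_chain_bound\<close> asks for.\<close>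

lemma finite_length:
  assumes "finitely_generated_module U_h M"
  shows "finite_composition_length weyl_algebra M"
proof -
  obtain B where B: "finite B" "B \<subseteq> carrier M" "span_in M (carrier U_h) B = carrier M"
    using assms U.finitely_generated_module_iff by blast
  show ?thesis
  proof (rule finite_composition_lengthI[of "card B"])
    fix k :: nat and N
    assume N: "\<And>i. i \<le> k \<Longrightarrow> submodule (N i) weyl_algebra M" "\<And>i. i < k \<Longrightarrow> N i \<subset> N (Suc i)"
    have "\<forall>i. \<exists>x. i < k \<longrightarrow> x \<in> N (Suc i) \<and> x \<notin> N i" using N(2) by blast
    then obtain v where v: "\<And>i. i < k \<Longrightarrow> v i \<in> N (Suc i) \<and> v i \<notin> N i" by metis
    have vc: "v i \<in> carrier M" if "i < k" for i
      using v[OF that] submoduleD(1)[OF N(1)[of "Suc i"]] that by auto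
    show "k \<le> card B"
    proof (rule U.saturated_chain_bound[OF B(1,2)])
      \<comment> \<open>The bound speaks of submodules at all indices, so the chain is continued as
        constant after \<open>k\<close>.\<close>
      show "submodule (N (min i k)) U_h M" for i using N(1) by (simp add: submodule_U_h)
      show "N (min i k) \<subseteq> N (min (Suc i) k)" for i
        using N(2)[of i] by (cases "i < k") (auto simp: min_def)
      fix i assume i: "i < k"
      show "v i \<in> span_in M (carrier U_h) B" using vc[OF i] B(3) by simp
      show "v i \<in> N (min (Suc i) k)" using v[OF i] i by (simp add: min_def)
      fix p :: "'d laurent_op" assume "p \<in> carrier U_h - {\<zero>\<^bsub>U_h\<^esub>}"
      then show "p \<odot> v i \<notin> N (min i k)"
        using torsion_free[OF B N(1)[of i] vc[OF i]] i v[OF i] by (auto simp: min_def)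
    qed
  qed
qed

text \<open>The Weyl algebra is generated by elements of \<open>U_h\<close> and by monomials, and
  stability of \<open>N\<close> passes through the ring operations.\<close>

lemma submodule_weylI:
  assumes N: "submodule N U_h M" and mon: "\<And>\<alpha> x. x \<in> N \<Longrightarrow> mon_op \<alpha> \<odot> x \<in> N"
  shows "submodule N weyl_algebra M"
proof (rule submoduleI)
  note ND = submoduleD[OF N]
  show "N \<subseteq> carrier M" "\<zero> \<in> N" by (rule ND)+
  show "x \<oplus> y \<in> N" if "x \<in> N" "y \<in> N" for x y using that by (rule ND)
  have scalar: "T \<odot> x \<in> N" if "T \<in> carrier U_h" "x \<in> N" for T x using that by (rule ND)
  fix r :: "'d laurent_op" and x assume r: "r \<in> carrier weyl_algebra" and x: "x \<in> N"
  have gen: "generate_ring laurent_End weyl_gens = carrier weyl_algebra" by (simp add: carrier_weyl_algebra)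
  from r have "r \<in> generate_ring laurent_End weyl_gens" by (simp add: gen)
  then have "\<forall>x\<in>N. r \<odot> x \<in> N"
  proof induction
    case one
    have "\<one>\<^bsub>laurent_End\<^esub> = (id :: 'd laurent_op)" by (simp add: laurent_End_def)
    moreover have "id \<odot> x = x" if "x \<in> N" for x using ND(1) smult_one[of x] that by (simp add: subset_iff)
    ultimately show ?case by metis
  next
    case (incl h)
    then consider "h \<in> range scalar_op \<union> range euler_op" | i where "h = X_op i" | i where "h = X_inv_op i"
      by auto
    then show ?case
    proof cases
      case 1
      then have "h \<in> carrier U_h" unfolding carrier_U_h_generate by (rule generate_ring.incl)
      then show ?thesis using scalar by blast
    qed (use mon in \<open>auto simp: X_op_eq X_inv_op_eq\<close>)
  next
    \<comment> \<open>The inverse is formed in \<open>laurent_End\<close>; the relation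
      \<open>neg\<close> in the Weyl algebra identifies its action with negation in
      \<open>M\<close>.\<close>
    case (a_inv h)
    interpret E: ring "laurent_End :: 'd laurent_op ring" by (rule ring_laurent_End)
    have h: "h \<in> carrier weyl_algebra" "\<ominus>\<^bsub>laurent_End\<^esub> h \<in> carrier weyl_algebra"
      unfolding carrier_weyl_algebra using a_inv.hyps by (auto intro: generate_ring.a_inv)
    then have "h \<oplus>\<^bsub>laurent_End\<^esub> \<ominus>\<^bsub>laurent_End\<^esub> h = \<zero>\<^bsub>laurent_End\<^esub>"
      using subringE(1)[OF subring_weyl] by (intro E.r_neg) blast
    then have neg: "h \<oplus>\<^bsub>weyl_algebra\<^esub> \<ominus>\<^bsub>laurent_End\<^esub> h = \<zero>\<^bsub>weyl_algebra\<^esub>"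
      by (simp add: laurent_End_def)
    show ?case
    proof
      fix x assume x: "x \<in> N"
      then have xc: "x \<in> carrier M" using ND(1) by auto
      have "h \<odot> x \<oplus> (\<ominus>\<^bsub>laurent_End\<^esub> h) \<odot> x = \<zero>"
        using smult_l_distr[OF h xc] smult_l_null[OF xc] unfolding neg by simp
      then have "(\<ominus>\<^bsub>laurent_End\<^esub> h) \<odot> x = \<ominus> (h \<odot> x)"
        using h xc by (metis M.a_comm M.minus_equality smult_closed)
      then show "(\<ominus>\<^bsub>laurent_End\<^esub> h) \<odot> x \<in> N" using a_inv.IH x ND(4) by simp
    qed
  next
    case (eng_add S T)
    then have "S \<in> carrier weyl_algebra" "T \<in> carrier weyl_algebra" by (simp_all add: gen)
    then have "(S \<oplus>\<^bsub>weyl_algebra\<^esub> T) \<odot> x \<in> N" if "x \<in> N" for x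
      using eng_add.IH that ND(1,3) by (subst smult_l_distr) auto
    then show ?case by (simp add: laurent_End_def)
  next
    case (eng_mult S T)
    then have "S \<in> carrier weyl_algebra" "T \<in> carrier weyl_algebra" by (simp_all add: gen)
    then have "(S \<otimes>\<^bsub>weyl_algebra\<^esub> T) \<odot> x \<in> N" if "x \<in> N" for x
      using eng_mult.IH that ND(1) by (subst smult_assoc1) auto
    then show ?case by (simp add: laurent_End_def comp_def)
  qed
  then show "r \<odot> x \<in> N" using x by blast
qed

text \<open>The \<open>U_h\<close>-span of all monomial multiples of \<open>m\<close> is stable
  under monomials, which translate coefficients and shift exponents. It is therefore a submodule
  over the Weyl algebra containing the generator \<open>m\<close>.\<close>

lemma cyclic_span:
  assumes m: "m \<in> carrier M" and cyc: "\<And>x. x \<in> carrier M \<Longrightarrow> \<exists>r\<in>carrier weyl_algebra. x = r \<odot> m"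
    and W: "submodule W U_h M" "\<And>\<alpha>. mon_op \<alpha> \<odot> m \<in> W"
  shows "W = carrier M"
proof -
  define B where "B = range (\<lambda>\<alpha>. mon_op \<alpha> \<odot> m)"
  have B: "B \<subseteq> carrier M" using m by (auto simp: B_def)
  note V = U.submodule_span[OF B]
  have "submodule (span_in M (carrier U_h) B) weyl_algebra M"
  proof (rule submodule_weylI[OF V])
    fix \<alpha> x assume x: "x \<in> span_in M (carrier U_h) B"
    show "mon_op \<alpha> \<odot> x \<in> span_in M (carrier U_h) B"
    proof (rule span_in_smult[OF U_h_subset_weyl B x mon_op_in_weyl _ U_h_subset_weyl B])
      fix a :: "'d laurent_op" and b assume "a \<in> carrier U_h" "b \<in> B"
      then obtain \<phi> \<beta> where "a = diag_op \<phi>" "\<phi> \<in> polyfun" "b = mon_op \<beta> \<odot> m"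
        by (auto simp: carrier_U_h B_def)
      then show "mon_op \<alpha> \<odot> (a \<odot> b) \<in> span_in M (carrier U_h) B"
        using m B polyfun_shift
        by (auto simp: mon_op_diag_op_smult mon_op_smult_smult carrier_U_h B_def intro!: U.span_in_smult_mem)
    qed
  qed
  note VD = submoduleD[OF this]
  have "m \<in> span_in M (carrier U_h) B"
  proof (rule U.span_in_superset[OF B])
    have "m = mon_op 0 \<odot> m" using m by simp
    then show "m \<in> B" unfolding B_def by (rule range_eqI)
  qed
  then have "carrier M \<subseteq> span_in M (carrier U_h) B" using cyc VD(5) by blast
  also have "B \<subseteq> W" using W(2) by (auto simp: B_def)
  then have "span_in M (carrier U_h) B \<subseteq> W" using U.span_in_subset_submodule[OF W(1)] by blast
  finally show ?thesis using submoduleD(1)[OF W(1)] by blast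
qed

end

subsection \<open>The operators \<open>f\<^sub>i\<close>\<close>

lemma submodule_finsum:
  assumes "left_module R M" "submodule W R M" "finite I" "\<And>i. i \<in> I \<Longrightarrow> f i \<in> W"
  shows "(\<Oplus>\<^bsub>M\<^esub>i\<in>I. f i) \<in> W"
proof -
  interpret left_module R M by fact
  note WD = submoduleD[OF assms(2)]
  show ?thesis
    using assms(3,4)
  proof (induction I rule: finite_induct)
    case empty
    then show ?case using WD by simp
  next
    case (insert i I)
    then have "f i \<in> carrier M" "f \<in> I \<rightarrow> carrier M" using WD(1) by auto
    then show ?case using insert WD(3) by simp
  qed
qed

definition U_poly :: "'d \<Rightarrow> nat \<Rightarrow> (nat \<Rightarrow> 'd laurent_op) \<Rightarrow> 'd laurent_op" where
  "U_poly i n a = \<one>\<^bsub>weyl_algebra\<^esub> \<oplus>\<^bsub>weyl_algebra\<^esub>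
        (\<Oplus>\<^bsub>weyl_algebra\<^esub>j\<in>{1..n}. a j \<otimes>\<^bsub>weyl_algebra\<^esub> X_op i [^]\<^bsub>weyl_algebra\<^esub> j)"

lemma star_form_iff:
  "star_form i f \<longleftrightarrow> (\<exists>n a c. n \<ge> 1 \<and> (\<forall>j\<in>{1..n}. a j \<in> carrier U_h) \<and> c \<noteq> 0 \<and> a n = scalar_op c \<and>
    f = U_poly i n a)"
  unfolding star_form_def U_poly_def by blast

lemma U_poly_terms:
  fixes i :: 'd and n :: nat
  assumes "\<forall>j\<in>{1..n}. a j \<in> carrier U_h"
  shows "(\<lambda>j. a j \<otimes>\<^bsub>weyl_algebra\<^esub> X_op i [^]\<^bsub>weyl_algebra\<^esub> j) \<in> {1..n} \<rightarrow> carrier weyl_algebra"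
proof -
  interpret W: ring "weyl_algebra :: 'd laurent_op ring" by (rule ring_weyl)
  show ?thesis
    using assms U_h_subset_weyl mon_op_in_weyl by (auto simp del: weyl_simps simp: X_op_pow intro!: W.m_closed)
qed

lemma U_poly_in_weyl:
  fixes i :: 'd and n :: nat
  assumes "\<forall>j\<in>{1..n}. a j \<in> carrier U_h"
  shows "U_poly i n a \<in> carrier weyl_algebra"
proof -
  interpret W: ring "weyl_algebra :: 'd laurent_op ring" by (rule ring_weyl)
  show ?thesis
    unfolding U_poly_def by (intro W.a_closed W.one_closed W.finsum_closed U_poly_terms assms)
qed

lemma star_form_in_weyl: "star_form i f \<Longrightarrow> f \<in> carrier weyl_algebra"
  by (auto simp: star_form_iff intro: U_poly_in_weyl)

context weyl_module
begin

lemma U_poly_smult: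
  assumes "\<forall>j\<in>{1..n}. a j \<in> carrier U_h" "m \<in> carrier M"
  shows "U_poly i n a \<odot> m = m \<oplus> (\<Oplus>j\<in>{1..n}. a j \<odot> (mon_op (Poly_Mapping.single i (int j)) \<odot> m))"
proof -
  note t = U_poly_terms[OF assms(1), of i]
  have aw: "a j \<in> carrier weyl_algebra" if "j \<in> {1..n}" for j using assms(1) U_h_subset_weyl that by auto
  have "U_poly i n a \<odot> m = \<one>\<^bsub>weyl_algebra\<^esub> \<odot> m \<oplus>
      (\<Oplus>j\<in>{1..n}. (a j \<otimes>\<^bsub>weyl_algebra\<^esub> X_op i [^]\<^bsub>weyl_algebra\<^esub> j) \<odot> m)"
    unfolding U_poly_def using assms t smult_finsum_l[OF finite_atLeastAtMost t assms(2)]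
    by (subst smult_l_distr) (auto intro!: R.finsum_closed simp del: weyl_simps)
  also have "(\<Oplus>j\<in>{1..n}. (a j \<otimes>\<^bsub>weyl_algebra\<^esub> X_op i [^]\<^bsub>weyl_algebra\<^esub> j) \<odot> m) =
      (\<Oplus>j\<in>{1..n}. a j \<odot> (mon_op (Poly_Mapping.single i (int j)) \<odot> m))"
    using assms(2) aw
    by (intro M.finsum_cong') (auto simp: mon_op_in_weyl X_op_pow smult_assoc1 simp del: weyl_simps)
  finally show ?thesis using assms(2) by (simp del: weyl_simps)
qed

lemma finsum_last:
  assumes "n \<ge> 1" "g \<in> {1..n} \<rightarrow> carrier M"
  shows "(\<Oplus>j\<in>{1..n::nat}. g j) = g n \<oplus> (\<Oplus>j\<in>{1..<n}. g j)"
proof -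
  have "{1..n} = insert n {1..<n}" using assms(1) by auto
  moreover have "g \<in> {1..<n} \<rightarrow> carrier M" "g n \<in> carrier M" using assms by auto
  ultimately show ?thesis by simp
qed

text \<open>Either end of the window can be solved for: its coefficient is 1 or the constant
  \<open>c\<close>, hence invertible, and translation by \<open>\<alpha>\<close> leaves a constant
  unchanged. The inner coefficients only need to stay in \<open>U_h\<close>.\<close>

lemma star_form_window:
  assumes n: "n \<ge> 1" and a: "\<forall>j\<in>{1..n}. a j \<in> carrier U_h" and c: "c \<noteq> 0" "a n = scalar_op c"
    and m: "m \<in> carrier M" "U_poly i n a \<odot> m = \<zero>" and W: "submodule W U_h M"
  shows "(\<And>j. j \<in> {1..n} \<Longrightarrow> mon_op (\<alpha> + Poly_Mapping.single i (int j)) \<odot> m \<in> W) \<Longrightarrow> mon_op \<alpha> \<odot> m \<in> W"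
    and "(\<And>j. j \<in> {0..<n} \<Longrightarrow> mon_op (\<alpha> + Poly_Mapping.single i (int j)) \<odot> m \<in> W) \<Longrightarrow>
      mon_op (\<alpha> + Poly_Mapping.single i (int n)) \<odot> m \<in> W"
proof -
  note WD = submoduleD[OF W]
  have "\<forall>j. \<exists>\<phi>. j \<in> {1..n} \<longrightarrow> \<phi> \<in> polyfun \<and> a j = diag_op \<phi>" using a by (auto simp: carrier_U_h)
  then obtain \<phi> where \<phi>: "\<And>j. j \<in> {1..n} \<Longrightarrow> \<phi> j \<in> polyfun \<and> a j = diag_op (\<phi> j)" by metis
  \<comment> \<open>The \<open>j\<close>-th term after the monomial has been moved to the right of
    \<open>a j\<close>.\<close>
  define g where "g j = diag_op (\<lambda>\<beta>. \<phi> j (\<beta> - \<alpha>)) \<odot> (mon_op (\<alpha> + Poly_Mapping.single i (int j)) \<odot> m)" for j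
  have sh: "(\<lambda>\<beta>. \<phi> j (\<beta> - \<alpha>)) \<in> polyfun" if "j \<in> {1..n}" for j using \<phi>[OF that] polyfun_shift by blast
  have gc: "g \<in> {1..n} \<rightarrow> carrier M" unfolding g_def
    using m sh by (intro Pi_I diag_op_smult_closed) simp_all
  have tc: "(\<lambda>j. a j \<odot> (mon_op (Poly_Mapping.single i (int j)) \<odot> m)) \<in> {1..n} \<rightarrow> carrier M"
    using m(1) \<phi> by (auto simp: Pi_iff)
  have distr: "mon_op \<alpha> \<odot> (\<Oplus>j\<in>J. h j) = (\<Oplus>j\<in>J. mon_op \<alpha> \<odot> h j)"
    if "finite J" "h \<in> J \<rightarrow> carrier M" for J :: "nat set" and h
    using that
  proof (induction J rule: finite_induct)
    case empty
    then show ?case by (simp add: mon_op_in_weyl)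
  next
    case (insert j J)
    then have "h j \<in> carrier M" "h \<in> J \<rightarrow> carrier M" by auto
    then show ?case using insert by (simp add: mon_op_in_weyl smult_r_distr Pi_iff)
  qed
  have "\<zero> = mon_op \<alpha> \<odot> (U_poly i n a \<odot> m)" using m by (simp add: mon_op_in_weyl)
  also have "\<dots> = mon_op \<alpha> \<odot> m \<oplus>
      mon_op \<alpha> \<odot> (\<Oplus>j\<in>{1..n}. a j \<odot> (mon_op (Poly_Mapping.single i (int j)) \<odot> m))"
    unfolding U_poly_smult[OF a m(1)]
    by (rule smult_r_distr[OF mon_op_in_weyl m(1) M.finsum_closed[OF tc]])
  also have "mon_op \<alpha> \<odot> (\<Oplus>j\<in>{1..n}. a j \<odot> (mon_op (Poly_Mapping.single i (int j)) \<odot> m)) = (\<Oplus>j\<in>{1..n}. g j)"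
    unfolding distr[OF finite_atLeastAtMost tc] using \<phi> m gc
    by (intro M.finsum_cong') (auto simp: g_def mon_op_diag_op_smult mon_op_smult_smult)
  finally have rel: "\<zero> = mon_op \<alpha> \<odot> m \<oplus> (\<Oplus>j\<in>{1..n}. g j)" .
  have gW: "g j \<in> W" if "j \<in> {1..n}" "mon_op (\<alpha> + Poly_Mapping.single i (int j)) \<odot> m \<in> W" for j
    unfolding g_def by (rule WD(5)) (use that sh[OF that(1)] in \<open>auto simp: carrier_U_h\<close>)
  {
    assume *: "\<And>j. j \<in> {1..n} \<Longrightarrow> mon_op (\<alpha> + Poly_Mapping.single i (int j)) \<odot> m \<in> W"
    have "(\<Oplus>j\<in>{1..n}. g j) \<in> W"
      by (rule submodule_finsum[OF U.left_module_axioms W]) (use gW * in auto)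
    then show "mon_op \<alpha> \<odot> m \<in> W"
      using U.submodule_cancel[OF W, of "mon_op \<alpha> \<odot> m" "\<Oplus>j\<in>{1..n}. g j"] rel m WD(2) by simp
  next
    assume *: "\<And>j. j \<in> {0..<n} \<Longrightarrow> mon_op (\<alpha> + Poly_Mapping.single i (int j)) \<odot> m \<in> W"
    define y where "y = (\<Oplus>j\<in>{1..<n}. g j)"
    have yW: "y \<in> W" unfolding y_def
      by (rule submodule_finsum[OF U.left_module_axioms W]) (use gW * in auto)
    have yc: "y \<in> carrier M" using yW WD(1) by blast
    have gn: "g n \<in> carrier M" using gc n by auto
    have xW: "mon_op \<alpha> \<odot> m \<in> W" using *[of 0] n by simp
    have "\<zero> = g n \<oplus> (mon_op \<alpha> \<odot> m \<oplus> y)"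
      using rel gn yc m unfolding finsum_last[OF n gc] y_def[symmetric] by (simp add: M.a_lcomm)
    then have gnW: "g n \<in> W"
      using U.submodule_cancel[OF W, of "g n" "mon_op \<alpha> \<odot> m \<oplus> y"] gn WD(2) WD(3)[OF xW yW] by simp
    have "n \<in> {1..n}" using n by simp
    \<comment> \<open>Equality of operators determines the eigenvalue function, so
      \<open>\<phi> n\<close> is constant and the translation inside \<open>g n\<close>
      disappears.\<close>
    then have "diag_op (\<phi> n) = diag_op (\<lambda>_. c)" using \<phi> c(2) by (simp add: scalar_op_eq)
    then have \<phi>n: "\<phi> n = (\<lambda>_. c)" by (simp add: diag_op_eq_iff)
    define z where "z = mon_op (\<alpha> + Poly_Mapping.single i (int n)) \<odot> m"
    have zc: "z \<in> carrier M" using m by (simp add: z_def)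
    have gz: "g n = diag_op (\<lambda>_. c) \<odot> z" by (simp add: g_def \<phi>n z_def)
    have inv: "(diag_op (\<lambda>_. inverse c) :: 'd laurent_op) \<in> carrier U_h" by (auto simp: carrier_U_h intro: polyfun.const)
    have "diag_op (\<lambda>_. inverse c) \<odot> g n = (diag_op (\<lambda>_. inverse c) \<circ> diag_op (\<lambda>_. c)) \<odot> z"
      unfolding gz using zc by (intro smult_comp diag_op_in_weyl polyfun.const)
    also have "\<dots> = z" using c(1) zc smult_one[OF zc] by (simp add: diag_op_mult diag_op_one)
    finally show "mon_op (\<alpha> + Poly_Mapping.single i (int n)) \<odot> m \<in> W"
      using WD(5)[OF inv gnW] by (simp add: z_def)
  }
qed

end

section \<open>Spreading from a finite box to the whole exponent lattice\<close>

text \<open>The window from 0 to \<open>n - 1\<close> propagates upwards from its predecessors and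
  downwards from its successors, each direction by strong induction.\<close>

lemma int_window_induct:
  fixes P :: "int \<Rightarrow> bool" and n :: nat
  assumes base: "\<And>z. 0 \<le> z \<Longrightarrow> z < int n \<Longrightarrow> P z"
    and up: "\<And>z. (\<And>j. j \<in> {0..<n} \<Longrightarrow> P (z + int j)) \<Longrightarrow> P (z + int n)"
    and down: "\<And>z. (\<And>j. j \<in> {1..n} \<Longrightarrow> P (z + int j)) \<Longrightarrow> P z"
  shows "P z"
proof -
  have nonneg: "P (int k)" for k
  proof (induction k rule: less_induct)
    case (less k)
    show ?case
    proof (cases "k < n")
      case False
      have "P (int (k - n) + int n)"
      proof (rule up)
        fix j assume "j \<in> {0..<n}"
        then have "P (int (k - n + j))" using False by (intro less) auto
        then show "P (int (k - n) + int j)" by simp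
      qed
      then show ?thesis using False by (simp add: of_nat_diff)
    qed (simp add: base)
  qed
  have neg: "P (- int k)" for k
  proof (induction k rule: less_induct)
    case (less k)
    show ?case
    proof (rule down)
      fix j assume j: "j \<in> {1..n}"
      show "P (- int k + int j)"
      proof (cases "j \<le> k")
        case True
        then show ?thesis using less[of "k - j"] j by (simp add: of_nat_diff)
      next
        \<comment> \<open>Here the step upwards from a negative integer crosses zero, where the
          nonnegative half is already available.\<close>
        case False
        then have "- int k + int j = int (j - k)" by (simp add: of_nat_diff)
        then show ?thesis by (simp only: nonneg)
      qed
    qed
  qed
  show ?thesis using nonneg[of "nat z"] neg[of "nat (- z)"] by (cases "z \<ge> 0") simp_all
qed

text \<open>The box constraints are lifted one coordinate at a time: \<open>D\<close> collects the
  coordinates already free, and freeing one more is an induction along a line in that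
  direction.\<close>

lemma box_induct:
  fixes Q :: "('d::finite \<Rightarrow>\<^sub>0 int) \<Rightarrow> bool" and n :: "'d \<Rightarrow> nat"
  assumes base: "\<And>\<alpha>. (\<And>i. 0 \<le> Poly_Mapping.lookup \<alpha> i \<and> Poly_Mapping.lookup \<alpha> i < int (n i)) \<Longrightarrow> Q \<alpha>"
    and up: "\<And>\<alpha> i. (\<And>j. j \<in> {0..<n i} \<Longrightarrow> Q (\<alpha> + Poly_Mapping.single i (int j))) \<Longrightarrow>
      Q (\<alpha> + Poly_Mapping.single i (int (n i)))"
    and down: "\<And>\<alpha> i. (\<And>j. j \<in> {1..n i} \<Longrightarrow> Q (\<alpha> + Poly_Mapping.single i (int j))) \<Longrightarrow> Q \<alpha>"
  shows "Q \<alpha>"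
proof -
  have "\<forall>\<alpha>. (\<forall>i. i \<notin> D \<longrightarrow> 0 \<le> Poly_Mapping.lookup \<alpha> i \<and> Poly_Mapping.lookup \<alpha> i < int (n i)) \<longrightarrow> Q \<alpha>"
    if "finite D" for D
    using that
  proof (induction D rule: finite_induct)
    case empty
    then show ?case using base by simp
  next
    case (insert i D)
    show ?case
    proof (intro allI impI)
      fix \<alpha> :: "'d \<Rightarrow>\<^sub>0 int"
      assume \<alpha>: "\<forall>k. k \<notin> insert i D \<longrightarrow> 0 \<le> Poly_Mapping.lookup \<alpha> k \<and> Poly_Mapping.lookup \<alpha> k < int (n k)"
      \<comment> \<open>\<open>\<alpha>\<close> with its \<open>i\<close>-th coordinate reset to
        zero, the base point of the line through \<open>\<alpha>\<close> in direction
        \<open>i\<close>.\<close>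
      define \<beta> where "\<beta> = \<alpha> + Poly_Mapping.single i (- Poly_Mapping.lookup \<alpha> i)"
      have "Q (\<beta> + Poly_Mapping.single i z)" for z
      proof (rule int_window_induct[where n = "n i"])
        fix z :: int assume "0 \<le> z" "z < int (n i)"
        then show "Q (\<beta> + Poly_Mapping.single i z)"
          using \<alpha> by (intro insert.IH[rule_format]) (auto simp: \<beta>_def lookup_add lookup_single when_def)
      next
        fix z assume "\<And>j. j \<in> {0..<n i} \<Longrightarrow> Q (\<beta> + Poly_Mapping.single i (z + int j))"
        then show "Q (\<beta> + Poly_Mapping.single i (z + int (n i)))"
          using up[of i "\<beta> + Poly_Mapping.single i z"] by (simp add: single_add add.assoc)
      next
        fix z assume "\<And>j. j \<in> {1..n i} \<Longrightarrow> Q (\<beta> + Poly_Mapping.single i (z + int j))"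
        then show "Q (\<beta> + Poly_Mapping.single i z)"
          using down[of i "\<beta> + Poly_Mapping.single i z"] by (simp add: single_add add.assoc)
      qed
      from this[of "Poly_Mapping.lookup \<alpha> i"] show "Q \<alpha>"
        by (simp add: \<beta>_def add.assoc single_add[symmetric])
    qed
  qed
  from this[of UNIV] show ?thesis by simp
qed

lemma finite_box:
  fixes n :: "'d::finite \<Rightarrow> nat"
  shows "finite {\<alpha> :: 'd \<Rightarrow>\<^sub>0 int. \<forall>i. 0 \<le> Poly_Mapping.lookup \<alpha> i \<and> Poly_Mapping.lookup \<alpha> i < int (n i)}" (is "finite ?B")
proof (rule finite_imageD)
  have "Poly_Mapping.lookup ` ?B \<subseteq> PiE UNIV (\<lambda>i. {0..<int (n i)})" by auto
  then show "finite (Poly_Mapping.lookup ` ?B)" by (rule finite_subset) (simp add: finite_PiE)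
  show "inj_on Poly_Mapping.lookup ?B" by (auto intro!: inj_onI poly_mapping_eqI)
qed

text \<open>The explicit generators are the multiples of \<open>m\<close> by monomials whose
  exponent at each \<open>i\<close> is below the degree \<open>n i\<close>.\<close>

lemma finitely_generated_star:
  fixes M :: "('d::finite laurent_op, 'b, 'm) module_scheme"
  assumes M: "left_module weyl_algebra M" and f: "\<And>i. star_form i (f i)"
    and m: "m \<in> carrier M" "\<And>i. f i \<odot>\<^bsub>M\<^esub> m = \<zero>\<^bsub>M\<^esub>"
    and cyc: "\<And>x. x \<in> carrier M \<Longrightarrow> \<exists>r\<in>carrier weyl_algebra. x = r \<odot>\<^bsub>M\<^esub> m"
  shows "finitely_generated_module U_h M"
proof -
  interpret weyl_module M using M by (simp add: weyl_module_def)
  have "\<forall>i. \<exists>n a c. n \<ge> 1 \<and> (\<forall>j\<in>{1..n}. a j \<in> carrier U_h) \<and> c \<noteq> 0 \<and> a n = scalar_op c \<and> f i = U_poly i n a"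
    using f by (simp add: star_form_iff)
  then obtain n a c where *: "\<And>i. n i \<ge> 1 \<and> (\<forall>j\<in>{1..n i}. a i j \<in> carrier U_h) \<and> c i \<noteq> 0 \<and>
      a i (n i) = scalar_op (c i) \<and> f i = U_poly i (n i) (a i)" by metis
  define B where "B = (\<lambda>\<alpha>. mon_op \<alpha> \<odot>\<^bsub>M\<^esub> m) `
    {\<alpha>. \<forall>i. 0 \<le> Poly_Mapping.lookup \<alpha> i \<and> Poly_Mapping.lookup \<alpha> i < int (n i)}"
  have B: "finite B" "B \<subseteq> carrier M" using m finite_box by (auto simp: B_def)
  define W where "W = span_in M (carrier U_h) B"
  have W: "submodule W U_h M" unfolding W_def by (rule U.submodule_span[OF B(2)])
  have win: "(\<And>j. j \<in> {1..n i} \<Longrightarrow> mon_op (\<alpha> + Poly_Mapping.single i (int j)) \<odot>\<^bsub>M\<^esub> m \<in> W) \<Longrightarrow> mon_op \<alpha> \<odot>\<^bsub>M\<^esub> m \<in> W"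
    "(\<And>j. j \<in> {0..<n i} \<Longrightarrow> mon_op (\<alpha> + Poly_Mapping.single i (int j)) \<odot>\<^bsub>M\<^esub> m \<in> W) \<Longrightarrow>
      mon_op (\<alpha> + Poly_Mapping.single i (int (n i))) \<odot>\<^bsub>M\<^esub> m \<in> W" for i \<alpha>
    using star_form_window[of "n i" "a i" "c i" m i W \<alpha>] * m W by metis+
  have "mon_op \<alpha> \<odot>\<^bsub>M\<^esub> m \<in> W" for \<alpha>
  proof (rule box_induct[where n = n])
    fix \<alpha> :: "'d \<Rightarrow>\<^sub>0 int"
    assume "\<And>i. 0 \<le> Poly_Mapping.lookup \<alpha> i \<and> Poly_Mapping.lookup \<alpha> i < int (n i)"
    then show "mon_op \<alpha> \<odot>\<^bsub>M\<^esub> m \<in> W" unfolding W_def by (intro U.span_in_superset[OF B(2)]) (auto simp: B_def)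
  qed (use win in blast)+
  then have "W = carrier M" using cyclic_span[OF m(1) cyc W] by blast
  then show ?thesis unfolding U.finitely_generated_module_iff using B W_def by blast
qed

section \<open>The ascending chain condition over \<open>U_h\<close>\<close>

text \<open>A decreasing sequence of natural numbers is constant from the place where its minimum is
  attained, so in the decreasing case a tail of the monotone subsequence serves.\<close>

lemma nat_seq_mono_subseq:
  fixes s :: "nat \<Rightarrow> nat"
  shows "\<exists>h :: nat \<Rightarrow> nat. strict_mono h \<and> (\<forall>m n. m \<le> n \<longrightarrow> s (h m) \<le> s (h n))"
proof -
  obtain f where f: "strict_mono f" "monoseq (\<lambda>n. s (f n))" using seq_monosub[of s] by blast
  show ?thesis
  proof (cases "\<forall>m n. m \<le> n \<longrightarrow> s (f m) \<le> s (f n)")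
    case False
    then have dec: "\<forall>m n. m \<le> n \<longrightarrow> s (f n) \<le> s (f m)" using f(2) unfolding monoseq_def by blast
    define v where "v = (LEAST v. \<exists>n. v = s (f n))"
    have "\<exists>n. v = s (f n)" unfolding v_def by (rule LeastI_ex) blast
    then obtain n0 where n0: "v = s (f n0)" by blast
    have "v \<le> s (f n)" for n unfolding v_def by (rule Least_le) blast
    then have "s (f (n + n0)) = v" for n using dec n0 by (metis le_add2 le_antisym)
    moreover have "strict_mono (\<lambda>n. f (n + n0))" using f(1) by (auto simp: strict_mono_def)
    ultimately show ?thesis by (intro exI[of _ "\<lambda>n. f (n + n0)"]) simp
  qed (use f in blast)
qed

text \<open>One refinement of the sequence per function; passing to a subsequence keeps the
  monotonicity obtained before. Stating it for functions on an arbitrary type lets exponents and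
  generator indices be treated together.\<close>

lemma dickson:
  fixes a :: "nat \<Rightarrow> 'x"
  assumes "finite F"
  shows "\<exists>g :: nat \<Rightarrow> nat. strict_mono g \<and> (\<forall>f\<in>F. \<forall>m n. m \<le> n \<longrightarrow> (f (a (g m)) :: nat) \<le> f (a (g n)))"
  using assms
proof (induction F rule: finite_induct)
  case empty
  show ?case by (intro exI[of _ id]) (simp add: strict_mono_def)
next
  case (insert f F)
  then obtain g :: "nat \<Rightarrow> nat" where g: "strict_mono g" "\<forall>f\<in>F. \<forall>m n. m \<le> n \<longrightarrow> f (a (g m)) \<le> f (a (g n))" by blast
  obtain h :: "nat \<Rightarrow> nat" where h: "strict_mono h" "\<forall>m n. m \<le> n \<longrightarrow> f (a (g (h m))) \<le> f (a (g (h n)))"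
    using nat_seq_mono_subseq[of "\<lambda>n. f (a (g n))"] by blast
  have "strict_mono (g \<circ> h)" using g(1) h(1) by (auto simp: strict_mono_def)
  moreover have "h m \<le> h n" if "m \<le> n" for m n using h(1) that by (simp add: strict_mono_less_eq)
  ultimately show ?case using g(2) h(2) by (intro exI[of _ "g \<circ> h"]) (simp add: comp_def)
qed

text \<open>The lexicographic order along an enumeration of the variables. All lists compared have
  the same length, which makes \<open>lex\<close> total on them.\<close>

lemma exists_monomial_order:
  "\<exists>r :: (('d::finite \<Rightarrow> nat) \<times> ('d \<Rightarrow> nat)) set. wf r \<and> trans r \<and> (\<forall>a b. a \<noteq> b \<longrightarrow> (a, b) \<in> r \<or> (b, a) \<in> r) \<and>
    (\<forall>a b c. (a, b) \<in> r \<longrightarrow> ((\<lambda>i. c i + a i), (\<lambda>i. c i + b i)) \<in> r)"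
proof -
  obtain xs :: "'d list" where xs: "set xs = UNIV" using finite_list[of "UNIV :: 'd set"] by auto
  define r where "r = inv_image (lex less_than) (\<lambda>a :: 'd \<Rightarrow> nat. map a xs)"
  have 1: "wf r" unfolding r_def by (intro wf_inv_image wf_lex wf_less_than)
  have 2: "trans r" unfolding r_def by (intro trans_inv_image lex_transI trans_less_than)
  have "(map a ys, map b ys) \<in> lex less_than \<or> (map b ys, map a ys) \<in> lex less_than \<or> map a ys = map b ys"
    for a b :: "'d \<Rightarrow> nat" and ys
    by (induction ys) auto
  from this[of _ xs] have 3: "a \<noteq> b \<longrightarrow> (a, b) \<in> r \<or> (b, a) \<in> r" for a b
    using xs by (auto simp: r_def fun_eq_iff)
  have "(map a ys, map b ys) \<in> lex less_than \<longrightarrow>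
      (map (\<lambda>i. c i + a i) ys, map (\<lambda>i. c i + b i) ys) \<in> lex less_than"
    for a b c :: "'d \<Rightarrow> nat" and ys
    by (induction ys) auto
  then have 4: "(a, b) \<in> r \<longrightarrow> ((\<lambda>i. c i + a i), (\<lambda>i. c i + b i)) \<in> r" for a b c
    by (simp add: r_def)
  show ?thesis using 1 2 3 4 by blast
qed

definition monofun :: "('d::finite \<Rightarrow> nat) \<Rightarrow> ('d \<Rightarrow>\<^sub>0 int) \<Rightarrow> complex" where
  "monofun a \<alpha> = (\<Prod>i\<in>UNIV. of_int (Poly_Mapping.lookup \<alpha> i) ^ a i)"

lemma monofun_polyfun: "monofun a \<in> polyfun"
proof -
  have pow: "(\<lambda>\<alpha>. of_int (Poly_Mapping.lookup \<alpha> i) ^ k) \<in> polyfun" for i :: 'a and k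
    by (induction k) (auto intro: polyfun.intros)
  have "(\<lambda>\<alpha>. \<Prod>i\<in>S. of_int (Poly_Mapping.lookup \<alpha> i) ^ a i) \<in> polyfun" if "finite S" for S
    using that by (induction S rule: finite_induct) (auto intro: polyfun.intros pow)
  from this[of UNIV] show ?thesis by (simp add: monofun_def[abs_def])
qed

lemma monofun_add: "monofun a \<alpha> * monofun b \<alpha> = monofun (\<lambda>i. a i + b i) \<alpha>"
  by (simp add: monofun_def power_add prod.distrib)

lemma monofun_single: "monofun (\<lambda>k. if k = i then 1 else 0) \<alpha> = of_int (Poly_Mapping.lookup \<alpha> i)"
proof -
  have "monofun (\<lambda>k. if k = i then 1 else 0) \<alpha> =
      (\<Prod>k\<in>UNIV. if k = i then of_int (Poly_Mapping.lookup \<alpha> k) else 1)"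
    unfolding monofun_def by (intro prod.cong) auto
  then show ?thesis by simp
qed

lemma monofun_zero: "monofun (\<lambda>_. 0) \<alpha> = 1"
  by (simp add: monofun_def)

section \<open>Complex spans and leading terms\<close>

lemma subring_scalars: "subring (range scalar_op) U_h"
proof -
  interpret U: domain "U_h :: 'd laurent_op ring" by (rule domain_U_h)
  have mem: "scalar_op c \<in> (carrier U_h :: 'd laurent_op set)" for c
    by (auto simp: scalar_op_eq carrier_U_h intro: polyfun.const)
  show "subring (range scalar_op) (U_h :: 'd laurent_op ring)"
  proof (rule U.subringI)
    show "range scalar_op \<subseteq> (carrier U_h :: 'd laurent_op set)" using mem by auto
    show "\<one>\<^bsub>U_h\<^esub> \<in> (range scalar_op :: 'd laurent_op set)"
      by (rule range_eqI[of _ _ 1]) (simp add: scalar_op_eq diag_op_one)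
    fix S T :: "'d laurent_op" assume S: "S \<in> range scalar_op"
    then obtain c where c: "S = scalar_op c" by auto
    have "scalar_op (- c) \<oplus>\<^bsub>U_h\<^esub> S = \<zero>\<^bsub>U_h\<^esub>" by (simp add: c scalar_op_eq diag_op_add diag_op_zero)
    then have "\<ominus>\<^bsub>U_h\<^esub> S = scalar_op (- c)" using mem c by (intro U.minus_equality) auto
    then show "\<ominus>\<^bsub>U_h\<^esub> S \<in> range scalar_op" by simp
    assume "T \<in> range scalar_op"
    then obtain d where d: "T = scalar_op d" by auto
    show "S \<otimes>\<^bsub>U_h\<^esub> T \<in> range scalar_op"
      by (rule range_eqI[of _ _ "c * d"]) (simp add: c d scalar_op_eq diag_op_mult)
    show "S \<oplus>\<^bsub>U_h\<^esub> T \<in> range scalar_op"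
      by (rule range_eqI[of _ _ "c + d"]) (simp add: c d scalar_op_eq diag_op_add)
  qed
qed

locale U_h_module = left_module U_h M
  for M :: "('d::finite laurent_op, 'b, 'm) module_scheme" (structure)
begin

abbreviation scalars :: "'d laurent_op set" where "scalars \<equiv> range scalar_op"

lemma scalars_subset: "scalars \<subseteq> carrier U_h"
  using subringE(1)[OF subring_scalars] .

text \<open>The complex vector space structure of \<open>M\<close>. Leading coefficients are scalars
  and can be normalized, which coefficients in \<open>U_h\<close> would not allow.\<close>

sublocale C: left_module "U_h\<lparr>carrier := scalars\<rparr>" M
  using left_module_axioms subring_scalars by (rule left_module_subring)

lemma diag_in_U: "\<phi> \<in> polyfun \<Longrightarrow> diag_op \<phi> \<in> carrier U_h"
  by (simp add: carrier_U_h)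

lemma diag_smult_closed: "\<phi> \<in> polyfun \<Longrightarrow> x \<in> carrier M \<Longrightarrow> diag_op \<phi> \<odot> x \<in> carrier M"
  using diag_in_U by blast

lemma diag_smult_diag:
  "\<phi> \<in> polyfun \<Longrightarrow> \<psi> \<in> polyfun \<Longrightarrow> x \<in> carrier M \<Longrightarrow>
    diag_op \<phi> \<odot> (diag_op \<psi> \<odot> x) = diag_op (\<lambda>\<alpha>. \<phi> \<alpha> * \<psi> \<alpha>) \<odot> x"
  using smult_assoc1[of "diag_op \<phi>" "diag_op \<psi>" x] by (simp add: diag_in_U diag_op_mult)

lemma diag_smult_add:
  "\<phi> \<in> polyfun \<Longrightarrow> \<psi> \<in> polyfun \<Longrightarrow> x \<in> carrier M \<Longrightarrow>
    diag_op (\<lambda>\<alpha>. \<phi> \<alpha> + \<psi> \<alpha>) \<odot> x = diag_op \<phi> \<odot> x \<oplus> diag_op \<psi> \<odot> x"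
  using smult_l_distr[of "diag_op \<phi>" "diag_op \<psi>" x] by (simp add: diag_in_U diag_op_add)

lemma scalar_diag_comm:
  assumes "c \<in> scalars" "\<phi> \<in> polyfun" "x \<in> carrier M"
  shows "diag_op \<phi> \<odot> (c \<odot> x) = c \<odot> (diag_op \<phi> \<odot> x)"
proof -
  obtain k where "c = diag_op (\<lambda>_. k)" using assms(1) by (auto simp: scalar_op_eq)
  then show ?thesis using assms(2,3) by (simp add: diag_smult_diag polyfun.const mult.commute)
qed

text \<open>For a product, \<open>\<psi>\<close> is expanded at \<open>x\<close> and then
  \<open>\<phi>\<close> at every vector that occurs. This is why \<open>x\<close> varies in the
  induction.\<close>

lemma polyfun_smult_in_span:
  assumes "\<phi> \<in> polyfun" "x \<in> carrier M"
  shows "diag_op \<phi> \<odot> x \<in> span_in M scalars (range (\<lambda>a. diag_op (monofun a) \<odot> x))"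
  using assms
proof (induction arbitrary: x rule: polyfun.induct)
  case (const c)
  have "diag_op (\<lambda>_. c) \<odot> x = scalar_op c \<odot> (diag_op (monofun (\<lambda>_. 0)) \<odot> x)"
    using const by (simp add: scalar_op_eq monofun_zero[abs_def] diag_smult_diag polyfun.const)
  also have "\<dots> \<in> span_in M scalars (range (\<lambda>a. diag_op (monofun a) \<odot> x))"
    using const by (intro span_in_smult_mem scalars_subset) (auto intro: diag_smult_closed monofun_polyfun)
  finally show ?case .
next
  case (coord i)
  have "diag_op (\<lambda>\<alpha>. of_int (Poly_Mapping.lookup \<alpha> i)) \<odot> x =
      scalar_op 1 \<odot> (diag_op (monofun (\<lambda>k. if k = i then 1 else 0)) \<odot> x)"
    using coord by (simp add: scalar_op_eq monofun_single[abs_def] diag_smult_diag polyfun.const polyfun.coord)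
  also have "\<dots> \<in> span_in M scalars (range (\<lambda>a. diag_op (monofun a) \<odot> x))"
    using coord by (intro span_in_smult_mem scalars_subset) (auto intro: diag_smult_closed monofun_polyfun)
  finally show ?case .
next
  case (add \<phi> \<psi>)
  have "range (\<lambda>a. diag_op (monofun a) \<odot> x) \<subseteq> carrier M"
    using add by (auto intro: diag_smult_closed monofun_polyfun)
  then show ?case using add scalars_subset by (simp add: diag_smult_add span_in_add)
next
  case (mult \<phi> \<psi>)
  have B: "range (\<lambda>a. diag_op (monofun a) \<odot> x) \<subseteq> carrier M"
    using mult by (auto intro: diag_smult_closed monofun_polyfun)
  have "diag_op \<phi> \<odot> (diag_op \<psi> \<odot> x) \<in> span_in M scalars (range (\<lambda>a. diag_op (monofun a) \<odot> x))"
  proof (rule span_in_smult[OF scalars_subset B mult.IH(2)[OF mult.prems] diag_in_U[OF mult.hyps(1)] _ scalars_subset B])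
    fix c y assume c: "c \<in> scalars" and "y \<in> range (\<lambda>a. diag_op (monofun a) \<odot> x)"
    then obtain a where y: "y = diag_op (monofun a) \<odot> x" by auto
    have yc: "y \<in> carrier M" using mult.prems y by (auto intro: diag_smult_closed monofun_polyfun)
    have "range (\<lambda>b. diag_op (monofun b) \<odot> y) \<subseteq> range (\<lambda>a. diag_op (monofun a) \<odot> x)"
      using mult.prems by (auto simp: y diag_smult_diag monofun_polyfun monofun_add)
    then have "diag_op \<phi> \<odot> y \<in> span_in M scalars (range (\<lambda>a. diag_op (monofun a) \<odot> x))"
      using span_in_mono[OF mult.IH(1)[OF yc]] by blast
    then have "c \<odot> (diag_op \<phi> \<odot> y) \<in> span_in M scalars (range (\<lambda>a. diag_op (monofun a) \<odot> x))"
      using submoduleD(5)[OF C.submodule_span[OF B]] c by simp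
    then show "diag_op \<phi> \<odot> (c \<odot> y) \<in> span_in M scalars (range (\<lambda>a. diag_op (monofun a) \<odot> x))"
      using c yc mult.hyps(1) by (simp add: scalar_diag_comm)
  qed
  then show ?case using mult by (simp add: diag_smult_diag)
qed

text \<open>A Groebner basis argument: \<open>lead V\<close> is the set of leading terms of the submodule \<open>V\<close> with respect to
  a monomial order on the spanning vectors \<open>e (a, s)\<close>, the monomial with exponent \<open>a\<close> times the
  generator \<open>b s\<close>. Nested submodules with the same leading terms agree, and an ascending chain of
  sets of leading terms stops by Dickson's lemma.\<close>

lemma ascending_chain:
  assumes fg: "finitely_generated_module U_h M"
    and N: "\<And>k. submodule (N k) U_h M" "\<And>k. N k \<subseteq> N (Suc k)"
  shows "\<exists>k::nat. N (Suc k) = N k"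
proof (rule ccontr)
  assume contra: "\<not> ?thesis"
  obtain B where B: "finite B" "B \<subseteq> carrier M" "span_in M (carrier U_h) B = carrier M"
    using fg finitely_generated_module_iff by blast
  \<comment> \<open>Generators are numbered so that they can enter both the order and Dickson's
    lemma; repetitions do no harm.\<close>
  obtain n :: nat and b where b: "B = b ` {s. s < n}"
    using B(1) unfolding finite_conv_nat_seg_image by blast
  obtain r :: "(('d \<Rightarrow> nat) \<times> ('d \<Rightarrow> nat)) set" where r: "wf r" "trans r"
    "\<And>a b. a \<noteq> b \<Longrightarrow> (a, b) \<in> r \<or> (b, a) \<in> r"
    "\<And>a b c. (a, b) \<in> r \<Longrightarrow> ((\<lambda>i. c i + a i), (\<lambda>i. c i + b i)) \<in> r"
    using exists_monomial_order by blast
  \<comment> \<open>Exponents are compared first, and ties are broken by the number of the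
    generator.\<close>
  define R where "R = r <*lex*> less_than"
  have R1: "wf R" and R2: "trans R"
    unfolding R_def using r(1,2) by (simp_all add: wf_lex_prod trans_lex_prod)
  have "(p, q) \<in> R \<or> (q, p) \<in> R" if "p \<noteq> q" for p q
    using that r(3)[of "fst p" "fst q"] by (cases "fst p = fst q") (auto simp: R_def lex_prod_def prod_eq_iff)
  note R = R1 R2 this
  define X where "X = {p :: ('d \<Rightarrow> nat) \<times> nat. snd p < n}"
  define e where "e p = diag_op (monofun (fst p)) \<odot> b (snd p)" for p
  define E where "E J = span_in M scalars (e ` J)" for J
  define below where "below p = {q \<in> X. (q, p) \<in> R}" for p
  have bX: "below p \<subseteq> X" for p by (auto simp: below_def)
  have ec: "e p \<in> carrier M" if "p \<in> X" for p
    using that B(2) b by (auto simp: e_def X_def intro!: diag_smult_closed monofun_polyfun)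
  then have eX: "e ` J \<subseteq> carrier M" if "J \<subseteq> X" for J using that by auto
  have Esub: "submodule (E J) (U_h\<lparr>carrier := scalars\<rparr>) M" if "J \<subseteq> X" for J
    using C.submodule_span[OF eX[OF that]] by (simp add: E_def)
  have Ec: "E J \<subseteq> carrier M" if "J \<subseteq> X" for J using submoduleD(1)[OF Esub[OF that]] .
  have Emono: "E J \<subseteq> E J'" if "J \<subseteq> J'" for J J' unfolding E_def using that by (blast intro: span_in_mono)
  have EX: "E X = carrier M"
  proof (rule equalityI[OF Ec[OF subset_refl]])
    have "c \<odot> x \<in> E X" if cx: "c \<in> carrier U_h" "x \<in> B" for c x
    proof -
      obtain s where s: "s < n" "x = b s" using b cx by auto
      obtain \<phi> where \<phi>: "c = diag_op \<phi>" "\<phi> \<in> polyfun" using cx by (auto simp: carrier_U_h)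
      have "range (\<lambda>a. diag_op (monofun a) \<odot> x) \<subseteq> e ` X"
      proof
        fix y assume "y \<in> range (\<lambda>a. diag_op (monofun a) \<odot> x)"
        then obtain a where "y = e (a, s)" using s by (auto simp: e_def)
        then show "y \<in> e ` X" using s by (auto simp: X_def)
      qed
      moreover have "x \<in> carrier M" using cx B by auto
      ultimately show ?thesis
        using span_in_mono[OF polyfun_smult_in_span[OF \<phi>(2)]] \<phi>(1) unfolding E_def by blast
    qed
    note mem = this
    have "v \<in> E X" if "v \<in> span_in M (carrier U_h) B" for v
      using that by induction (use submoduleD(2,3)[OF Esub[OF subset_refl]] mem in auto)
    then show "carrier M \<subseteq> E X" using B(3) by blast
  qed
  have cancel1: "(x \<oplus> y) \<oplus> \<ominus> (x \<oplus> z) = y \<oplus> \<ominus> z"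
    and cancel2: "(y \<oplus> \<ominus> z) \<oplus> (x \<oplus> z) = x \<oplus> y"
    if "x \<in> carrier M" "y \<in> carrier M" "z \<in> carrier M" for x y z
  proof -
    have "(x \<oplus> y) \<oplus> \<ominus> (x \<oplus> z) = (x \<oplus> \<ominus> x) \<oplus> (y \<oplus> \<ominus> z)"
      using that by (simp add: M.minus_add M.a_ac)
    then show "(x \<oplus> y) \<oplus> \<ominus> (x \<oplus> z) = y \<oplus> \<ominus> z" using that by (simp add: M.r_neg)
    have "(y \<oplus> \<ominus> z) \<oplus> (x \<oplus> z) = (x \<oplus> y) \<oplus> (z \<oplus> \<ominus> z)"
      using that by (simp add: M.a_ac)
    then show "(y \<oplus> \<ominus> z) \<oplus> (x \<oplus> z) = x \<oplus> y" using that by (simp add: M.r_neg)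
  qed
  \<comment> \<open>The vectors \<open>e p\<close> may be dependent, so a vector need not have a
    unique leading index. An index counts as leading for \<open>V\<close> as soon as one element of
    \<open>V\<close> can be written with coefficient one there and all other indices lower.\<close>
  define lead where "lead V = {p \<in> X. \<exists>v\<in>E (below p). e p \<oplus> v \<in> V}" for V
  have lead_mono: "lead V \<subseteq> lead V'" if "V \<subseteq> V'" for V V' using that by (auto simp: lead_def)
  \<comment> \<open>Adding \<open>c\<close> to exponents preserves the order, so the monomial
    carries the lower terms to lower terms.\<close>
  have lead_up: "((\<lambda>i. c i + a i), s) \<in> lead V" if V: "submodule V U_h M" and p: "(a, s) \<in> lead V" for V a s c
  proof -
    obtain v where v: "v \<in> E (below (a, s))" "e (a, s) \<oplus> v \<in> V" "(a, s) \<in> X" using p by (auto simp: lead_def)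
    have bs: "b s' \<in> carrier M" if "s' < n" for s' using B(2) b that by auto
    have shift: "diag_op (monofun c) \<odot> e (a', s') = e ((\<lambda>i. c i + a' i), s')" if "s' < n" for a' s'
      using bs[OF that] by (simp add: e_def diag_smult_diag monofun_polyfun monofun_add)
    have "diag_op (monofun c) \<odot> v \<in> E (below ((\<lambda>i. c i + a i), s))"
      unfolding E_def
    proof (rule span_in_smult[OF scalars_subset eX[OF bX] v(1)[unfolded E_def] diag_in_U[OF monofun_polyfun] _ scalars_subset eX[OF bX]])
      fix k y assume k: "k \<in> scalars" and "y \<in> e ` below (a, s)"
      then obtain a' s' where y: "y = e (a', s')" "(a', s') \<in> below (a, s)" by auto
      then have s': "s' < n" "((\<lambda>i. c i + a' i), s') \<in> below ((\<lambda>i. c i + a i), s)"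
        using r(4) by (auto simp: below_def X_def R_def)
      have "diag_op (monofun c) \<odot> (k \<odot> y) = k \<odot> e ((\<lambda>i. c i + a' i), s')"
        using k ec y(2) shift[OF s'(1)] by (simp add: scalar_diag_comm monofun_polyfun y(1) below_def)
      then show "diag_op (monofun c) \<odot> (k \<odot> y) \<in> span_in M scalars (e ` below ((\<lambda>i. c i + a i), s))"
        using span_in_smult_mem[OF scalars_subset eX[OF bX] k, of "e ((\<lambda>i. c i + a' i), s')"] s'(2) by auto
    qed
    moreover have "diag_op (monofun c) \<odot> (e (a, s) \<oplus> v) \<in> V"
      using submoduleD(5)[OF V diag_in_U[OF monofun_polyfun] v(2)] .
    moreover have "diag_op (monofun c) \<odot> (e (a, s) \<oplus> v) = e ((\<lambda>i. c i + a i), s) \<oplus> diag_op (monofun c) \<odot> v"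
      using v Ec[OF bX] ec shift
      by (subst smult_r_distr) (auto simp: X_def intro: diag_in_U monofun_polyfun)
    ultimately show ?thesis using v(3) by (auto simp: lead_def X_def)
  qed
  \<comment> \<open>The index \<open>p\<close> is only an upper bound for the indices involved: the
    coefficient at \<open>p\<close> may be zero.\<close>
  have top: "v = \<zero> \<or> (\<exists>p\<in>J. v \<in> E (insert p (below p)))" if J: "J \<subseteq> X" and v: "v \<in> E J" for v J
    using v unfolding E_def
  proof induction
    case (step k y v)
    then obtain q where q: "q \<in> J" "y = e q" by auto
    have kq: "k \<odot> e q \<in> E (insert q (below q))" unfolding E_def
      using step(1) q(1) J bX by (intro span_in_smult_mem scalars_subset eX) auto
    have ins: "insert p (below p) \<subseteq> X" if "p \<in> J" for p using that J bX by auto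
    from step(4) consider "v = \<zero>" | p where "p \<in> J" "v \<in> E (insert p (below p))" by (auto simp: E_def)
    then have "\<exists>p\<in>J. k \<odot> e q \<oplus> v \<in> E (insert p (below p))"
    proof cases
      case 1
      then have "k \<odot> e q \<oplus> v = k \<odot> e q"
        using Ec[OF ins[OF q(1)]] kq by (simp add: subset_iff)
      then show ?thesis using kq q(1) by auto
    next
      case 2
      consider "p = q" | "(p, q) \<in> R" | "(q, p) \<in> R" using R(3) by blast
      then show ?thesis
      proof cases
        case 1
        then show ?thesis using kq 2 submoduleD(3)[OF Esub[OF ins[OF q(1)]]] q(1) by blast
      next
        case pq: 2
        then have "insert p (below p) \<subseteq> insert q (below q)"
          using \<open>p \<in> J\<close> J R(2) by (auto simp: below_def dest: transD)
        then have "v \<in> E (insert q (below q))" using 2 Emono by blast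
        then show ?thesis using kq submoduleD(3)[OF Esub[OF ins[OF q(1)]]] q(1) by blast
      next
        case 3
        then have "insert q (below q) \<subseteq> insert p (below p)"
          using \<open>q \<in> J\<close> J R(2) by (auto simp: below_def dest: transD)
        then have "k \<odot> e q \<in> E (insert p (below p))" using kq Emono by blast
        then show ?thesis using 2 submoduleD(3)[OF Esub[OF ins[OF 2(1)]]] by blast
      qed
    qed
    then show ?case using q by (auto simp: E_def)
  qed simp
  have lead_eq: "V' \<subseteq> V" if V: "submodule V U_h M" and V': "submodule V' U_h M" and VV': "V \<subseteq> V'"
    and lead: "lead V' \<subseteq> lead V" for V V'
  proof -
    note VD = submoduleD[OF V] and VD' = submoduleD[OF V']
    \<comment> \<open>The division algorithm as well-founded induction on the upper bound of the
      indices.\<close>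
    have "\<forall>v\<in>V'. p \<in> X \<longrightarrow> v \<in> E (insert p (below p)) \<longrightarrow> v \<in> V" for p
      using R(1)
    proof (induction p rule: wf_induct_rule)
      case (less p)
      have low: "v \<in> V" if "v \<in> V'" "v \<in> E (below p)" for v
        using top[OF bX that(2)] less that(1) VD(2) by (auto simp: below_def)
      show ?case
      proof (intro ballI impI)
        fix v assume v: "v \<in> V'" "v \<in> E (insert p (below p))" and pX: "p \<in> X"
        have ep: "e p \<in> carrier M" using ec pX .
        have "insert (e p) (e ` below p) \<subseteq> carrier M" "v \<in> span_in M (carrier (U_h\<lparr>carrier := scalars\<rparr>)) (insert (e p) (e ` below p))"
          using v(2) pX eX bX by (auto simp: E_def ec)
        then obtain c w where c: "c \<in> scalars" and w: "w \<in> E (below p)" and vw: "v = c \<odot> e p \<oplus> w"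
          by (rule C.span_in_insertE) (auto simp: E_def)
        obtain k where k: "c = scalar_op k" using c by auto
        have wc: "w \<in> carrier M" using subsetD[OF Ec[OF bX] w] .
        have cU: "c \<in> carrier U_h" using c scalars_subset by auto
        note ED = submoduleD[OF Esub[OF bX[of p]]]
        show "v \<in> V"
        proof (cases "k = 0")
          case True
          then have "c = \<zero>\<^bsub>U_h\<^esub>" using k by (simp add: scalar_op_eq diag_op_zero)
          then have "v = w" using vw ep wc smult_l_null[OF ep] by simp
          then show ?thesis using low v w by simp
        next
          case False
          \<comment> \<open>Normalizes the coefficient at \<open>p\<close> to one, the form recorded
            by \<open>lead\<close>.\<close>
          define c' :: "'d laurent_op" where "c' = scalar_op (inverse k)"
          have c': "c' \<in> scalars" "c' \<in> carrier U_h" using scalars_subset by (auto simp: c'_def)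
          have "c' \<otimes>\<^bsub>U_h\<^esub> c = \<one>\<^bsub>U_h\<^esub>" using False by (simp add: c'_def k scalar_op_eq diag_op_mult diag_op_one)
          then have "c' \<odot> (c \<odot> e p) = e p" using smult_assoc1[OF c'(2) cU ep] smult_one[OF ep] by simp
          then have "c' \<odot> v = e p \<oplus> c' \<odot> w" using vw c' cU ep wc by (simp add: smult_r_distr)
          then have "e p \<oplus> c' \<odot> w \<in> V'" using VD'(5)[OF c'(2) v(1)] by simp
          moreover have "c' \<odot> w \<in> E (below p)" using ED(5) c' w by simp
          ultimately have "p \<in> lead V'" using pX by (auto simp: lead_def)
          then obtain u where u: "u \<in> E (below p)" "e p \<oplus> u \<in> V" using lead by (auto simp: lead_def)
          have uc: "u \<in> carrier M" using subsetD[OF Ec[OF bX] u(1)] .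
          have cu: "c \<odot> (e p \<oplus> u) \<in> V" using VD(5)[OF cU u(2)] .
          \<comment> \<open>Subtracting the multiple of an element of \<open>V\<close> with the same
            leading term cancels \<open>e p\<close>. The difference stays in \<open>V'\<close>
            because \<open>V \<subseteq> V'\<close>, and the induction hypothesis applies to
            it.\<close>
          have "v \<oplus> \<ominus> (c \<odot> (e p \<oplus> u)) \<in> V'" using v(1) cu VV' VD'(3,4) by blast
          also have "v \<oplus> \<ominus> (c \<odot> (e p \<oplus> u)) = w \<oplus> \<ominus> (c \<odot> u)"
            using cancel1[of "c \<odot> e p" w "c \<odot> u"] vw cU ep uc wc by (simp add: smult_r_distr)
          finally have 1: "w \<oplus> \<ominus> (c \<odot> u) \<in> V'" .
          have "w \<oplus> \<ominus> (c \<odot> u) \<in> E (below p)" using ED(3,4,5) w u(1) c by simp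
          then have "w \<oplus> \<ominus> (c \<odot> u) \<in> V" using low 1 by blast
          then have "(w \<oplus> \<ominus> (c \<odot> u)) \<oplus> c \<odot> (e p \<oplus> u) \<in> V" using cu VD(3) by blast
          also have "(w \<oplus> \<ominus> (c \<odot> u)) \<oplus> c \<odot> (e p \<oplus> u) = v"
            using cancel2[of "c \<odot> e p" w "c \<odot> u"] vw cU ep uc wc by (simp add: smult_r_distr)
          finally show ?thesis .
        qed
      qed
    qed
    then show ?thesis using top[OF subset_refl] EX VD(2) VD'(1) by blast
  qed
  \<comment> \<open>By \<open>lead_eq\<close>, every strict step of the chain contributes a leading
    index that was absent before.\<close>
  have "\<exists>p. p \<in> lead (N (Suc k)) \<and> p \<notin> lead (N k)" for k
    using lead_eq[OF N(1)[of k] N(1)[of "Suc k"] N(2)] N(2)[of k] contra by blast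
  then obtain p where p: "\<And>k. p k \<in> lead (N (Suc k)) \<and> p k \<notin> lead (N k)" by metis
  \<comment> \<open>Besides the exponents, both \<open>snd\<close> and \<open>n - snd\<close> are
    made monotone, which forces the generator index to agree along the subsequence.\<close>
  define F where "F = insert snd (insert (\<lambda>q. n - snd q) (range (\<lambda>i (q :: ('d \<Rightarrow> nat) \<times> nat). fst q i)))"
  have "finite F" by (simp add: F_def)
  then have "\<exists>g :: nat \<Rightarrow> nat. strict_mono g \<and> (\<forall>f\<in>F. \<forall>j k. j \<le> k \<longrightarrow> f (p (g j)) \<le> f (p (g k)))"
    by (rule dickson)
  then obtain g :: "nat \<Rightarrow> nat" where g: "strict_mono g"
    and mono: "\<forall>f\<in>F. \<forall>j k. j \<le> k \<longrightarrow> f (p (g j)) \<le> f (p (g k))"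
    by (elim exE conjE)
  have mono: "f (p (g 0)) \<le> f (p (g 1))" if "f \<in> F" for f
    using mono that by (meson le_numeral_extra(3) zero_le)
  have pX: "snd (p k) < n" for k using p[of k] by (auto simp: lead_def X_def)
  have "snd (p (g 0)) \<le> snd (p (g 1))" "n - snd (p (g 0)) \<le> n - snd (p (g 1))"
    using mono[of snd] mono[of "\<lambda>q. n - snd q"] by (simp_all add: F_def)
  then have s: "snd (p (g 1)) = snd (p (g 0))" using pX[of "g 0"] pX[of "g 1"] by linarith
  have le: "fst (p (g 0)) i \<le> fst (p (g 1)) i" for i using mono[of "\<lambda>q. fst q i"] by (simp add: F_def)
  \<comment> \<open>The index \<open>p (g 0)\<close> is leading by stage \<open>g 1\<close>, and
    \<open>p (g 1)\<close> is obtained from it by raising exponents. So \<open>p (g 1)\<close> was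
    not new at that stage.\<close>
  have "N (Suc (g 0)) \<subseteq> N (g 1)" using lift_Suc_mono_le[of N, OF N(2)] g by (simp add: strict_mono_def Suc_leI)
  then have "p (g 0) \<in> lead (N (g 1))" using p[of "g 0"] lead_mono by blast
  then have "((\<lambda>i. (fst (p (g 1)) i - fst (p (g 0)) i) + fst (p (g 0)) i), snd (p (g 0))) \<in> lead (N (g 1))"
    by (intro lead_up N(1)) simp
  also have "((\<lambda>i. (fst (p (g 1)) i - fst (p (g 0)) i) + fst (p (g 0)) i), snd (p (g 0))) = p (g 1)"
    using s le by (simp add: prod_eq_iff)
  finally show False using p[of "g 1"] by simp
qed

end

lemma star_form_annihilator:
  fixes M :: "('d::finite laurent_op, 'b, 'm) module_scheme" and i :: 'd
  assumes "left_module weyl_algebra M" and fg: "finitely_generated_module U_h M" and m: "m \<in> carrier M"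
  shows "\<exists>f. star_form i f \<and> f \<odot>\<^bsub>M\<^esub> m = \<zero>\<^bsub>M\<^esub>"
proof -
  interpret weyl_module M using assms(1) by (simp add: weyl_module_def)
  have "U_h_module M" using U.left_module_axioms by (simp add: U_h_module_def)
  note acc = U_h_module.ascending_chain[OF this fg]
  define y where "y z = mon_op (Poly_Mapping.single i z) \<odot>\<^bsub>M\<^esub> m" for z :: int
  define S where "S J = span_in M (carrier U_h) (y ` J)" for J
  have yc: "y z \<in> carrier M" for z using m by (simp add: y_def)
  have yJ: "y ` J \<subseteq> carrier M" for J using yc by auto
  have Ssub: "submodule (S J) U_h M" for J unfolding S_def by (rule U.submodule_span[OF yJ])
  have Smono: "S J \<subseteq> S J'" if "J \<subseteq> J'" for J J' unfolding S_def using that by (blast intro: span_in_mono)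
  have yS: "y z \<in> S J" if "z \<in> J" for z J unfolding S_def using that yJ by (blast intro: U.span_in_superset)
  have ymon: "mon_op (Poly_Mapping.single i z) \<odot>\<^bsub>M\<^esub> y z' = y (z + z')" for z z'
    using m by (simp add: y_def mon_op_smult_smult single_add)
  have shift: "mon_op (Poly_Mapping.single i z) \<odot>\<^bsub>M\<^esub> v \<in> S ((\<lambda>j. z + j) ` J)" if v: "v \<in> S J" for v z J
    unfolding S_def
  proof (rule span_in_smult[OF U_h_subset_weyl yJ v[unfolded S_def] mon_op_in_weyl _ U_h_subset_weyl yJ])
    fix a b assume a: "a \<in> (carrier U_h :: 'd laurent_op set)" and "b \<in> y ` J"
    then obtain \<phi> j where \<phi>: "a = diag_op \<phi>" "\<phi> \<in> polyfun" and j: "b = y j" "j \<in> J"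
      by (auto simp: carrier_U_h)
    have "mon_op (Poly_Mapping.single i z) \<odot>\<^bsub>M\<^esub> (a \<odot>\<^bsub>M\<^esub> b) =
        diag_op (\<lambda>\<beta>. \<phi> (\<beta> - Poly_Mapping.single i z)) \<odot>\<^bsub>M\<^esub> y (z + j)"
      using \<phi> j yc by (simp add: mon_op_diag_op_smult ymon)
    also have "\<dots> \<in> span_in M (carrier U_h) (y ` (\<lambda>j. z + j) ` J)"
      using polyfun_shift[OF \<phi>(2)] j
      by (intro U.span_in_smult_mem[OF subset_refl yJ]) (auto simp: carrier_U_h)
    finally show "mon_op (Poly_Mapping.single i z) \<odot>\<^bsub>M\<^esub> (a \<odot>\<^bsub>M\<^esub> b) \<in> span_in M (carrier U_h) (y ` (\<lambda>j. z + j) ` J)" .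
  qed
  have "\<exists>k. S (int ` {..<Suc k}) = S (int ` {..<k})"
    by (rule acc, rule Ssub, rule Smono) auto
  then obtain k where "S (int ` {..<Suc k}) = S (int ` {..<k})" ..
  then have k: "y (int k) \<in> S (int ` {..<k})" using yS[of "int k" "int ` {..<Suc k}"] by auto
  have "\<exists>l. S ((\<lambda>j. - int j) ` {..<Suc l}) = S ((\<lambda>j. - int j) ` {..<l})"
    by (rule acc, rule Ssub, rule Smono) auto
  then obtain l where "S ((\<lambda>j. - int j) ` {..<Suc l}) = S ((\<lambda>j. - int j) ` {..<l})" ..
  then have l: "y (- int l) \<in> S ((\<lambda>j. - int j) ` {..<l})"
    using yS[of "- int l" "(\<lambda>j. - int j) ` {..<Suc l}"] by auto
  \<comment> \<open>The upward relation is shifted by \<open>Suc l\<close> instead of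
    \<open>l\<close>, so that its lower terms start at a positive exponent even when
    \<open>l = 0\<close>. The downward relation is shifted by \<open>l\<close>, taking its extreme
    term to \<open>m\<close>. All remaining exponents then lie strictly between 0 and
    \<open>n\<close>.\<close>
  define n where "n = Suc l + k"
  have "y (int (Suc l) + int k) \<in> S ((\<lambda>j. int (Suc l) + j) ` int ` {..<k})"
    using shift[OF k, of "int (Suc l)"] by (simp only: ymon)
  also have "(\<lambda>j. int (Suc l) + j) ` int ` {..<k} \<subseteq> int ` {1..<n}"
  proof
    fix z assume "z \<in> (\<lambda>j. int (Suc l) + j) ` int ` {..<k}"
    then obtain j where "j < k" "z = int (Suc l + j)" by auto
    moreover from this have "Suc l + j \<in> {1..<n}" by (simp add: n_def)
    ultimately show "z \<in> int ` {1..<n}" by blast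
  qed
  then have "S ((\<lambda>j. int (Suc l) + j) ` int ` {..<k}) \<subseteq> S (int ` {1..<n})" by (rule Smono)
  finally have yn: "y (int n) \<in> S (int ` {1..<n})"
    by (simp only: n_def of_nat_add)
  have "y (int l + - int l) \<in> S ((\<lambda>j. int l + j) ` (\<lambda>j. - int j) ` {..<l})"
    using shift[OF l, of "int l"] by (simp only: ymon)
  also have "(\<lambda>j. int l + j) ` (\<lambda>j. - int j) ` {..<l} \<subseteq> int ` {1..<n}"
  proof
    fix z assume "z \<in> (\<lambda>j. int l + j) ` (\<lambda>j. - int j) ` {..<l}"
    then obtain j where j: "j < l" "z = int l + - int j" by auto
    then have "z = int (l - j)" by (simp add: of_nat_diff)
    moreover have "l - j \<in> {1..<n}" using j by (auto simp: n_def)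
    ultimately show "z \<in> int ` {1..<n}" by blast
  qed
  then have "S ((\<lambda>j. int l + j) ` (\<lambda>j. - int j) ` {..<l}) \<subseteq> S (int ` {1..<n})" by (rule Smono)
  finally have y0: "m \<in> S (int ` {1..<n})" using m by (simp add: y_def)
  note SD = submoduleD[OF Ssub[of "int ` {1..<n}"]]
  \<comment> \<open>Both \<open>m\<close> and \<open>y (int n)\<close> lie in the span of the
    intermediate powers. Expanding the negative of their sum supplies the inner coefficients, while
    the coefficients of \<open>m\<close> and \<open>y (int n)\<close> stay equal to 1.\<close>
  define w where "w = \<ominus>\<^bsub>M\<^esub> (m \<oplus>\<^bsub>M\<^esub> y (int n))"
  have "w \<in> span_in M (carrier U_h) ((\<lambda>j. y (int j)) ` {1..<n})"
    using SD(4)[OF SD(3)[OF y0 yn]] by (simp add: w_def S_def image_image)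
  then obtain u where u: "u \<in> {1..<n} \<rightarrow> carrier U_h" "w = (\<Oplus>\<^bsub>M\<^esub>j\<in>{1..<n}. u j \<odot>\<^bsub>M\<^esub> y (int j))"
    using U.span_in_finsum[of "{1..<n}" "\<lambda>j. y (int j)" w] yc by auto
  define a where "a j = (if j = n then scalar_op 1 else u j)" for j
  have n1: "n \<ge> 1" by (simp add: n_def)
  have "scalar_op 1 \<in> (carrier U_h :: 'd laurent_op set)" by (auto simp: scalar_op_eq carrier_U_h intro: polyfun.const)
  then have a: "\<forall>j\<in>{1..n}. a j \<in> carrier U_h" using u(1) by (auto simp: a_def Pi_iff)
  have ac: "(\<lambda>j. a j \<odot>\<^bsub>M\<^esub> y (int j)) \<in> {1..n} \<rightarrow> carrier M" using a yc U.smult_closed by (auto simp: Pi_iff)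
  have "(\<Oplus>\<^bsub>M\<^esub>j\<in>{1..n}. a j \<odot>\<^bsub>M\<^esub> y (int j)) = a n \<odot>\<^bsub>M\<^esub> y (int n) \<oplus>\<^bsub>M\<^esub> (\<Oplus>\<^bsub>M\<^esub>j\<in>{1..<n}. a j \<odot>\<^bsub>M\<^esub> y (int j))"
    by (rule finsum_last[OF n1 ac])
  also have "(\<Oplus>\<^bsub>M\<^esub>j\<in>{1..<n}. a j \<odot>\<^bsub>M\<^esub> y (int j)) = w"
    unfolding u(2) using u(1) yc U.smult_closed by (intro M.finsum_cong') (auto simp: a_def Pi_iff)
  also have "a n \<odot>\<^bsub>M\<^esub> y (int n) = y (int n)"
    using smult_one[OF yc] by (simp add: a_def scalar_op_eq diag_op_one)
  finally have sum: "(\<Oplus>\<^bsub>M\<^esub>j\<in>{1..n}. a j \<odot>\<^bsub>M\<^esub> y (int j)) = y (int n) \<oplus>\<^bsub>M\<^esub> w" .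
  have "U_poly i n a \<odot>\<^bsub>M\<^esub> m = m \<oplus>\<^bsub>M\<^esub> (\<Oplus>\<^bsub>M\<^esub>j\<in>{1..n}. a j \<odot>\<^bsub>M\<^esub> y (int j))"
    unfolding y_def by (rule U_poly_smult[OF a m])
  also have "\<dots> = (m \<oplus>\<^bsub>M\<^esub> y (int n)) \<oplus>\<^bsub>M\<^esub> w" unfolding sum using m yc by (simp add: M.a_assoc w_def)
  also have "\<dots> = \<zero>\<^bsub>M\<^esub>" using m yc by (simp add: w_def M.r_neg)
  finally have "U_poly i n a \<odot>\<^bsub>M\<^esub> m = \<zero>\<^bsub>M\<^esub>" .
  moreover have "star_form i (U_poly i n a)"
    unfolding star_form_iff using n1 a by (intro exI[of _ n] exI[of _ a] exI[of _ 1]) (simp add: a_def)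
  ultimately show ?thesis by blast
qed

section \<open>Cyclic modules\<close>

lemma left_module_regular:
  assumes "ring R"
  shows "left_module R (regular_module R)"
proof -
  interpret ring R by fact
  interpret M: abelian_group "regular_module R"
    by (rule abelian_groupI)
      (auto simp: regular_module_def a_ac intro!: bexI[of _ "\<ominus>\<^bsub>R\<^esub> _"] r_neg)
  show ?thesis
    by unfold_locales (auto simp: regular_module_def l_distr r_distr m_assoc)
qed

text \<open>Turns the formula with one left coefficient per generator into a span, for which
  submodule closure is already established.\<close>

lemma left_ideal_sum_eq_span:
  fixes f :: "'i::finite \<Rightarrow> 'a"
  assumes "ring R" "\<And>i. f i \<in> carrier R"
  shows "left_ideal_sum R f = span_in (regular_module R) (carrier R) (range f)"
proof -
  interpret L: left_module R "regular_module R" using assms(1) by (rule left_module_regular)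
  have sum: "(\<Oplus>\<^bsub>regular_module R\<^esub>i\<in>UNIV. g i \<odot>\<^bsub>regular_module R\<^esub> f i) = (\<Oplus>\<^bsub>R\<^esub>i\<in>UNIV. g i \<otimes>\<^bsub>R\<^esub> f i)" for g
    by (simp add: finsum_def finprod_def regular_module_def)
  have c: "f \<in> UNIV \<rightarrow> carrier (regular_module R)" "range f \<subseteq> carrier (regular_module R)"
    using assms(2) by (auto simp: regular_module_def)
  show ?thesis
  proof (intro equalityI subsetI)
    fix x assume "x \<in> left_ideal_sum R f"
    then obtain g where "g \<in> UNIV \<rightarrow> carrier R" "x = (\<Oplus>\<^bsub>R\<^esub>i\<in>UNIV. g i \<otimes>\<^bsub>R\<^esub> f i)"
      by (auto simp: left_ideal_sum_def)
    then show "x \<in> span_in (regular_module R) (carrier R) (range f)"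
      using L.finsum_in_span[of UNIV f "range f" g] c by (simp add: sum)
  next
    fix x assume "x \<in> span_in (regular_module R) (carrier R) (range f)"
    then show "x \<in> left_ideal_sum R f"
      using L.span_in_finsum[of UNIV f x] c by (auto simp: left_ideal_sum_def sum)
  qed
qed

lemma star_ideal:
  fixes f :: "'d::finite \<Rightarrow> 'd laurent_op"
  assumes "\<And>i. star_form i (f i)"
  shows "submodule (left_ideal_sum weyl_algebra f) weyl_algebra (regular_module weyl_algebra)"
    and "f i \<in> left_ideal_sum weyl_algebra f"
proof -
  interpret L: left_module weyl_algebra "regular_module weyl_algebra :: ('d laurent_op, 'd laurent_op) module"
    by (rule left_module_regular[OF ring_weyl])
  note f = star_form_in_weyl[OF assms]
  have c: "range f \<subseteq> carrier (regular_module weyl_algebra)" using f by (auto simp: regular_module_def)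
  have eq: "left_ideal_sum weyl_algebra f = span_in (regular_module weyl_algebra) (carrier weyl_algebra) (range f)"
    by (rule left_ideal_sum_eq_span[OF ring_weyl f])
  show "submodule (left_ideal_sum weyl_algebra f) weyl_algebra (regular_module weyl_algebra)"
    unfolding eq by (rule L.submodule_span[OF c])
  show "f i \<in> left_ideal_sum weyl_algebra f"
    unfolding eq by (rule L.span_in_superset[OF c]) simp
qed

lemma left_module_S_module:
  fixes f :: "'d::finite \<Rightarrow> 'd laurent_op"
  assumes "\<And>i. star_form i (f i)"
  shows "left_module weyl_algebra (S_module f)"
  unfolding S_module_def
  by (rule left_module.left_module_quotient[OF left_module_regular[OF ring_weyl] star_ideal(1)[OF assms]])

text \<open>The class of 1 is the cyclic generator. It is killed by \<open>f i\<close>, whose own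
  class vanishes because \<open>f i\<close> lies in the ideal.\<close>

lemma finitely_generated_S_module:
  fixes f :: "'d::finite \<Rightarrow> 'd laurent_op"
  assumes f: "\<And>i. star_form i (f i)"
  shows "finitely_generated_module U_h (S_module f)"
proof -
  define K where "K = (regular_module weyl_algebra :: ('d laurent_op, 'd laurent_op) module)"
  define L where "L = left_ideal_sum weyl_algebra f"
  interpret K: left_module weyl_algebra K unfolding K_def by (rule left_module_regular[OF ring_weyl])
  have cK: "carrier K = carrier weyl_algebra" and sK: "\<And>r x. r \<odot>\<^bsub>K\<^esub> x = r \<otimes>\<^bsub>weyl_algebra\<^esub> x"
    by (simp_all add: K_def regular_module_def)
  have L: "submodule L weyl_algebra K" "\<And>i. f i \<in> L" using star_ideal[OF f] by (auto simp: K_def L_def)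
  have S: "S_module f = quotient_module K L" by (simp add: S_module_def K_def L_def)
  have one: "\<one>\<^bsub>weyl_algebra\<^esub> \<in> carrier K" unfolding cK by (rule K.R.one_closed)
  have fw: "f i \<in> carrier weyl_algebra" for i by (rule star_form_in_weyl[OF f])
  show ?thesis unfolding S
  proof (rule finitely_generated_star)
    show "left_module weyl_algebra (quotient_module K L)" by (rule K.left_module_quotient[OF L(1)])
    show "star_form i (f i)" for i by (rule f)
    show "L +>\<^bsub>K\<^esub> \<one>\<^bsub>weyl_algebra\<^esub> \<in> carrier (quotient_module K L)"
      unfolding K.carrier_quotient_module using one by (rule imageI)
    show "f i \<odot>\<^bsub>quotient_module K L\<^esub> (L +>\<^bsub>K\<^esub> \<one>\<^bsub>weyl_algebra\<^esub>) = \<zero>\<^bsub>quotient_module K L\<^esub>" for i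
    proof -
      have "f i \<odot>\<^bsub>quotient_module K L\<^esub> (L +>\<^bsub>K\<^esub> \<one>\<^bsub>weyl_algebra\<^esub>) = L +>\<^bsub>K\<^esub> f i"
        unfolding K.quotient_module_smult[OF L(1) one fw] sK by (simp add: fw del: weyl_simps)
      also have "\<dots> = L"
        using L fw by (intro K.M.a_coset_join2) (auto simp: cK submodule_def)
      finally show ?thesis by (simp add: quotient_module_def)
    qed
    fix A assume "A \<in> carrier (quotient_module K L)"
    then obtain r where r: "r \<in> carrier weyl_algebra" "A = L +>\<^bsub>K\<^esub> r"
      unfolding K.carrier_quotient_module cK by blast
    have "A = r \<odot>\<^bsub>quotient_module K L\<^esub> (L +>\<^bsub>K\<^esub> \<one>\<^bsub>weyl_algebra\<^esub>)"
      unfolding K.quotient_module_smult[OF L(1) one r(1)] sK r(2) by (simp add: r(1) del: weyl_simps)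
    then show "\<exists>r\<in>carrier weyl_algebra. A = r \<odot>\<^bsub>quotient_module K L\<^esub> (L +>\<^bsub>K\<^esub> \<one>\<^bsub>weyl_algebra\<^esub>)"
      using r(1) by blast
  qed
qed

text \<open>For a left ideal \<open>L\<close> annihilating a generator \<open>m\<close>, the isomorphism sends \<open>x\<close> to the class of
  any \<open>r\<close> with \<open>r m = x\<close>.\<close>

lemma cyclic_module_isomorphic:
  assumes M: "left_module R M" and L: "submodule L R (regular_module R)"
    and m: "m \<in> carrier M" "\<And>r. r \<in> L \<Longrightarrow> r \<odot>\<^bsub>M\<^esub> m = \<zero>\<^bsub>M\<^esub>"
    and cyc: "\<And>x. x \<in> carrier M \<Longrightarrow> \<exists>r\<in>carrier R. x = r \<odot>\<^bsub>M\<^esub> m"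
  shows "\<exists>N. submodule N R (quotient_module (regular_module R) L) \<and>
    module_isomorphic R M (quotient_module (quotient_module (regular_module R) L) N)"
proof -
  interpret left_module R M by fact
  define K where "K = regular_module R"
  interpret K: left_module R K unfolding K_def by (rule left_module_regular[OF R.ring_axioms])
  have cK: "carrier K = carrier R" and sK: "\<And>r x. r \<odot>\<^bsub>K\<^esub> x = r \<otimes>\<^bsub>R\<^esub> x"
    and aK: "\<And>x y. x \<oplus>\<^bsub>K\<^esub> y = x \<oplus>\<^bsub>R\<^esub> y" and zK: "\<zero>\<^bsub>K\<^esub> = \<zero>\<^bsub>R\<^esub>"
    by (simp_all add: K_def regular_module_def)
  have L: "submodule L R K" using L by (simp add: K_def)
  note LD = submoduleD[OF L]
  define S where "S = quotient_module K L"
  interpret S: left_module R S unfolding S_def by (rule K.left_module_quotient[OF L])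
  define q where "q r = L +>\<^bsub>K\<^esub> r" for r
  have qS: "carrier S = q ` carrier R" by (simp add: S_def K.carrier_quotient_module q_def[abs_def] cK)
  have q_add: "q r \<oplus>\<^bsub>S\<^esub> q s = q (r \<oplus>\<^bsub>R\<^esub> s)" if "r \<in> carrier R" "s \<in> carrier R" for r s
    using K.quotient_module_add[OF L] that by (simp add: S_def q_def cK aK)
  have q_smult: "r \<odot>\<^bsub>S\<^esub> q s = q (r \<otimes>\<^bsub>R\<^esub> s)" if "r \<in> carrier R" "s \<in> carrier R" for r s
    using K.quotient_module_smult[OF L] that by (simp add: S_def q_def cK sK)
  have q_zero: "\<zero>\<^bsub>S\<^esub> = q \<zero>\<^bsub>R\<^esub>"
    using K.M.a_coset_add_zero[OF LD(1)] by (simp add: S_def q_def quotient_module_def zK)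
  have minus_m: "(r \<ominus>\<^bsub>R\<^esub> s) \<odot>\<^bsub>M\<^esub> m = \<zero>\<^bsub>M\<^esub> \<longleftrightarrow> r \<odot>\<^bsub>M\<^esub> m = s \<odot>\<^bsub>M\<^esub> m"
    if "r \<in> carrier R" "s \<in> carrier R" for r s
  proof -
    have eq: "(r \<ominus>\<^bsub>R\<^esub> s) \<odot>\<^bsub>M\<^esub> m = r \<odot>\<^bsub>M\<^esub> m \<ominus>\<^bsub>M\<^esub> s \<odot>\<^bsub>M\<^esub> m"
      using that m(1) by (simp add: a_minus_def smult_l_distr smult_l_minus)
    have "x \<ominus>\<^bsub>M\<^esub> y = \<zero>\<^bsub>M\<^esub> \<longleftrightarrow> x = y" if "x \<in> carrier M" "y \<in> carrier M" for x y
      using that M.minus_equality[of x "\<ominus>\<^bsub>M\<^esub> y"] by (auto simp: a_minus_def M.r_neg)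
    then show ?thesis unfolding eq using that m(1) by simp
  qed
  have Km: "a_inv K s = \<ominus>\<^bsub>R\<^esub> s" if "s \<in> carrier R" for s
    using that by (intro K.M.minus_equality) (auto simp: cK aK zK R.l_neg)
  have q_eq: "r \<odot>\<^bsub>M\<^esub> m = s \<odot>\<^bsub>M\<^esub> m" if rs: "r \<in> carrier R" "s \<in> carrier R" and "q r = q s" for r s
  proof -
    have "r \<ominus>\<^bsub>K\<^esub> s \<in> L" using that K.coset_eq_iff[OF L, of r s] by (simp add: q_def cK)
    moreover have "r \<ominus>\<^bsub>K\<^esub> s = r \<ominus>\<^bsub>R\<^esub> s" using rs by (simp add: a_minus_def aK Km)
    ultimately show ?thesis using m(2) minus_m[OF rs] by auto
  qed
  \<comment> \<open>The kernel of the map sending the class of \<open>r\<close> to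
    \<open>r m\<close>, which is well defined by \<open>q_eq\<close>.\<close>
  define N where "N = {q r | r. r \<in> carrier R \<and> r \<odot>\<^bsub>M\<^esub> m = \<zero>\<^bsub>M\<^esub>}"
  have N_iff: "q r \<in> N \<longleftrightarrow> r \<odot>\<^bsub>M\<^esub> m = \<zero>\<^bsub>M\<^esub>" if "r \<in> carrier R" for r
  proof
    assume "q r \<in> N"
    then obtain s where s: "s \<in> carrier R" "q r = q s" "s \<odot>\<^bsub>M\<^esub> m = \<zero>\<^bsub>M\<^esub>" unfolding N_def by blast
    then show "r \<odot>\<^bsub>M\<^esub> m = \<zero>\<^bsub>M\<^esub>" using q_eq[OF that s(1,2)] by simp
  qed (use that in \<open>auto simp: N_def\<close>)
  have N: "submodule N R S"
  proof (rule S.submoduleI)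
    show "N \<subseteq> carrier S" by (auto simp: N_def qS)
    show "\<zero>\<^bsub>S\<^esub> \<in> N" using m(1) by (simp add: q_zero N_iff)
  next
    fix x y assume "x \<in> N" "y \<in> N"
    then obtain r s where "r \<in> carrier R" "r \<odot>\<^bsub>M\<^esub> m = \<zero>\<^bsub>M\<^esub>" "x = q r"
      "s \<in> carrier R" "s \<odot>\<^bsub>M\<^esub> m = \<zero>\<^bsub>M\<^esub>" "y = q s" unfolding N_def by blast
    then show "x \<oplus>\<^bsub>S\<^esub> y \<in> N" using m(1) by (simp add: q_add N_iff smult_l_distr)
  next
    fix a x assume "a \<in> carrier R" "x \<in> N"
    then obtain r where "r \<in> carrier R" "r \<odot>\<^bsub>M\<^esub> m = \<zero>\<^bsub>M\<^esub>" "x = q r" "a \<in> carrier R" unfolding N_def by blast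
    then show "a \<odot>\<^bsub>S\<^esub> x \<in> N" using m(1) by (simp add: q_smult N_iff smult_assoc1)
  qed
  define Q where "Q = quotient_module S N"
  define p where "p r = N +>\<^bsub>S\<^esub> q r" for r
  have qc: "q r \<in> carrier S" if "r \<in> carrier R" for r using that by (simp add: qS)
  have Q: "carrier Q = p ` carrier R" by (simp add: Q_def S.carrier_quotient_module qS image_image p_def[abs_def])
  have p_add: "p r \<oplus>\<^bsub>Q\<^esub> p s = p (r \<oplus>\<^bsub>R\<^esub> s)" if "r \<in> carrier R" "s \<in> carrier R" for r s
    using S.quotient_module_add[OF N qc qc] that by (simp add: Q_def p_def q_add)
  have p_smult: "r \<odot>\<^bsub>Q\<^esub> p s = p (r \<otimes>\<^bsub>R\<^esub> s)" if "r \<in> carrier R" "s \<in> carrier R" for r s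
    using S.quotient_module_smult[OF N qc] that by (simp add: Q_def p_def q_smult)
  have Sm: "q r \<ominus>\<^bsub>S\<^esub> q s = q (r \<ominus>\<^bsub>R\<^esub> s)" if "r \<in> carrier R" "s \<in> carrier R" for r s
  proof -
    have "\<ominus>\<^bsub>S\<^esub> q s = q (\<ominus>\<^bsub>R\<^esub> s)"
      using that by (intro S.M.minus_equality) (auto simp: q_add q_zero qc R.l_neg)
    then show ?thesis using that by (simp add: a_minus_def q_add)
  qed
  have p_eq: "p r = p s \<longleftrightarrow> r \<odot>\<^bsub>M\<^esub> m = s \<odot>\<^bsub>M\<^esub> m" if "r \<in> carrier R" "s \<in> carrier R" for r s
    using S.coset_eq_iff[OF N qc qc] that by (simp add: p_def Sm N_iff minus_m)
  have "\<forall>x. \<exists>r. x \<in> carrier M \<longrightarrow> r \<in> carrier R \<and> x = r \<odot>\<^bsub>M\<^esub> m" using cyc by blast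
  then obtain c where c: "\<And>x. x \<in> carrier M \<Longrightarrow> c x \<in> carrier R \<and> x = c x \<odot>\<^bsub>M\<^esub> m" by metis
  \<comment> \<open>Frees the map from the choice of \<open>c x\<close>: every \<open>r\<close> with
    \<open>r m = x\<close> represents the same class.\<close>
  have pc: "p (c x) = p r" if "r \<in> carrier R" "x = r \<odot>\<^bsub>M\<^esub> m" for r x
  proof -
    have "x \<in> carrier M" using that m(1) by simp
    then show ?thesis using c[of x] that p_eq[of "c x" r] by simp
  qed
  have "module_isomorphic R M Q"
    unfolding module_isomorphic_def
  proof (intro exI[of _ "\<lambda>x. p (c x)"] conjI ballI)
    show "bij_betw (\<lambda>x. p (c x)) (carrier M) (carrier Q)"
    proof (rule bij_betwI')
      fix x y assume "x \<in> carrier M" "y \<in> carrier M"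
      then show "p (c x) = p (c y) \<longleftrightarrow> x = y" using c[of x] c[of y] p_eq by metis
    next
      fix x assume "x \<in> carrier M"
      then show "p (c x) \<in> carrier Q" using c by (simp add: Q)
    next
      fix A assume "A \<in> carrier Q"
      then obtain r where r: "r \<in> carrier R" "A = p r" by (auto simp: Q)
      then show "\<exists>x\<in>carrier M. A = p (c x)" using pc[OF r(1) refl] m(1) by (intro bexI[of _ "r \<odot>\<^bsub>M\<^esub> m"]) auto
    qed
    fix x assume x: "x \<in> carrier M"
    show "p (c (x \<oplus>\<^bsub>M\<^esub> y)) = p (c x) \<oplus>\<^bsub>Q\<^esub> p (c y)" if y: "y \<in> carrier M" for y
    proof -
      have "x \<oplus>\<^bsub>M\<^esub> y = (c x \<oplus>\<^bsub>R\<^esub> c y) \<odot>\<^bsub>M\<^esub> m" using c[OF x] c[OF y] m(1) by (simp add: smult_l_distr)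
      then show ?thesis using c[OF x] c[OF y] pc[of "c x \<oplus>\<^bsub>R\<^esub> c y" "x \<oplus>\<^bsub>M\<^esub> y"] by (simp add: p_add)
    qed
    show "p (c (r \<odot>\<^bsub>M\<^esub> x)) = r \<odot>\<^bsub>Q\<^esub> p (c x)" if r: "r \<in> carrier R" for r
    proof -
      have "r \<odot>\<^bsub>M\<^esub> x = (r \<otimes>\<^bsub>R\<^esub> c x) \<odot>\<^bsub>M\<^esub> m" using c[OF x] r m(1) by (simp add: smult_assoc1)
      then show ?thesis using c[OF x] r pc[of "r \<otimes>\<^bsub>R\<^esub> c x" "r \<odot>\<^bsub>M\<^esub> x"] by (simp add: p_smult)
    qed
  qed
  then show ?thesis using N by (auto simp: Q_def S_def K_def)
qed

text \<open>The multiples of \<open>m\<close> form a submodule that is nonzero because it contains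
  \<open>m\<close>.\<close>

lemma simple_module_cyclic:
  assumes "simple_module R M" "m \<in> carrier M" "m \<noteq> \<zero>\<^bsub>M\<^esub>" "x \<in> carrier M"
  shows "\<exists>r\<in>carrier R. x = r \<odot>\<^bsub>M\<^esub> m"
proof -
  interpret left_module R M using assms(1) by (simp add: simple_module_def)
  define N where "N = (\<lambda>r. r \<odot>\<^bsub>M\<^esub> m) ` carrier R"
  have "submodule N R M"
  proof (rule submoduleI)
    show "N \<subseteq> carrier M" using assms(2) by (auto simp: N_def)
    show "\<zero>\<^bsub>M\<^esub> \<in> N" unfolding N_def using assms(2) by (intro image_eqI[of _ _ "\<zero>\<^bsub>R\<^esub>"]) auto
    show "x \<oplus>\<^bsub>M\<^esub> y \<in> N" if "x \<in> N" "y \<in> N" for x y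
      using that assms(2) by (auto simp: N_def smult_l_distr[symmetric])
    show "a \<odot>\<^bsub>M\<^esub> x \<in> N" if "a \<in> carrier R" "x \<in> N" for a x
      using that assms(2) by (auto simp: N_def smult_assoc1[symmetric])
  qed
  moreover have "m \<in> N" unfolding N_def using assms(2) by (intro image_eqI[of _ _ "\<one>\<^bsub>R\<^esub>"]) auto
  ultimately have "N = carrier M" using assms(1,3) unfolding simple_module_def by blast
  then show ?thesis using assms(4) by (auto simp: N_def)
qed

theorem lemma6p1:
  shows "(\<forall>f :: 'd::finite \<Rightarrow> 'd laurent_op. (\<forall>i. star_form i (f i)) \<longrightarrow>
            (\<forall>N. submodule N weyl_algebra (S_module f) \<longrightarrow>
              finitely_generated_module U_h (quotient_module (S_module f) N)))
       \<and> (\<forall>f :: 'd \<Rightarrow> 'd laurent_op. (\<forall>i. star_form i (f i)) \<longrightarrow>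
            finite_composition_length weyl_algebra (S_module f))
       \<and> (\<forall>M :: ('d laurent_op, 'm) module.
            simple_module weyl_algebra M \<longrightarrow> finitely_generated_module U_h M \<longrightarrow>
            (\<exists>f :: 'd \<Rightarrow> 'd laurent_op. (\<forall>i. star_form i (f i)) \<and>
              (\<exists>N. submodule N weyl_algebra (S_module f) \<and>
                module_isomorphic weyl_algebra M (quotient_module (S_module f) N))))"
proof (intro conjI allI impI)
  fix f :: "'d \<Rightarrow> 'd laurent_op" and N
  assume f: "\<forall>i. star_form i (f i)"
  interpret weyl_module "S_module f"
    unfolding weyl_module_def by (rule left_module_S_module) (use f in simp)
  have fg: "finitely_generated_module U_h (S_module f)" using f by (simp add: finitely_generated_S_module)
  show "finite_composition_length weyl_algebra (S_module f)" by (rule finite_length[OF fg])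
  assume "submodule N weyl_algebra (S_module f)"
  then show "finitely_generated_module U_h (quotient_module (S_module f) N)"
    by (intro U.finitely_generated_quotient submodule_U_h fg)
next
  fix M :: "('d laurent_op, 'm) module"
  assume simple: "simple_module weyl_algebra M" and fg: "finitely_generated_module U_h M"
  then have M: "left_module weyl_algebra M" by (simp add: simple_module_def)
  interpret weyl_module M using M by (simp add: weyl_module_def)
  obtain m where m: "m \<in> carrier M" "m \<noteq> \<zero>\<^bsub>M\<^esub>"
    using simple M.zero_closed unfolding simple_module_def by blast
  have "\<forall>i. \<exists>f. star_form i f \<and> f \<odot>\<^bsub>M\<^esub> m = \<zero>\<^bsub>M\<^esub>"
    using star_form_annihilator[OF M fg m(1)] by blast
  then obtain f where f: "\<And>i. star_form i (f i)" "\<And>i. f i \<odot>\<^bsub>M\<^esub> m = \<zero>\<^bsub>M\<^esub>" by metis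
  note fw = star_form_in_weyl[OF f(1)]
  have "r \<odot>\<^bsub>M\<^esub> m = \<zero>\<^bsub>M\<^esub>" if r: "r \<in> left_ideal_sum weyl_algebra f" for r
  proof -
    obtain g where g: "g \<in> UNIV \<rightarrow> carrier weyl_algebra"
      "r = (\<Oplus>\<^bsub>weyl_algebra\<^esub>i\<in>UNIV. g i \<otimes>\<^bsub>weyl_algebra\<^esub> f i)"
      using r unfolding left_ideal_sum_def by blast
    have gf: "(\<lambda>i. g i \<otimes>\<^bsub>weyl_algebra\<^esub> f i) \<in> UNIV \<rightarrow> carrier weyl_algebra"
      using g(1) fw by (auto simp del: weyl_simps)
    have "(g i \<otimes>\<^bsub>weyl_algebra\<^esub> f i) \<odot>\<^bsub>M\<^esub> m = \<zero>\<^bsub>M\<^esub>" for i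
    proof -
      have gi: "g i \<in> carrier weyl_algebra" using g(1) by auto
      show ?thesis using smult_assoc1[OF gi fw m(1)] smult_r_null[OF gi] f(2) by simp
    qed
    then show ?thesis
      unfolding g(2) smult_finsum_l[OF finite gf m(1)] by (intro M.add.finprod_one_eqI) simp
  qed
  then have "\<exists>N. submodule N weyl_algebra (S_module f) \<and>
      module_isomorphic weyl_algebra M (quotient_module (S_module f) N)"
    unfolding S_module_def
    using cyclic_module_isomorphic[OF M star_ideal(1)[OF f(1)] m(1)] simple_module_cyclic[OF simple m] by blast
  then show "\<exists>f :: 'd \<Rightarrow> 'd laurent_op. (\<forall>i. star_form i (f i)) \<and>
      (\<exists>N. submodule N weyl_algebra (S_module f) \<and>
        module_isomorphic weyl_algebra M (quotient_module (S_module f) N))"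
    using f(1) by blast
qed

end
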